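(* Let $e\le h_1\le h_2\le\cdots\le h_{e-1}$ be positive integers such that $\gcd(e,h_1,h_2,\dots,h_{e-1})=1$. Set $H=\langle e,h_1,h_2,\dots,h_{e-1}\rangle$ and $R=k[[H]]$, where $k$ is a field. Let $K$ be the standard fractional canonical ideal of $R$ and $\mathfrak c=R:R[K]$ (see context). Assume that $R$ is a GGL ring with $e=e(R)=v(R)\ge3$. Set $n=\ell_R(R/\mathfrak c)>0$ and $H'=\langle e,h_1-ne,h_2-ne,\dots,h_{e-1}-ne\rangle$. Then the following assertions hold true: (1) $H'$ is symmetric, that is, $R'=k[[H']]$ is a Gorenstein ring, and (2) $\mathrm{Ap}_e(H')=\{0,h_1-ne,h_2-ne,\dots,h_{e-1}-ne\}$. Hence, $R$ is reconstructed by $\mathrm{Ap}_e(H')$ and $n>0$.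
   Context: For positive integers $a_1,\dots,a_\ell$ with gcd $1$, $H=\langle a_1,\dots,a_\ell\rangle=\{\sum c_ia_i\mid 0\le c_i\in\mathbb Z\}$ is the numerical semigroup they generate, and $k[[H]]=k[[t^{a_1},\dots,t^{a_\ell}]]\subseteq k[[t]]$, a one-dimensional Cohen-Macaulay local domain. For $0<e\in H$, the Apéry set is $\mathrm{Ap}_e(H)=\{h\in H\mid h-e\notin H\}$. Let $f=\max(\mathbb Z\setminus H)$ and $\mathrm{PF}(H)=\{m\in\mathbb Z\setminus H\mid m+a_i\in H\text{ for all }i\}$. The standard fractional canonical ideal of $R=k[[H]]$ is $K=\sum_{c\in\mathrm{PF}(H)}Rt^{f-c}\subseteq k[[t]]$; it is isomorphic to the canonical module $K_R$ and satisfies $R\subseteq K\subseteq\overline R=k[[t]]$. $R[K]$ is the subring generated by $K$ over $R$, and $R:R[K]=\{x\in Q(R)\mid xR[K]\subseteq R\}$, where $Q(R)$ is the fraction field. $e(R)$ is the multiplicity, $v(R)$ the embedding dimension, $\ell_R$ length. Let $\mathfrak m$ be the maximal ideal of $R$. A finitely generated $R$-module $C$ is an Ulrich $R$-module with respect to an $\mathfrak m$-primary ideal $\mathfrak a$ if $C$ is nonzero Cohen-Macaulay, $e_{\mathfrak a}^0(C)=\ell_R(C/\mathfrak aC)$ (multiplicity with respect to $\mathfrak a$), and $C/\mathfrak aC$ is $R/\mathfrak a$-free. $R$ is a GGL ring if for some $\mathfrak m$-primary ideal $\mathfrak a$ there is an exact sequence $0\to R\to K_R\to C\to0$ of $R$-modules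 with $C$ an Ulrich $R$-module with respect to $\mathfrak a$ and $K_R/\mathfrak aK_R$ free over $R/\mathfrak a$. *)

theory Defs
  imports
    "HOL-Computational_Algebra.Formal_Laurent_Series"
    "HOL-Library.Extended_Nat"
    "HOL-Algebra.Module"
    "HOL-Algebra.QuotRing"
    "HOL-Algebra.Generated_Rings"
    "HOL-Algebra.Ideal_Product"
    "HOL-Algebra.Ring_Divisibility"
begin

section \<open>Numerical semigroups\<close>

text \<open>
  Semigroups are sets of integers, so that gaps, Frobenius and pseudo-Frobenius numbers may be
  negative (for \<open>H = \<nat>\<close> the Frobenius number is \<open>-1\<close>) and no truncated subtraction occurs.
  The generating set is meant to be finite.
\<close>

definition semigroup_gen :: "int set \<Rightarrow> int set" where
  "semigroup_gen A = {\<Sum>a\<in>A. int (c a) * a | c. True}"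

definition apery :: "int \<Rightarrow> int set \<Rightarrow> int set" where
  "apery e H = {x \<in> H. x - e \<notin> H}"

text \<open>
  \<open>GREATEST\<close> and not \<open>Max\<close>: the complement of \<open>H\<close> in the integers is infinite, but bounded above.
\<close>

definition frobenius :: "int set \<Rightarrow> int" where
  "frobenius H = (GREATEST m. m \<notin> H)"

definition pseudo_frobenius :: "int set \<Rightarrow> int set" where
  "pseudo_frobenius A =
     {m. m \<notin> semigroup_gen A \<and> (\<forall>a\<in>A. m + a \<in> semigroup_gen A)}"

definition symmetric_semigroup :: "int set \<Rightarrow> bool" where
  "symmetric_semigroup H \<longleftrightarrow> (\<forall>m. m \<in> H \<longleftrightarrow> frobenius H - m \<notin> H)"


section \<open>Modules and ideals\<close>

definition self_module :: "('a, 'r) ring_scheme \<Rightarrow> ('a, 'a) module" where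
  "self_module R = \<lparr>carrier = carrier R, mult = mult R, one = one R,
     zero = zero R, add = add R, smult = mult R\<rparr>"

text \<open>
  The record type of modules extends that of rings; the fields \<open>mult\<close> and \<open>one\<close> play no role in
  the locale \<open>module\<close> and are left unspecified in quotients.
\<close>

definition quotient_module ::
    "('a, 'b, 'm) module_scheme \<Rightarrow> 'b set \<Rightarrow> ('a, 'b set) module" where
  "quotient_module M N = \<lparr>carrier = a_rcosets\<^bsub>M\<^esub> N, mult = undefined, one = undefined,
     zero = N, add = set_add M, smult = (\<lambda>r Y. \<Union>y\<in>Y. N +>\<^bsub>M\<^esub> (r \<odot>\<^bsub>M\<^esub> y))\<rparr>"

definition module_span ::
    "('a, 'r) ring_scheme \<Rightarrow> ('a, 'b, 'm) module_scheme \<Rightarrow> 'b set \<Rightarrow> 'b set" where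
  "module_span R M S = \<Inter>{N. submodule N R M \<and> S \<subseteq> N}"

definition ideal_times ::
    "('a, 'r) ring_scheme \<Rightarrow> 'a set \<Rightarrow> ('a, 'b, 'm) module_scheme \<Rightarrow> 'b set" where
  "ideal_times R I M = module_span R M {r \<odot>\<^bsub>M\<^esub> x | r x. r \<in> I \<and> x \<in> carrier M}"

text \<open>\<open>M/IM\<close>, first as a module over \<open>R\<close>, then as a module over the ring \<open>R Quot I\<close>.\<close>

definition reduction ::
    "('a, 'r) ring_scheme \<Rightarrow> 'a set \<Rightarrow> ('a, 'b, 'm) module_scheme \<Rightarrow> ('a, 'b set) module" where
  "reduction R I M = quotient_module M (ideal_times R I M)"

definition reduction_over_quot ::
    "('a, 'r) ring_scheme \<Rightarrow> 'a set \<Rightarrow> ('a, 'b, 'm) module_scheme \<Rightarrow> ('a set, 'b set) module" where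
  "reduction_over_quot R I M =
     (let N = ideal_times R I M in
      \<lparr>carrier = a_rcosets\<^bsub>M\<^esub> N, mult = undefined, one = undefined,
       zero = N, add = set_add M,
       smult = (\<lambda>X Y. \<Union>r\<in>X. \<Union>y\<in>Y. N +>\<^bsub>M\<^esub> (r \<odot>\<^bsub>M\<^esub> y))\<rparr>)"

definition fin_gen_module ::
    "('a, 'r) ring_scheme \<Rightarrow> ('a, 'b, 'm) module_scheme \<Rightarrow> bool" where
  "fin_gen_module R M \<longleftrightarrow>
     module R M \<and> (\<exists>S. finite S \<and> S \<subseteq> carrier M \<and> module_span R M S = carrier M)"

definition free_module ::
    "('a, 'r) ring_scheme \<Rightarrow> ('a, 'b, 'm) module_scheme \<Rightarrow> bool" where
  "free_module R M \<longleftrightarrow> module R M \<and>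
     (\<exists>B \<subseteq> carrier M. module_span R M B = carrier M \<and>
        (\<forall>F c. finite F \<longrightarrow> F \<subseteq> B \<longrightarrow> c \<in> F \<rightarrow> carrier R \<longrightarrow>
           (\<Oplus>\<^bsub>M\<^esub>b\<in>F. c b \<odot>\<^bsub>M\<^esub> b) = \<zero>\<^bsub>M\<^esub> \<longrightarrow> (\<forall>b\<in>F. c b = \<zero>\<^bsub>R\<^esub>)))"

definition linear_map ::
    "('a, 'r) ring_scheme \<Rightarrow> ('a, 'b, 'm) module_scheme \<Rightarrow> ('a, 'c, 'n) module_scheme
       \<Rightarrow> ('b \<Rightarrow> 'c) \<Rightarrow> bool" where
  "linear_map R M N f \<longleftrightarrow> f \<in> carrier M \<rightarrow> carrier N \<and>
     (\<forall>x\<in>carrier M. \<forall>y\<in>carrier M. f (x \<oplus>\<^bsub>M\<^esub> y) = f x \<oplus>\<^bsub>N\<^esub> f y) \<and>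
     (\<forall>r\<in>carrier R. \<forall>x\<in>carrier M. f (r \<odot>\<^bsub>M\<^esub> x) = r \<odot>\<^bsub>N\<^esub> f x)"

definition short_exact ::
    "('a, 'r) ring_scheme \<Rightarrow> ('a, 'b, 'm) module_scheme \<Rightarrow> ('a, 'c, 'n) module_scheme
       \<Rightarrow> ('a, 'd, 'l) module_scheme \<Rightarrow> ('b \<Rightarrow> 'c) \<Rightarrow> ('c \<Rightarrow> 'd) \<Rightarrow> bool" where
  "short_exact R L M N f g \<longleftrightarrow> linear_map R L M f \<and> linear_map R M N g \<and>
     inj_on f (carrier L) \<and> g ` carrier M = carrier N \<and>
     f ` carrier L = {x \<in> carrier M. g x = \<zero>\<^bsub>N\<^esub>}"

definition module_length ::
    "('a, 'r) ring_scheme \<Rightarrow> ('a, 'b, 'm) module_scheme \<Rightarrow> enat" where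
  "module_length R M = Sup {enat n | n.
     \<exists>N :: nat \<Rightarrow> 'b set. (\<forall>i\<le>n. submodule (N i) R M) \<and> (\<forall>i<n. N i \<subset> N (Suc i))}"

definition annihilator ::
    "('a, 'r) ring_scheme \<Rightarrow> ('a, 'b, 'm) module_scheme \<Rightarrow> 'a set" where
  "annihilator R M = {r \<in> carrier R. \<forall>x\<in>carrier M. r \<odot>\<^bsub>M\<^esub> x = \<zero>\<^bsub>M\<^esub>}"

text \<open>The Krull dimension of \<open>R/Ann M\<close>.\<close>

definition module_dim ::
    "('a, 'r) ring_scheme \<Rightarrow> ('a, 'b, 'm) module_scheme \<Rightarrow> enat" where
  "module_dim R M = Sup {enat n | n.
     \<exists>P :: nat \<Rightarrow> 'a set. (\<forall>i\<le>n. primeideal (P i) R \<and> annihilator R M \<subseteq> P i) \<and>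
       (\<forall>i<n. P i \<subset> P (Suc i))}"


section \<open>Local rings, Cohen-Macaulay modules and multiplicities\<close>

definition local_cring :: "('a, 'r) ring_scheme \<Rightarrow> bool" where
  "local_cring R \<longleftrightarrow> cring R \<and> (\<exists>!M. maximalideal M R)"

definition max_ideal :: "('a, 'r) ring_scheme \<Rightarrow> 'a set" where
  "max_ideal R = (THE M. maximalideal M R)"

definition radical :: "('a, 'r) ring_scheme \<Rightarrow> 'a set \<Rightarrow> 'a set" where
  "radical R I = {x \<in> carrier R. \<exists>n::nat. x [^]\<^bsub>R\<^esub> n \<in> I}"

definition m_primary :: "('a, 'r) ring_scheme \<Rightarrow> 'a set \<Rightarrow> bool" where
  "m_primary R I \<longleftrightarrow> ideal I R \<and> I \<noteq> carrier R \<and>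
     (\<forall>x\<in>carrier R. \<forall>y\<in>carrier R. x \<otimes>\<^bsub>R\<^esub> y \<in> I \<longrightarrow> x \<in> I \<or> y \<in> radical R I) \<and>
     radical R I = max_ideal R"

definition regular_sequence ::
    "('a, 'r) ring_scheme \<Rightarrow> ('a, 'b, 'm) module_scheme \<Rightarrow> 'a list \<Rightarrow> bool" where
  "regular_sequence R M xs \<longleftrightarrow> set xs \<subseteq> carrier R \<and>
     ideal_times R (Idl\<^bsub>R\<^esub> (set xs)) M \<noteq> carrier M \<and>
     (\<forall>i<length xs. \<forall>y\<in>carrier M.
        xs ! i \<odot>\<^bsub>M\<^esub> y \<in> ideal_times R (Idl\<^bsub>R\<^esub> (set (take i xs))) M \<longrightarrow>
        y \<in> ideal_times R (Idl\<^bsub>R\<^esub> (set (take i xs))) M)"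

definition module_depth ::
    "('a, 'r) ring_scheme \<Rightarrow> ('a, 'b, 'm) module_scheme \<Rightarrow> enat" where
  "module_depth R M =
     Sup {enat (length xs) | xs. set xs \<subseteq> max_ideal R \<and> regular_sequence R M xs}"

definition nonzero_cohen_macaulay ::
    "('a, 'r) ring_scheme \<Rightarrow> ('a, 'b, 'm) module_scheme \<Rightarrow> bool" where
  "nonzero_cohen_macaulay R M \<longleftrightarrow> fin_gen_module R M \<and> carrier M \<noteq> {\<zero>\<^bsub>M\<^esub>} \<and>
     module_depth R M = module_dim R M"

definition ideal_power :: "('a, 'r) ring_scheme \<Rightarrow> 'a set \<Rightarrow> nat \<Rightarrow> 'a set" where
  "ideal_power R I n = ((\<lambda>J. ideal_prod R I J) ^^ n) (carrier R)"

text \<open>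
  The Hilbert-Samuel multiplicity \<open>lim d! \<ell>(M/I\<^sup>n\<^sup>+\<^sup>1M) / n\<^sup>d\<close>, normalised with
  \<open>d = dim M\<close> (not \<open>dim R\<close>). The lengths are finite for finitely generated \<open>M\<close> over a
  Noetherian local ring and an \<open>I\<close> primary to the maximal ideal.
\<close>

definition multiplicity_wrt ::
    "('a, 'r) ring_scheme \<Rightarrow> 'a set \<Rightarrow> ('a, 'b, 'm) module_scheme \<Rightarrow> real" where
  "multiplicity_wrt R I M =
     (let d = the_enat (module_dim R M) in
      lim (\<lambda>n. fact d *
        real (the_enat (module_length R (reduction R (ideal_power R I (Suc n)) M))) / real n ^ d))"

definition ring_multiplicity :: "('a, 'r) ring_scheme \<Rightarrow> real" where
  "ring_multiplicity R = multiplicity_wrt R (max_ideal R) (self_module R)"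

definition embedding_dim :: "('a, 'r) ring_scheme \<Rightarrow> nat" where
  "embedding_dim R =
     (LEAST n. \<exists>S \<subseteq> carrier R. finite S \<and> card S = n \<and> Idl\<^bsub>R\<^esub> S = max_ideal R)"


section \<open>Gorenstein rings, Ulrich modules and GGL rings\<close>

definition parameter_ideal :: "('a, 'r) ring_scheme \<Rightarrow> 'a set \<Rightarrow> bool" where
  "parameter_ideal R Q \<longleftrightarrow> m_primary R Q \<and>
     (\<exists>xs. set xs \<subseteq> max_ideal R \<and> enat (length xs) = module_dim R (self_module R) \<and>
        Q = Idl\<^bsub>R\<^esub> (set xs))"

definition irreducible_ideal :: "('a, 'r) ring_scheme \<Rightarrow> 'a set \<Rightarrow> bool" where
  "irreducible_ideal R Q \<longleftrightarrow> ideal Q R \<and> Q \<noteq> carrier R \<and>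
     (\<forall>I J. ideal I R \<longrightarrow> ideal J R \<longrightarrow> Q = I \<inter> J \<longrightarrow> Q = I \<or> Q = J)"

text \<open>
  Of the equivalent definitions of a Gorenstein local ring (Matsumura, Commutative Ring Theory,
  Section 18), the one that quantifies over no modules or resolutions: a Cohen-Macaulay local ring
  in which every parameter ideal is irreducible.
\<close>

definition gorenstein_local :: "('a, 'r) ring_scheme \<Rightarrow> bool" where
  "gorenstein_local R \<longleftrightarrow> noetherian_ring R \<and> local_cring R \<and>
     nonzero_cohen_macaulay R (self_module R) \<and>
     (\<forall>Q. parameter_ideal R Q \<longrightarrow> irreducible_ideal R Q)"

definition ulrich_module ::
    "('a, 'r) ring_scheme \<Rightarrow> 'a set \<Rightarrow> ('a, 'b, 'm) module_scheme \<Rightarrow> bool" where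
  "ulrich_module R I C \<longleftrightarrow> nonzero_cohen_macaulay R C \<and>
     (\<exists>l. module_length R (reduction R I C) = enat l \<and> multiplicity_wrt R I C = real l) \<and>
     free_module (R Quot I) (reduction_over_quot R I C)"

text \<open>
  \<open>\<omega>\<close> stands for the canonical module of \<open>R\<close>. Any cokernel of a map into \<open>\<omega>\<close> is isomorphic to
  a module of cosets, so restricting \<open>C\<close> to carriers in \<open>'b set\<close> loses no exact sequence.
\<close>

definition ggl_ring :: "('a, 'r) ring_scheme \<Rightarrow> ('a, 'b) module \<Rightarrow> bool" where
  "ggl_ring R \<omega> \<longleftrightarrow>
     (\<exists>I (C :: ('a, 'b set) module) \<phi> \<psi>.
        m_primary R I \<and> module R C \<and> short_exact R (self_module R) \<omega> C \<phi> \<psi> \<and>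
        ulrich_module R I C \<and> free_module (R Quot I) (reduction_over_quot R I \<omega>))"


section \<open>Numerical semigroup rings\<close>

text \<open>
  Everything lives in the field \<open>k((t))\<close>: \<open>t\<^sup>m\<close> is \<^term>\<open>fls_X_intpow m\<close>, and \<open>k[[H]]\<close> consists of
  the series with exponents in \<open>H\<close>, which are power series when \<open>H\<close> has no negative element.
\<close>

definition fls_ring :: "'k::field fls ring" where
  "fls_ring = \<lparr>carrier = UNIV, mult = (*), one = 1, zero = 0, add = (+)\<rparr>"

definition semigroup_ring :: "int set \<Rightarrow> 'k::field fls ring" where
  "semigroup_ring H = fls_ring\<lparr>carrier := {x. \<forall>m. fls_nth x m \<noteq> 0 \<longrightarrow> m \<in> H}\<rparr>"

text \<open>An \<open>R\<close>-submodule of \<open>k((t))\<close>, as a module.\<close>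

definition fractional_module :: "'k::field fls set \<Rightarrow> ('k fls, 'k fls) module" where
  "fractional_module I = \<lparr>carrier = I, mult = (*), one = 1, zero = 0, add = (+), smult = (*)\<rparr>"

definition fraction_field :: "'k::field fls ring \<Rightarrow> 'k fls set" where
  "fraction_field R = {x / y | x y. x \<in> carrier R \<and> y \<in> carrier R \<and> y \<noteq> 0}"

definition colon :: "'k::field fls ring \<Rightarrow> 'k fls set \<Rightarrow> 'k fls set" where
  "colon R I = {x \<in> fraction_field R. \<forall>y\<in>I. x * y \<in> carrier R}"

definition adjoin :: "'k::field fls ring \<Rightarrow> 'k fls set \<Rightarrow> 'k fls set" where
  "adjoin R S = generate_ring fls_ring (carrier R \<union> S)"

definition canonical_ideal :: "int set \<Rightarrow> 'k::field fls set" where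
  "canonical_ideal A =
     {\<Sum>c\<in>pseudo_frobenius A. r c * fls_X_intpow (frobenius (semigroup_gen A) - c) | r.
        \<forall>c. r c \<in> carrier (semigroup_ring (semigroup_gen A))}"

end

theory Submission
  imports Defs
begin

text \<open>
  Let \<open>W\<close> be the set of the \<open>h\<^sub>i\<close> and \<open>M\<close> its maximum. Since \<open>R\<close> needs \<open>e\<close> generators of its maximal
  ideal, the generators \<open>e, h\<^sub>1, \<dots>\<close> of \<open>H\<close> are minimal, and this makes \<open>{0} \<union> W\<close> the Apery set of \<open>e\<close>,
  with \<open>u + v - e \<in> H\<close> for all \<open>u, v \<in> W\<close> (\<open>minimal_generators_apery_system\<close>). The pseudo-Frobenius
  numbers are then the \<open>w - e\<close>, and \<open>K\<close> is spanned by the monomials \<open>t\<^bsup>M - w\<^esup>\<close>.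

  The hypothesis that \<open>R\<close> is a GGL ring is used through two consequences, proved in \<open>ggl_conductor\<close>:
  the ideal \<open>R : K\<close> is stable under \<open>K\<close>, hence equal to \<open>\<cc> = R : R[K]\<close>, and \<open>K/\<cc>\<close> is free over \<open>R/\<cc>\<close>. Indeed
  the cokernel \<open>C\<close> of \<open>R \<rightarrow> K\<close> has dimension 0, where the Ulrich condition forces \<open>I C = 0\<close>; the
  annihilator of the free module \<open>C\<close> is \<open>I\<close>, and comparing orders and leading exponents of series one
  finds \<open>I = R : K\<close>. Freeness implies that a minimal generator \<open>t\<^bsup>M - w\<^esup> \<noteq> 1\<close> of \<open>K\<close> has
  annihilator \<open>\<cc>\<close> modulo \<open>R\<close> (\<open>minimal_generator_annihilator\<close>).

  In terms of exponents: if \<open>T\<close> is the set of exponents of \<open>\<cc>\<close>, then \<open>s \<in> H\<close> and \<open>s + M - w \<in> H\<close> for a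
  single \<open>w \<noteq> M\<close> imply \<open>s \<in> T\<close>, and \<open>T + (M - w) \<subseteq> T\<close>. The rest is arithmetic (\<open>shifted_apery_system\<close>):
  \<open>W \<subseteq> T\<close>, so \<open>H - T\<close> consists of \<open>0, e, \<dots>, (n - 1) e\<close> with \<open>n\<close> the length of \<open>R/\<cc>\<close>
  (\<open>length_monomial_quotient\<close>), each \<open>n e + M - w\<close> with \<open>w \<noteq> M\<close> is again an element of \<open>W\<close>, and this
  pairing of \<open>W\<close> makes the semigroup with Apery set \<open>{0} \<union> {w - n e | w \<in> W}\<close> symmetric.

  Finally a symmetric semigroup has a Gorenstein ring (\<open>gorenstein_if_symmetric\<close>), because with the
  Frobenius number \<open>f\<close> every submodule of \<open>k((t))\<close> that properly contains the ring contains \<open>t\<^bsup>f\<^esup>\<close>, so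
  proper nonzero principal ideals are irreducible.

  Series are handled concretely: ideals and modules are subsets of \<open>k((t))\<close>, and lengths are bounded by
  counting leading exponents.
\<close>

unbundle fps_syntax

section \<open>Laurent series and their supports\<close>

lemma fls_mult_nth_nonzeroE:
  fixes x y :: "'k::field fls"
  assumes "(x * y) $$ m \<noteq> 0"
  obtains i where "x $$ i \<noteq> 0" "y $$ (m - i) \<noteq> 0"
proof -
  have "\<exists>i. x $$ i * y $$ (m - i) \<noteq> 0"
    using assms unfolding fls_times_nth(2)[of x y m] by (meson sum.not_neutral_contains_not_neutral)
  then show thesis using that by auto
qed

lemma fls_mult_nth_single:
  fixes x y :: "'k::field fls"
  assumes "\<And>j. x $$ j \<noteq> 0 \<Longrightarrow> y $$ (m - j) \<noteq> 0 \<Longrightarrow> j = i"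
  shows "(x * y) $$ m = x $$ i * y $$ (m - i)"
proof -
  let ?S = "{fls_subdegree x..m - fls_subdegree y}" and ?f = "\<lambda>j. x $$ j * y $$ (m - j)"
  have z: "?f j = 0" if "j \<noteq> i" for j using assms[of j] that by auto
  have "(x * y) $$ m = sum ?f ?S" by (rule fls_times_nth(2))
  also have "\<dots> = ?f i"
  proof (cases "i \<in> ?S")
    case True
    have "sum ?f ?S = sum ?f {i}"
      by (rule sum.mono_neutral_right) (use True z in auto)
    then show ?thesis by simp
  next
    case False
    have "?f i = 0" using False by force
    with z have "?f j = 0" for j by (cases "j = i") auto
    then show ?thesis by (simp add: sum.neutral)
  qed
  finally show ?thesis .
qed

text \<open>
  The abbreviation \<open>fls_X_intpow\<close> is a shift of 1, whose exponent the simplifier rearranges; a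
  constant of its own keeps monomials recognisable.
\<close>

definition tpow :: "int \<Rightarrow> 'k::field fls" where
  "tpow i = fls_X_intpow i"

lemma tpow_nth [simp]: "tpow i $$ m = (if m = i then 1 else 0)"
  by (auto simp: tpow_def)

lemma tpow_mult_nth [simp]: "(tpow i * x) $$ m = x $$ (m - i)" "(x * tpow i) $$ m = x $$ (m - i)"
  by (simp_all add: tpow_def fls_X_intpow_times_conv_shift)

lemma tpow_nonzero [simp]: "tpow i \<noteq> 0"
  by (simp add: tpow_def)

lemma tpow_0 [simp]: "tpow 0 = 1"
  by (simp add: tpow_def)

lemma tpow_mult: "tpow i * tpow j = tpow (i + j)"
  by (rule fls_eqI) auto

lemma fls_mult_nth_below:
  fixes x y :: "'k::field fls"
  assumes "\<And>m. m < A \<Longrightarrow> x $$ m = 0" "\<And>m. m < B \<Longrightarrow> y $$ m = 0" "m < A + B"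
  shows "(x * y) $$ m = 0"
proof (rule ccontr)
  assume "(x * y) $$ m \<noteq> 0"
  then obtain i where "x $$ i \<noteq> 0" "y $$ (m - i) \<noteq> 0" by (rule fls_mult_nth_nonzeroE)
  then have "\<not> i < A" "\<not> m - i < B" using assms(1,2) by blast+
  with assms(3) show False by simp
qed

definition restrict_support :: "int set \<Rightarrow> 'k::field fls \<Rightarrow> 'k fls" where
  "restrict_support S x = Abs_fls (\<lambda>m. if m \<in> S then x $$ m else 0)"

lemma restrict_support_nth [simp]: "restrict_support S x $$ m = (if m \<in> S then x $$ m else 0)"
proof -
  have "\<forall>n<fls_subdegree x. (if n \<in> S then x $$ n else 0) = 0" by simp
  then show ?thesis unfolding restrict_support_def by (rule nth_Abs_fls_lower_bound)
qed

definition kspace :: "'k::field fls set \<Rightarrow> bool" where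
  "kspace V \<longleftrightarrow> 0 \<in> V \<and> (\<forall>x\<in>V. \<forall>y\<in>V. x + y \<in> V) \<and> (\<forall>c. \<forall>x\<in>V. fls_const c * x \<in> V)"

lemma kspace_diff_scaled: "kspace V \<Longrightarrow> x \<in> V \<Longrightarrow> y \<in> V \<Longrightarrow> x - fls_const c * y \<in> V"
  unfolding kspace_def
  by (metis add_uminus_conv_diff fls_const_uminus mult_minus_left)

text \<open>
  The exponents in \<open>G\<close> that are leading exponents of elements of \<open>V\<close> when all exponents outside
  \<open>G\<close> are ignored. For a subspace they measure its size modulo the elements that vanish on \<open>G\<close>,
  and replace dimensions in all length computations below.
\<close>

definition leads :: "int set \<Rightarrow> 'k::field fls set \<Rightarrow> int set" where
  "leads G V = {p \<in> G. \<exists>x\<in>V. x $$ p \<noteq> 0 \<and> (\<forall>q\<in>G. q < p \<longrightarrow> x $$ q = 0)}"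

lemma leads_mono: "V \<subseteq> W \<Longrightarrow> leads G V \<subseteq> leads G W"
  unfolding leads_def by blast

text \<open>
  Gaussian elimination: subtracting multiples of elements of \<open>V\<close> with the same leading exponent
  moves the leading exponent of an element of \<open>W\<close> up until nothing is left on \<open>G\<close>.
\<close>

lemma eq_if_leads_subset:
  assumes "finite G" and V: "kspace V" and W: "kspace W" and "V \<subseteq> W"
    and low: "\<And>x. x \<in> W \<Longrightarrow> (\<forall>q\<in>G. x $$ q = 0) \<Longrightarrow> x \<in> V"
    and leads: "leads G W \<subseteq> leads G V"
  shows "V = W"
proof -
  have "x \<in> V" if "x \<in> W" for x
    using that
  proof (induction "card {q \<in> G. \<exists>p\<in>G. p \<le> q \<and> x $$ p \<noteq> 0}" arbitrary: x rule: less_induct)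
    case less
    let ?Q = "\<lambda>x. {q \<in> G. \<exists>p\<in>G. p \<le> q \<and> x $$ p \<noteq> 0}"
    show ?case
    proof (cases "\<forall>q\<in>G. x $$ q = 0")
      case True with low less.prems show ?thesis by blast
    next
      case False
      let ?P = "{q \<in> G. x $$ q \<noteq> 0}"
      have fP: "finite ?P" "?P \<noteq> {}" using assms(1) False by auto
      define p where "p = Min ?P"
      have p: "p \<in> G" "x $$ p \<noteq> 0" using Min_in[OF fP] by (auto simp: p_def)
      have below: "x $$ q = 0" if "q \<in> G" "q < p" for q
        using that Min_le[OF fP(1), of q] by (force simp: p_def)
      have "p \<in> leads G W" using p below less.prems unfolding leads_def by blast
      then obtain y where y: "y \<in> V" "y $$ p \<noteq> 0" "\<And>q. q \<in> G \<Longrightarrow> q < p \<Longrightarrow> y $$ q = 0"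
        using leads unfolding leads_def by blast
      \<comment> \<open>\<open>c\<close> is chosen so that \<open>x - c y\<close> vanishes at \<open>p\<close> as well\<close>
      define c where "c = x $$ p / y $$ p"
      define z where "z = x - fls_const c * y"
      have zW: "z \<in> W" unfolding z_def using kspace_diff_scaled[OF W] less.prems y(1) assms(4) by blast
      have z0: "z $$ q = 0" if "q \<in> G" "q \<le> p" for q
        using that below y p by (cases "q = p") (auto simp: z_def c_def)
      have "?Q z \<subset> ?Q x"
      proof
        have later: "p < q" if "q \<in> ?Q z" for q
        proof -
          from that obtain r where "r \<in> G" "r \<le> q" "z $$ r \<noteq> 0" by blast
          then show ?thesis using z0[of r] by linarith
        qed
        show "?Q z \<subseteq> ?Q x"
        proof
          fix q assume q: "q \<in> ?Q z"
          then have "q \<in> G" "p \<le> q" using later[OF q] by simp_all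
          then show "q \<in> ?Q x" using p by blast
        qed
        have "p \<in> ?Q x" using p by blast
        moreover have "p \<notin> ?Q z" using later[of p] by blast
        ultimately have "?Q x \<noteq> ?Q z" by metis
        then show "?Q z \<noteq> ?Q x" by simp
      qed
      then have "card (?Q z) < card (?Q x)" using assms(1) by (simp add: psubset_card_mono)
      then have "z \<in> V" using less.hyps zW by blast
      then have "z - fls_const (- c) * y \<in> V" using y(1) V kspace_diff_scaled by blast
      then show ?thesis by (simp add: z_def)
    qed
  qed
  with assms(4) show ?thesis by blast
qed

text \<open>
  Each step of the chain adds a leading exponent, by elimination.
\<close>

lemma chain_length_le_card:
  fixes N :: "nat \<Rightarrow> 'k::field fls set"
  assumes "finite G" and "\<And>i. i \<le> m \<Longrightarrow> kspace (N i)" and "\<And>i. i < m \<Longrightarrow> N i \<subset> N (Suc i)"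
    and low: "\<And>x. x \<in> N m \<Longrightarrow> (\<forall>q\<in>G. x $$ q = 0) \<Longrightarrow> x \<in> N 0"
  shows "m \<le> card G"
proof -
  have up: "N 0 \<subseteq> N i \<and> N i \<subseteq> N m" if "i \<le> m" for i
  proof
    show "N 0 \<subseteq> N i" using that
    proof (induction i)
      case (Suc i) then show ?case using assms(3)[of i] by auto
    qed simp
    show "N i \<subseteq> N m" using that
    proof (induction rule: inc_induct)
      case (step j) then show ?case using assms(3)[of j] by auto
    qed simp
  qed
  have "i \<le> card (leads G (N i))" if "i \<le> m" for i
    using that
  proof (induction i)
    case (Suc i)
    have "leads G (N i) \<noteq> leads G (N (Suc i))"
    proof
      assume "leads G (N i) = leads G (N (Suc i))"
      moreover have "x \<in> N i" if "x \<in> N (Suc i)" "\<forall>q\<in>G. x $$ q = 0" for x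
      proof -
        have "x \<in> N m" using that(1) up[of "Suc i"] Suc.prems by blast
        then have "x \<in> N 0" using low that(2) by blast
        then show ?thesis using up[of i] Suc.prems Suc_leD by blast
      qed
      moreover have "N i \<subseteq> N (Suc i)" "kspace (N i)" "kspace (N (Suc i))"
        using assms(2)[of i] assms(2)[of "Suc i"] assms(3)[of i] Suc.prems by auto
      ultimately have "N i = N (Suc i)"
        using eq_if_leads_subset[OF assms(1), of "N i" "N (Suc i)"] by simp
      then show False using assms(3)[of i] Suc.prems by auto
    qed
    moreover have "leads G (N i) \<subseteq> leads G (N (Suc i))"
      by (rule leads_mono) (use assms(3)[of i] Suc.prems in auto)
    moreover have "finite (leads G (N (Suc i)))" using assms(1) unfolding leads_def by simp
    ultimately have "card (leads G (N i)) < card (leads G (N (Suc i)))"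
      by (simp add: psubset_card_mono)
    with Suc show ?case by simp
  qed simp
  from this[of m] have "m \<le> card (leads G (N m))" by simp
  also have "\<dots> \<le> card G"
    by (rule card_mono) (use assms(1) in \<open>auto simp: leads_def\<close>)
  finally show ?thesis .
qed

section \<open>The local ring of a semigroup\<close>

locale semigroup_series =
  fixes H :: "int set" and R :: "'k::field fls ring"
  assumes zero_mem: "0 \<in> H" and add_mem: "x \<in> H \<Longrightarrow> y \<in> H \<Longrightarrow> x + y \<in> H"
    and nonneg: "x \<in> H \<Longrightarrow> 0 \<le> x" and R_def: "R = semigroup_ring H"
begin

lemma carrier_iff: "x \<in> carrier R \<longleftrightarrow> (\<forall>m. x $$ m \<noteq> 0 \<longrightarrow> m \<in> H)"
  by (simp add: R_def semigroup_ring_def)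

lemma R_ops [simp]: "mult R = (*)" "one R = 1" "zero R = 0" "add R = (+)"
  by (simp_all add: R_def semigroup_ring_def fls_ring_def)

lemma mult_closed: "x \<in> carrier R \<Longrightarrow> y \<in> carrier R \<Longrightarrow> x * y \<in> carrier R"
  unfolding carrier_iff
proof (intro allI impI)
  fix m assume x: "\<forall>m. x $$ m \<noteq> 0 \<longrightarrow> m \<in> H" and y: "\<forall>m. y $$ m \<noteq> 0 \<longrightarrow> m \<in> H" and "(x * y) $$ m \<noteq> 0"
  from this(3) obtain i where "x $$ i \<noteq> 0" "y $$ (m - i) \<noteq> 0" by (rule fls_mult_nth_nonzeroE)
  with x y have "i + (m - i) \<in> H" by (intro add_mem) auto
  then show "m \<in> H" by simp
qed

lemma closed [simp]: "0 \<in> carrier R" "1 \<in> carrier R" "fls_const c \<in> carrier R"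
  using zero_mem by (auto simp: carrier_iff)

lemma add_closed: "x \<in> carrier R \<Longrightarrow> y \<in> carrier R \<Longrightarrow> x + y \<in> carrier R"
  by (auto simp: carrier_iff) (metis add.right_neutral)

lemma uminus_closed: "x \<in> carrier R \<Longrightarrow> - x \<in> carrier R"
  by (auto simp: carrier_iff)

lemma diff_closed: "x \<in> carrier R \<Longrightarrow> y \<in> carrier R \<Longrightarrow> x - y \<in> carrier R"
  using add_closed[OF _ uminus_closed] by fastforce

lemma monomial_mem_iff [simp]: "tpow m \<in> carrier R \<longleftrightarrow> m \<in> H"
  by (auto simp: carrier_iff)

lemma nth_neg: "x \<in> carrier R \<Longrightarrow> m < 0 \<Longrightarrow> x $$ m = 0"
  using nonneg by (force simp: carrier_iff)

text \<open>
  Among the exponents of the inverse \<open>y\<close> outside \<open>H\<close> take the least one, \<open>i\<close>. In the coefficient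
  of \<open>x y = 1\<close> at \<open>i\<close> a second nonzero term would write \<open>i\<close> as a sum of two elements of \<open>H\<close>, so
  the coefficient is \<open>x\<^sub>0 y\<^sub>i\<close>, which is not zero.
\<close>

lemma inverse_closed:
  assumes x: "x \<in> carrier R" and x0: "x $$ 0 \<noteq> 0"
  shows "inverse x \<in> carrier R"
proof (rule ccontr)
  let ?y = "inverse x"
  assume "?y \<notin> carrier R"
  then obtain m0 where m0: "?y $$ m0 \<noteq> 0" "m0 \<notin> H" by (auto simp: carrier_iff)
  have "x \<noteq> 0" using x0 by auto
  have sub: "fls_subdegree x = 0"
    by (rule fls_subdegree_eqI[OF x0]) (use nth_neg[OF x] in auto)
  have ny: "?y $$ m = 0" if "m < 0" for m
    using that sub by (intro fls_eq0_below_subdegree) simp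
  let ?bad = "\<lambda>i::nat. ?y $$ (int i) \<noteq> 0 \<and> int i \<notin> H"
  have "?bad (nat m0)" using m0 ny[of m0] by (cases "m0 < 0") auto
  define i where "i = (LEAST i. ?bad i)"
  have i: "?bad i" unfolding i_def by (rule LeastI) fact
  have least: "\<not> ?bad j" if "j < i" for j using that unfolding i_def by (rule not_less_Least)
  have "(x * ?y) $$ int i = x $$ 0 * ?y $$ (int i - 0)"
  proof (rule fls_mult_nth_single)
    fix j assume j: "x $$ j \<noteq> 0" "?y $$ (int i - j) \<noteq> 0"
    have jH: "j \<in> H" using x j by (simp add: carrier_iff)
    then have j0: "0 \<le> j" by (rule nonneg)
    show "j = 0"
    proof (rule ccontr)
      assume "j \<noteq> 0"
      have "0 \<le> int i - j" using j(2) ny[of "int i - j"] by (cases "int i - j < 0") auto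
      with \<open>j \<noteq> 0\<close> j0 have "nat (int i - j) < i" "int (nat (int i - j)) = int i - j" by auto
      with least[of "nat (int i - j)"] j(2) have "int i - j \<in> H" by auto
      with jH add_mem[of j "int i - j"] i show False by simp
    qed
  qed
  moreover have "x * ?y = 1" using \<open>x \<noteq> 0\<close> by simp
  moreover have "int i \<noteq> 0" using i zero_mem by metis
  ultimately show False using x0 i by auto
qed

lemma cring_R: "cring R"
proof (rule cringI)
  show "abelian_group R"
  proof (rule abelian_groupI)
    fix x assume "x \<in> carrier R"
    then show "\<exists>y\<in>carrier R. y \<oplus>\<^bsub>R\<^esub> x = \<zero>\<^bsub>R\<^esub>"
      by (intro bexI[of _ "- x"]) (auto simp: uminus_closed)
  qed (auto simp: add_closed ac_simps)
  show "comm_monoid R"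
    by (rule comm_monoidI) (auto simp: mult_closed ac_simps)
qed (auto simp: algebra_simps)

lemma domain_R: "domain R"
  by (rule domain.intro[OF cring_R], unfold_locales) auto

lemma pow_R: "x [^]\<^bsub>R\<^esub> (n::nat) = x ^ n"
  by (induction n) (auto simp: nat_pow_def ac_simps)

subsection \<open>Submodules of the field of Laurent series\<close>

text \<open>
  The common generalisation of ideals, fractional ideals and their submodules, with the ordinary
  operations of \<open>k((t))\<close>. The next lemmas translate it to the record-based notions.
\<close>

definition series_module :: "'k fls set \<Rightarrow> bool" where
  "series_module V \<longleftrightarrow> 0 \<in> V \<and> (\<forall>x\<in>V. \<forall>y\<in>V. x + y \<in> V) \<and> (\<forall>r\<in>carrier R. \<forall>x\<in>V. r * x \<in> V)"

lemma series_moduleI: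
  assumes "0 \<in> V" "\<And>x y. x \<in> V \<Longrightarrow> y \<in> V \<Longrightarrow> x + y \<in> V"
    "\<And>r x. r \<in> carrier R \<Longrightarrow> x \<in> V \<Longrightarrow> r * x \<in> V"
  shows "series_module V"
  using assms unfolding series_module_def by blast

lemma series_moduleD:
  assumes "series_module V"
  shows "0 \<in> V" "x \<in> V \<Longrightarrow> y \<in> V \<Longrightarrow> x + y \<in> V" "r \<in> carrier R \<Longrightarrow> x \<in> V \<Longrightarrow> r * x \<in> V"
    "x \<in> V \<Longrightarrow> - x \<in> V" "x \<in> V \<Longrightarrow> y \<in> V \<Longrightarrow> x - y \<in> V"
proof -
  show a: "0 \<in> V" "x \<in> V \<Longrightarrow> y \<in> V \<Longrightarrow> x + y \<in> V" "r \<in> carrier R \<Longrightarrow> x \<in> V \<Longrightarrow> r * x \<in> V" for x y r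
    using assms unfolding series_module_def by blast+
  show b: "x \<in> V \<Longrightarrow> - x \<in> V" for x
    using a(3)[of "- 1" x] uminus_closed[of 1] by simp
  show "x \<in> V \<Longrightarrow> y \<in> V \<Longrightarrow> x - y \<in> V"
    using a(2)[of x "- y"] b[of y] by simp
qed

lemma series_module_sum:
  "series_module V \<Longrightarrow> (\<And>i. i \<in> A \<Longrightarrow> f i \<in> V) \<Longrightarrow> sum f A \<in> V"
  by (induction A rule: infinite_finite_induct) (auto simp: series_moduleD)

lemma kspace_if_series_module: "series_module V \<Longrightarrow> kspace V"
  by (simp add: kspace_def series_moduleD)

lemma series_module_carrier: "series_module (carrier R)"
  by (rule series_moduleI) (auto simp: add_closed mult_closed)

lemma series_module_scale:
  assumes V: "series_module V" shows "series_module {r * a | r. r \<in> V}"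
proof (rule series_moduleI)
  show "0 \<in> {r * a | r. r \<in> V}" using series_moduleD(1)[OF V] by (auto intro!: exI[of _ 0])
next
  fix x y assume "x \<in> {r * a | r. r \<in> V}" "y \<in> {r * a | r. r \<in> V}"
  then obtain r s where "x = r * a" "y = s * a" "r \<in> V" "s \<in> V" by blast
  then show "x + y \<in> {r * a | r. r \<in> V}"
    by (auto intro!: exI[of _ "r + s"] simp: series_moduleD(2)[OF V] distrib_right)
next
  fix r x assume "r \<in> carrier R" "x \<in> {r * a | r. r \<in> V}"
  then show "r * x \<in> {r * a | r. r \<in> V}"
    using series_moduleD(3)[OF V] by (auto simp flip: mult.assoc)
qed

lemma series_module_plus:
  assumes U: "series_module U" and V: "series_module V"
  shows "series_module {u + v | u v. u \<in> U \<and> v \<in> V}"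
proof (rule series_moduleI)
  show "0 \<in> {u + v | u v. u \<in> U \<and> v \<in> V}"
    using series_moduleD(1)[OF U] series_moduleD(1)[OF V] by (intro CollectI exI[of _ 0]) auto
next
  fix x y assume "x \<in> {u + v | u v. u \<in> U \<and> v \<in> V}" "y \<in> {u + v | u v. u \<in> U \<and> v \<in> V}"
  then obtain u v u' v' where *: "x = u + v" "y = u' + v'" "u \<in> U" "u' \<in> U" "v \<in> V" "v' \<in> V" by blast
  have "x + y = (u + u') + (v + v')" using * by simp
  then show "x + y \<in> {u + v | u v. u \<in> U \<and> v \<in> V}"
    using * series_moduleD(2)[OF U] series_moduleD(2)[OF V] by blast
next
  fix r x assume r: "r \<in> carrier R" and "x \<in> {u + v | u v. u \<in> U \<and> v \<in> V}"
  then obtain u v where *: "x = u + v" "u \<in> U" "v \<in> V" by blast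
  have "r * x = r * u + r * v" using * by (simp add: distrib_left)
  then show "r * x \<in> {u + v | u v. u \<in> U \<and> v \<in> V}"
    using * series_moduleD(3)[OF U r] series_moduleD(3)[OF V r] by blast
qed

lemmas series_module_principal = series_module_scale[OF series_module_carrier]

lemma fractional_ops [simp]:
  "carrier (fractional_module K) = K" "zero (fractional_module K) = 0"
  "add (fractional_module K) = (+)" "smult (fractional_module K) = (*)"
  by (simp_all add: fractional_module_def)

lemma self_module_eq: "self_module R = fractional_module (carrier R)"
  by (simp add: self_module_def fractional_module_def)

lemma module_fractional:
  assumes "series_module K" shows "module R (fractional_module K)"
proof (rule moduleI)
  show "cring R" by (rule cring_R)
  show "abelian_group (fractional_module K)"
  proof (rule abelian_groupI)
    fix x assume "x \<in> carrier (fractional_module K)"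
    then show "\<exists>y\<in>carrier (fractional_module K). y \<oplus>\<^bsub>fractional_module K\<^esub> x = \<zero>\<^bsub>fractional_module K\<^esub>"
      using assms by (intro bexI[of _ "- x"]) (auto simp: series_moduleD)
  qed (use assms in \<open>auto simp: series_moduleD ac_simps\<close>)
qed (use assms in \<open>auto simp: series_moduleD algebra_simps\<close>)

lemma fractional_uminus:
  assumes "series_module K" "x \<in> K" shows "\<ominus>\<^bsub>fractional_module K\<^esub> x = - x"
proof -
  interpret module R "fractional_module K" using assms(1) by (rule module_fractional)
  show ?thesis
    by (rule minus_equality) (use assms in \<open>auto simp: series_moduleD\<close>)
qed

lemma submodule_iff:
  assumes "series_module K"
  shows "submodule V R (fractional_module K) \<longleftrightarrow> V \<subseteq> K \<and> series_module V"
proof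
  interpret module R "fractional_module K" using assms by (rule module_fractional)
  { assume s: "submodule V R (fractional_module K)"
    note E = submoduleE[OF s]
    have V: "V \<subseteq> K" using E(1) by simp
    have "series_module V"
    proof (rule series_moduleI)
      obtain x where "x \<in> V" using E(2) by blast
      then show "0 \<in> V" using E(4)[of 0 x] by simp
    qed (use E in auto)
    with V show "V \<subseteq> K \<and> series_module V" ..
  }
  assume V: "V \<subseteq> K \<and> series_module V"
  then show "submodule V R (fractional_module K)"
    by (intro submoduleI) (auto simp: series_moduleD fractional_uminus[OF assms] subset_iff)
qed

lemma ideal_iff: "ideal V R \<longleftrightarrow> V \<subseteq> carrier R \<and> series_module V"
proof
  interpret cring R by (rule cring_R)
  { assume i: "ideal V R"
    interpret ideal V R by fact
    have "series_module V"
      by (rule series_moduleI)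
         (use a_closed zero_closed I_l_closed in \<open>auto simp: additive_subgroup.zero_closed\<close>)
    then show "V \<subseteq> carrier R \<and> series_module V" using a_subset by simp }
  assume V: "V \<subseteq> carrier R \<and> series_module V"
  have "\<ominus>\<^bsub>R\<^esub> x = - x" if "x \<in> carrier R" for x
    by (rule minus_equality) (use that in \<open>auto simp: uminus_closed\<close>)
  moreover have "V \<noteq> {}" using V series_moduleD(1) by blast
  moreover have "x * a \<in> V" "a * x \<in> V" if "a \<in> V" "x \<in> carrier R" for a x
    using that V series_moduleD(3)[of V x a] by (simp_all add: mult.commute)
  ultimately show "ideal V R" using V
    by (intro idealI ring_axioms add.subgroupI) (auto simp: series_moduleD subset_iff)
qed

lemma module_span_eq:
  "series_module K \<Longrightarrow> module_span R (fractional_module K) S = \<Inter>{V. V \<subseteq> K \<and> series_module V \<and> S \<subseteq> V}"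
  unfolding module_span_def by (simp add: submodule_iff conj_assoc)

lemma genideal_eq: "Idl\<^bsub>R\<^esub> S = \<Inter>{V. V \<subseteq> carrier R \<and> series_module V \<and> S \<subseteq> V}"
  unfolding genideal_def by (simp add: ideal_iff conj_assoc)

lemma series_module_Inter: "\<forall>V\<in>\<V>. series_module V \<Longrightarrow> series_module (\<Inter>\<V>)"
  by (rule series_moduleI) (auto simp: series_moduleD)

subsection \<open>The maximal ideal\<close>

definition nonunits :: "'k fls set" where
  "nonunits = {x \<in> carrier R. x $$ 0 = 0}"

lemma mult_nth_0:
  assumes x: "\<And>m. m < 0 \<Longrightarrow> x $$ m = 0" and y: "\<And>m. m < 0 \<Longrightarrow> y $$ m = 0"
  shows "(x * y) $$ 0 = x $$ 0 * (y $$ 0 :: 'k)"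
  using fls_mult_nth_single[of x y 0 0] x y by (force simp: not_less[symmetric])

lemma series_module_nonunits: "series_module nonunits"
  by (rule series_moduleI)
     (auto simp: nonunits_def add_closed mult_closed mult_nth_0 nth_neg)

lemma module_eq_carrier_if_unit:
  assumes "series_module V" "V \<subseteq> carrier R" "x \<in> V" "x $$ 0 \<noteq> 0"
  shows "V = carrier R"
proof -
  have "x \<noteq> 0" using assms(4) by auto
  then have "y = (y * inverse x) * x" for y by simp
  moreover have "y * inverse x \<in> carrier R" if "y \<in> carrier R" for y
    using that assms inverse_closed mult_closed by blast
  ultimately have "carrier R \<subseteq> V" using series_moduleD(3)[OF assms(1) _ assms(3)] by (metis subsetI)
  with assms(2) show ?thesis by blast
qed

lemma proper_subset_nonunits:
  "series_module V \<Longrightarrow> V \<subseteq> carrier R \<Longrightarrow> V \<noteq> carrier R \<Longrightarrow> V \<subseteq> nonunits"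
  using module_eq_carrier_if_unit unfolding nonunits_def by blast

lemma one_notin_nonunits: "1 \<notin> nonunits" and nonunits_subset: "nonunits \<subseteq> carrier R"
  by (auto simp: nonunits_def)

lemma maximalideal_nonunits: "maximalideal nonunits R"
proof (rule maximalidealI)
  show "ideal nonunits R" using series_module_nonunits nonunits_subset by (simp add: ideal_iff)
  show "carrier R \<noteq> nonunits" using one_notin_nonunits closed(2) by blast
  show "J = nonunits \<or> J = carrier R" if "ideal J R" "nonunits \<subseteq> J" "J \<subseteq> carrier R" for J
    using that proper_subset_nonunits by (auto simp: ideal_iff)
qed

lemma maximalideal_iff: "maximalideal M R \<longleftrightarrow> M = nonunits"
proof
  assume M: "maximalideal M R"
  then have "ideal M R" "carrier R \<noteq> M" by (auto simp: maximalideal_def maximalideal_axioms_def)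
  then have "M \<subseteq> nonunits" using proper_subset_nonunits by (auto simp: ideal_iff)
  then show "M = nonunits"
    using maximalideal.I_maximal[OF M, of nonunits] maximalideal_nonunits one_notin_nonunits closed(2)
      nonunits_subset by (auto simp: maximalideal_def)
qed (simp add: maximalideal_nonunits)

lemma max_ideal_eq: "max_ideal R = nonunits"
  by (simp add: max_ideal_def maximalideal_iff)

lemma local_cring_R: "local_cring R"
  by (simp add: local_cring_def cring_R maximalideal_iff)

end

section \<open>Rings of numerical semigroups\<close>

locale numerical_semigroup_series = semigroup_series +
  fixes F :: int
  assumes conductor: "F \<le> m \<Longrightarrow> m \<in> H"
begin

lemma F_nonneg: "0 \<le> F"
  using conductor[of F] nonneg by simp

lemma high_mem_carrier: "(\<And>m. m < F \<Longrightarrow> x $$ m = 0) \<Longrightarrow> x \<in> carrier R"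
  using conductor by (force simp: carrier_iff not_less[symmetric])

text \<open>
  \<open>y = (y/a) a\<close>, and the order of \<open>y/a\<close> is beyond the conductor.
\<close>

lemma high_mem_module:
  assumes V: "series_module V" "a \<in> V" "a \<noteq> 0"
    and y: "\<And>m. m < fls_subdegree a + F \<Longrightarrow> y $$ m = 0"
  shows "y \<in> V"
proof (cases "y = 0")
  case False
  have "fls_subdegree a + F \<le> fls_subdegree y"
    using False y by (intro fls_subdegree_geI) auto
  then have "F \<le> fls_subdegree (y * inverse a)" using False V(3) by simp
  then have "y * inverse a \<in> carrier R" by (intro high_mem_carrier) simp
  then have "(y * inverse a) * a \<in> V" using V series_moduleD(3) by blast
  then show ?thesis using V(3) by (simp add: mult.assoc)
qed (use V in \<open>simp add: series_moduleD\<close>)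

lemma nonunit_power_nth:
  assumes "x \<in> nonunits" shows "m < int n \<Longrightarrow> (x ^ n) $$ m = 0"
proof (induction n arbitrary: m)
  case 0 then show ?case by simp
next
  case (Suc n)
  have "x $$ m = 0" if "m < 1" for m
    using that assms nth_neg[of x m] by (cases "m = 0") (auto simp: nonunits_def)
  then have "(x * x ^ n) $$ m = 0"
    using Suc by (intro fls_mult_nth_below[of 1 x "int n" "x ^ n"]) auto
  then show ?case by simp
qed

text \<open>
  High powers of a nonunit have high order, so they lie in \<open>P\<close>.
\<close>

lemma prime_eq_nonunits:
  assumes P: "primeideal P R" and high: "\<And>y. (\<And>m. m < N \<Longrightarrow> y $$ m = 0) \<Longrightarrow> y \<in> P"
  shows "P = nonunits"
proof
  interpret primeideal P R by fact
  have P': "P \<subseteq> carrier R" "series_module P" using is_ideal by (auto simp: ideal_iff)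
  show "P \<subseteq> nonunits" using P' I_notcarr proper_subset_nonunits by blast
  show "nonunits \<subseteq> P"
  proof
    fix x assume x: "x \<in> nonunits"
    then have xR: "x \<in> carrier R" by (simp add: nonunits_def)
    have pow: "x ^ n \<in> carrier R" for n by (induction n) (auto simp: mult_closed xR)
    have "x ^ nat N \<in> P" by (rule high) (use nonunit_power_nth[OF x] in auto)
    moreover have "x \<in> P" if "x ^ n \<in> P" for n
      using that
    proof (induction n)
      case 0
      then have "P = carrier R" using module_eq_carrier_if_unit[OF P'(2,1), of 1] by simp
      then show ?case using I_notcarr by simp
    next
      case (Suc n)
      then show ?case using I_prime[of x "x ^ n"] xR pow by auto
    qed
    ultimately show "x \<in> P" by blast
  qed
qed

lemma nonzero_prime_eq_nonunits:
  assumes P: "primeideal P R" and "a \<in> P" "a \<noteq> 0" shows "P = nonunits"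
proof -
  have "series_module P" using P by (simp add: primeideal_def ideal_iff)
  then show ?thesis using high_mem_module assms prime_eq_nonunits[OF P] by blast
qed

lemma exists_nonzero_nonunit: "tpow (F + 1) \<in> nonunits"
  using F_nonneg conductor[of "F + 1"] by (simp add: nonunits_def)

lemma genideal_subset: "S \<subseteq> carrier R \<Longrightarrow> Idl\<^bsub>R\<^esub> S \<subseteq> carrier R"
  and genideal_module: "series_module (Idl\<^bsub>R\<^esub> S)" and genideal_contains: "S \<subseteq> Idl\<^bsub>R\<^esub> S"
  unfolding genideal_eq using series_module_carrier
  by (auto intro!: series_module_Inter)

lemma genideal_least: "V \<subseteq> carrier R \<Longrightarrow> series_module V \<Longrightarrow> S \<subseteq> V \<Longrightarrow> Idl\<^bsub>R\<^esub> S \<subseteq> V"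
  unfolding genideal_eq by blast

lemma genideal_empty: "Idl\<^bsub>R\<^esub> {} = {0}"
proof -
  have "series_module {0}" by (rule series_moduleI) auto
  then show ?thesis using genideal_least[of "{0}" "{}"] series_moduleD(1)[OF genideal_module] by auto
qed

lemma genideal_singleton:
  assumes "x \<in> carrier R" shows "Idl\<^bsub>R\<^esub> {x} = {r * x | r. r \<in> carrier R}"
proof
  have "x \<in> {r * x | r. r \<in> carrier R}" by (auto intro!: exI[of _ 1])
  then show "Idl\<^bsub>R\<^esub> {x} \<subseteq> {r * x | r. r \<in> carrier R}"
    using assms mult_closed by (intro genideal_least series_module_principal) auto
  show "{r * x | r. r \<in> carrier R} \<subseteq> Idl\<^bsub>R\<^esub> {x}"
    using genideal_contains[of "{x}"] series_moduleD(3)[OF genideal_module] by auto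
qed

text \<open>
  A nonzero ideal contains all series of high order. Finitely many leading exponents remain, and one
  element for each of them, together with any nonzero element, generates the ideal by elimination.
\<close>

lemma noetherian_R: "noetherian_ring R"
proof -
  interpret cring R by (rule cring_R)
  show ?thesis
  proof (rule noetherian_ringI)
    fix V assume "ideal V R"
    then have V: "V \<subseteq> carrier R" "series_module V" by (auto simp: ideal_iff)
    show "\<exists>A\<subseteq>carrier R. finite A \<and> V = Idl\<^bsub>R\<^esub> A"
    proof (cases "V = {0}")
      case True then show ?thesis using genideal_empty by (intro exI[of _ "{}"]) auto
    next
      case False
      then obtain a where a: "a \<in> V" "a \<noteq> 0" using series_moduleD(1)[OF V(2)] by blast
      define G where "G = {0..<fls_subdegree a + F}"
      have "\<forall>p\<in>leads G V. \<exists>x\<in>V. x $$ p \<noteq> 0 \<and> (\<forall>q\<in>G. q < p \<longrightarrow> x $$ q = 0)"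
        unfolding leads_def by blast
      then obtain y where y: "\<And>p. p \<in> leads G V \<Longrightarrow>
          y p \<in> V \<and> y p $$ p \<noteq> 0 \<and> (\<forall>q\<in>G. q < p \<longrightarrow> y p $$ q = 0)" by metis
      define A where "A = insert a (y ` leads G V)"
      have AV: "A \<subseteq> V" using a y by (auto simp: A_def)
      have "finite (leads G V)" by (rule finite_subset[of _ G]) (auto simp: leads_def G_def)
      then have fin: "finite A" unfolding A_def by simp
      have I: "A \<subseteq> Idl\<^bsub>R\<^esub> A" "series_module (Idl\<^bsub>R\<^esub> A)" by (rule genideal_contains genideal_module)+
      have "Idl\<^bsub>R\<^esub> A = V"
      proof (rule eq_if_leads_subset[of G])
        show "Idl\<^bsub>R\<^esub> A \<subseteq> V" using AV V by (intro genideal_least) auto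
        show "leads G V \<subseteq> leads G (Idl\<^bsub>R\<^esub> A)"
        proof
          fix p assume p: "p \<in> leads G V"
          then have "y p \<in> Idl\<^bsub>R\<^esub> A" "p \<in> G" using I(1) unfolding A_def leads_def by auto
          with y[OF p] show "p \<in> leads G (Idl\<^bsub>R\<^esub> A)" unfolding leads_def by blast
        qed
        show "x \<in> Idl\<^bsub>R\<^esub> A" if "x \<in> V" "\<forall>q\<in>G. x $$ q = 0" for x
        proof (rule high_mem_module[OF I(2) _ a(2)])
          show "a \<in> Idl\<^bsub>R\<^esub> A" using I(1) by (auto simp: A_def)
          show "x $$ m = 0" if "m < fls_subdegree a + F" for m
            using that \<open>\<forall>q\<in>G. x $$ q = 0\<close> \<open>x \<in> V\<close> V(1) nth_neg[of x m]
            by (cases "m < 0") (auto simp: G_def)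
        qed
      qed (auto simp: G_def kspace_if_series_module V I)
      then show ?thesis using AV V fin by (intro exI[of _ A]) auto
    qed
  qed
qed

lemma module_dim_self: "module_dim R (self_module R) = 1"
proof -
  have ann: "annihilator R (self_module R) = {0}"
    unfolding annihilator_def self_module_eq by (auto dest: bspec[of _ _ 1])
  let ?chain = "\<lambda>n P. (\<forall>i\<le>n. primeideal (P i) R \<and> annihilator R (self_module R) \<subseteq> P i) \<and>
       (\<forall>i<n. P i \<subset> P (Suc i))"
  have le: "n \<le> 1" if P: "?chain n P" for n P
  proof (rule ccontr)
    assume "\<not> n \<le> 1"
    then have sub: "P 0 \<subset> P 1" "P 1 \<subset> P 2" and prime: "primeideal (P 1) R" "primeideal (P 2) R"
      and "0 \<in> P 0" using P ann by (auto simp: numeral_2_eq_2)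
    then obtain a where "a \<in> P 1" "a \<noteq> 0" by blast
    moreover then have "a \<in> P 2" using sub by blast
    ultimately have "P 1 = nonunits" "P 2 = nonunits" using prime nonzero_prime_eq_nonunits by blast+
    with sub show False by simp
  qed
  have "primeideal {0} R"
    using domain.zeroprimeideal[OF domain_R] by simp
  moreover have "primeideal nonunits R"
    using cring.maximalideal_prime[OF cring_R maximalideal_nonunits] .
  moreover have "{0} \<subset> nonunits"
    using exists_nonzero_nonunit tpow_nonzero series_moduleD(1)[OF series_module_nonunits]
    by (metis empty_subsetI insert_subset psubsetI singletonD)
  ultimately have one: "?chain 1 (\<lambda>i. if i = 0 then {0} else nonunits)"
    using ann by auto
  show ?thesis unfolding module_dim_def
  proof (rule antisym)
    show "Sup {enat n |n. \<exists>P. ?chain n P} \<le> 1"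
      by (rule Sup_least) (use le in \<open>auto simp flip: one_enat_def simp: one_enat_def\<close>)
    show "1 \<le> Sup {enat n |n. \<exists>P. ?chain n P}"
      unfolding one_enat_def
      by (rule Sup_upper, rule CollectI, rule exI[of _ 1], rule conjI[OF refl], rule exI, rule one)
  qed
qed

lemma ideal_times_self:
  assumes "V \<subseteq> carrier R" "series_module V"
  shows "ideal_times R V (self_module R) = V"
  unfolding ideal_times_def self_module_eq module_span_eq[OF series_module_carrier]
proof
  let ?S = "{r \<odot>\<^bsub>fractional_module (carrier R)\<^esub> x |r x. r \<in> V \<and> x \<in> carrier (fractional_module (carrier R))}"
  have "r * x \<in> V" if "r \<in> V" "x \<in> carrier R" for r x
    using series_moduleD(3)[OF assms(2) that(2,1)] by (simp add: mult.commute)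
  then have "?S \<subseteq> V" by auto
  then show "\<Inter> {W. W \<subseteq> carrier R \<and> series_module W \<and> ?S \<subseteq> W} \<subseteq> V" using assms by blast
  have "V \<subseteq> ?S"
  proof
    fix x assume "x \<in> V"
    then show "x \<in> ?S" by (intro CollectI exI[of _ x] exI[of _ 1]) simp
  qed
  then show "V \<subseteq> \<Inter> {W. W \<subseteq> carrier R \<and> series_module W \<and> ?S \<subseteq> W}" by blast
qed

text \<open>
  If \<open>a\<close>, \<open>b\<close> were the start of a regular sequence, some power of \<open>b\<close> would lie in \<open>(a)\<close> since it
  has high order; cancelling \<open>b\<close> repeatedly would put 1 into \<open>(a)\<close>.
\<close>

lemma regular_sequence_length_le:
  assumes xs: "set xs \<subseteq> nonunits" "regular_sequence R (self_module R) xs"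
  shows "length xs \<le> 1"
proof (rule ccontr)
  assume "\<not> length xs \<le> 1"
  then obtain a b ys where ab: "xs = a # b # ys"
    by (cases xs; cases "tl xs") auto
  have mem: "a \<in> nonunits" "b \<in> nonunits" "a \<in> carrier R" "b \<in> carrier R"
    using xs(1) nonunits_subset by (auto simp: ab)
  have it: "ideal_times R (Idl\<^bsub>R\<^esub> S) (self_module R) = Idl\<^bsub>R\<^esub> S" if "S \<subseteq> carrier R" for S
    using that by (intro ideal_times_self genideal_module genideal_subset)
  have reg: "xs ! i * y \<in> Idl\<^bsub>R\<^esub> (set (take i xs)) \<Longrightarrow> y \<in> Idl\<^bsub>R\<^esub> (set (take i xs))"
    if "i < length xs" "y \<in> carrier R" for i y
  proof -
    have "set (take i xs) \<subseteq> carrier R"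
      using xs(1) set_take_subset[of i xs] nonunits_subset by blast
    from it[OF this] show "xs ! i * y \<in> Idl\<^bsub>R\<^esub> (set (take i xs)) \<Longrightarrow> y \<in> Idl\<^bsub>R\<^esub> (set (take i xs))"
      using xs(2) that unfolding regular_sequence_def by (auto simp: self_module_eq)
  qed
  have "a \<noteq> 0" using reg[of 0 1] by (auto simp: ab genideal_empty)
  let ?I = "Idl\<^bsub>R\<^esub> {a}"
  have I: "a \<in> ?I" "series_module ?I" using genideal_contains[of "{a}"] genideal_module by auto
  have "?I \<subseteq> nonunits"
    using genideal_least[OF nonunits_subset series_module_nonunits] mem by blast
  then have "1 \<notin> ?I" using one_notin_nonunits by blast
  moreover have "b ^ n \<in> ?I" if "n = nat (fls_subdegree a + F)" for n
    using nonunit_power_nth[OF mem(2), of _ n] that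
    by (intro high_mem_module[OF I(2,1) \<open>a \<noteq> 0\<close>]) auto
  moreover have "b ^ n \<in> carrier R" for n
    by (induction n) (auto simp: mult_closed mem)
  then have "b ^ Suc n \<in> ?I \<Longrightarrow> b ^ n \<in> ?I" for n
    using reg[of 1 "b ^ n"] by (simp add: ab)
  then have "b ^ n \<in> ?I \<Longrightarrow> b ^ 0 \<in> ?I" for n by (induction n) auto
  ultimately show False by (metis power_0)
qed

lemma module_depth_self: "module_depth R (self_module R) = 1"
  unfolding module_depth_def max_ideal_eq
proof (rule antisym)
  let ?D = "{enat (length xs) |xs. set xs \<subseteq> nonunits \<and> regular_sequence R (self_module R) xs}"
  show "Sup ?D \<le> 1"
    by (rule Sup_least) (use regular_sequence_length_le in \<open>auto simp: one_enat_def\<close>)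
  let ?x = "tpow (F + 1) :: 'a fls"
  have x: "?x \<in> nonunits" "?x \<in> carrier R" using exists_nonzero_nonunit nonunits_subset by auto
  have "Idl\<^bsub>R\<^esub> {?x} \<subseteq> nonunits"
    using genideal_least[OF nonunits_subset series_module_nonunits] x by blast
  then have "Idl\<^bsub>R\<^esub> {?x} \<noteq> carrier R" using one_notin_nonunits closed(2) by blast
  moreover have "ideal_times R (Idl\<^bsub>R\<^esub> {?x}) (self_module R) = Idl\<^bsub>R\<^esub> {?x}"
    using x by (intro ideal_times_self genideal_module genideal_subset) auto
  moreover have "ideal_times R {0} (self_module R) = {0}"
    using genideal_module[of "{}"] genideal_empty by (intro ideal_times_self) auto
  ultimately have "regular_sequence R (self_module R) [?x]"
    unfolding regular_sequence_def using x by (simp add: self_module_eq genideal_empty)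
  with x(1) have "enat (length [?x]) \<in> ?D" by (intro CollectI exI[of _ "[?x]"]) auto
  then have "enat (length [?x]) \<le> Sup ?D" by (rule Sup_upper)
  then show "1 \<le> Sup ?D" by (simp add: one_enat_def)
qed

lemma cohen_macaulay_self: "nonzero_cohen_macaulay R (self_module R)"
proof -
  have "V = carrier R" if "V \<subseteq> carrier R" "series_module V" "{1} \<subseteq> V" for V
    using module_eq_carrier_if_unit[OF that(2,1), of 1] that(3) by simp
  then have "{V. V \<subseteq> carrier R \<and> series_module V \<and> {1} \<subseteq> V} = {carrier R}"
    using series_module_carrier closed(2) by blast
  then have "module_span R (self_module R) {1} = carrier (self_module R)"
    unfolding self_module_eq module_span_eq[OF series_module_carrier] by simp
  then have "fin_gen_module R (self_module R)"
    unfolding fin_gen_module_def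
    by (intro conjI exI[of _ "{1}"])
      (simp_all add: self_module_eq module_fractional series_module_carrier)
  moreover have "carrier (self_module R) \<noteq> {\<zero>\<^bsub>self_module R\<^esub>}"
    using closed(2) zero_neq_one by (metis self_module_eq fractional_ops(1,2) singletonD)
  ultimately show ?thesis
    by (simp add: nonzero_cohen_macaulay_def module_depth_self module_dim_self)
qed

section \<open>Symmetric semigroups give Gorenstein rings\<close>

text \<open>
  This is the one-dimensional socle behind the Gorenstein property. Let \<open>m\<close> be the order of the part
  \<open>u\<close> of \<open>z\<close> with exponents outside \<open>H\<close>. By symmetry \<open>f - m \<in> H\<close>, and \<open>t\<^bsup>f - m\<^esup> u\<close> starts with a
  multiple of \<open>t\<^bsup>f\<^esup>\<close>; everything above \<open>f\<close> belongs to \<open>R\<close>.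
\<close>

lemma frobenius_monomial_mem:
  assumes sym: "\<And>m. m \<in> H \<longleftrightarrow> f - m \<notin> H"
    and V: "series_module V" "1 \<in> V" "z \<in> V" and z: "z \<notin> carrier R"
  shows "tpow f \<in> V"
proof -
  have RV: "r \<in> V" if "r \<in> carrier R" for r using series_moduleD(3)[OF V(1) that V(2)] by simp
  define u where "u = z - restrict_support H z"
  have u_nth: "u $$ m = (if m \<in> H then 0 else z $$ m)" for m by (simp add: u_def)
  have "restrict_support H z \<in> V" by (rule RV) (simp add: carrier_iff)
  then have uV: "u \<in> V" using V series_moduleD(5) by (simp add: u_def)
  obtain m0 where "z $$ m0 \<noteq> 0" "m0 \<notin> H" using z by (auto simp: carrier_iff)
  then have "u $$ m0 \<noteq> 0" by (simp add: u_nth)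
  then have "u \<noteq> 0" by auto
  define m where "m = fls_subdegree u"
  define c where "c = u $$ m"
  have "c \<noteq> 0" using \<open>u \<noteq> 0\<close> by (simp add: c_def m_def)
  then have "m \<notin> H" using u_nth[of m] by (auto simp: c_def split: if_splits)
  then have s: "f - m \<in> H" using sym by blast
  define v where "v = tpow (f - m) * u"
  have "v \<in> V" unfolding v_def using s uV V series_moduleD(3) by simp
  moreover have "v - fls_const c * tpow f \<in> carrier R"
    unfolding carrier_iff
  proof (intro allI impI)
    fix j assume j: "(v - fls_const c * tpow f) $$ j \<noteq> 0"
    have "f < j"
    proof (rule ccontr)
      assume "\<not> f < j"
      then consider "j = f" | "j < f" by linarith
      then show False
      proof cases
        case 1 then show ?thesis using j by (simp add: v_def c_def)
      next
        case 2
        then have "j - (f - m) < fls_subdegree u" by (simp add: m_def)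
        with j 2 show ?thesis by (simp add: v_def)
      qed
    qed
    then have "f - j \<notin> H" using nonneg[of "f - j"] by linarith
    then show "j \<in> H" using sym[of j] by blast
  qed
  ultimately have "v - (v - fls_const c * tpow f) \<in> V"
    using series_moduleD(5)[OF V(1)] RV by blast
  then have "fls_const c * tpow f \<in> V" by simp
  then have "fls_const (1 / c) * (fls_const c * tpow f) \<in> V"
    by (rule series_moduleD(3)[OF V(1) closed(3)])
  then show ?thesis using \<open>c \<noteq> 0\<close> by (simp flip: mult.assoc)
qed

text \<open>
  Dividing by \<open>x\<close> turns an ideal larger than \<open>x R\<close> into a fractional ideal larger than \<open>R\<close>, which
  contains \<open>t\<^bsup>f\<^esup>\<close>. Hence two such ideals share \<open>t\<^bsup>f\<^esup> x\<close>, which is not in \<open>x R\<close>.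
\<close>

lemma irreducible_principal:
  assumes sym: "\<And>m. m \<in> H \<longleftrightarrow> f - m \<notin> H" and x: "x \<in> nonunits" "x \<noteq> 0"
  shows "irreducible_ideal R (Idl\<^bsub>R\<^esub> {x})"
  unfolding irreducible_ideal_def
proof (intro conjI allI impI)
  let ?Q = "Idl\<^bsub>R\<^esub> {x}"
  have xR: "x \<in> carrier R" using x nonunits_subset by blast
  note Q = genideal_singleton[OF xR]
  show "ideal ?Q R" using xR by (simp add: ideal_iff genideal_module genideal_subset)
  have "?Q \<subseteq> nonunits" using genideal_least[OF nonunits_subset series_module_nonunits] x by blast
  then show "?Q \<noteq> carrier R" using one_notin_nonunits closed(2) by blast
  fix I J assume IJ: "ideal I R" "ideal J R" "?Q = I \<inter> J"
  have f: "f \<notin> H" using sym[of 0] zero_mem by simp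
  have socle: "tpow f * x \<in> I" if I: "ideal I R" "?Q \<subset> I" for I
  proof -
    obtain y where y: "y \<in> I" "y \<notin> ?Q" using I by blast
    have sI: "series_module I" using I by (simp add: ideal_iff)
    define V where "V = {z. z * x \<in> I}"
    have "series_module V"
      by (rule series_moduleI) (use sI in \<open>auto simp: V_def series_moduleD distrib_right mult.assoc\<close>)
    moreover have "1 \<in> V" using I genideal_contains[of "{x}"] by (auto simp: V_def)
    moreover have "y * inverse x \<in> V" using y x by (simp add: V_def mult.assoc)
    moreover have "y * inverse x \<notin> carrier R"
    proof
      assume "y * inverse x \<in> carrier R"
      then have "y * inverse x * x \<in> ?Q" unfolding Q by blast
      then show False using y x by (simp add: mult.assoc)
    qed
    ultimately have "tpow f \<in> V" using frobenius_monomial_mem[OF sym] by blast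
    then show ?thesis by (simp add: V_def)
  qed
  show "?Q = I \<or> ?Q = J"
  proof (rule ccontr)
    assume "\<not> (?Q = I \<or> ?Q = J)"
    then have "?Q \<subset> I" "?Q \<subset> J" using IJ(3) by blast+
    then have "tpow f * x \<in> I" "tpow f * x \<in> J" using socle[OF IJ(1)] socle[OF IJ(2)] by blast+
    then have "tpow f * x \<in> ?Q" unfolding IJ(3) by blast
    then obtain r where "tpow f * x = r * x" "r \<in> carrier R" unfolding Q by blast
    then have "tpow f \<in> carrier R" using mult_right_cancel[OF x(2), of "tpow f" r] by simp
    then show False using f by simp
  qed
qed

theorem gorenstein_if_symmetric:
  assumes sym: "\<And>m. m \<in> H \<longleftrightarrow> f - m \<notin> H"
  shows "gorenstein_local R"
  unfolding gorenstein_local_def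
proof (intro conjI allI impI noetherian_R local_cring_R cohen_macaulay_self)
  fix Q assume "parameter_ideal R Q"
  then obtain xs where prim: "m_primary R Q" and xs: "set xs \<subseteq> nonunits"
    "enat (length xs) = 1" "Q = Idl\<^bsub>R\<^esub> (set xs)"
    unfolding parameter_ideal_def module_dim_self max_ideal_eq by blast
  have "length xs = 1" using xs(2) by (simp add: one_enat_def)
  then obtain x where "xs = [x]" by (metis One_nat_def length_0_conv length_Suc_conv)
  with xs have x: "x \<in> nonunits" and Q: "Q = Idl\<^bsub>R\<^esub> {x}" by auto
  have "x \<noteq> 0"
  proof
    assume "x = 0"
    moreover have "{r * 0 |r. r \<in> carrier R} = {0}" by (auto intro!: exI[of _ 0])
    ultimately have "Q = {0}" using genideal_singleton[OF closed(1)] unfolding Q by simp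
    then have "radical R Q \<subseteq> {0}" by (auto simp: radical_def pow_R)
    moreover have "radical R Q = nonunits" using prim by (simp add: m_primary_def max_ideal_eq)
    ultimately show False using exists_nonzero_nonunit tpow_nonzero[of "F + 1"] by blast
  qed
  then show "irreducible_ideal R Q" unfolding Q using irreducible_principal sym x by blast
qed

end

section \<open>Lengths of quotient modules\<close>

text \<open>
  Chains above \<open>N\<close> inside \<open>M\<close> stand for chains in \<open>M/N\<close>, so that lengths of different quotients of
  \<open>M\<close> can be compared without cosets.
\<close>

definition has_chain :: "('a, 'r) ring_scheme \<Rightarrow> ('a, 'b, 'm) module_scheme \<Rightarrow> 'b set \<Rightarrow> nat \<Rightarrow> bool" where
  "has_chain R M N n \<longleftrightarrow> (\<exists>V :: nat \<Rightarrow> 'b set.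
     (\<forall>i\<le>n. submodule (V i) R M \<and> N \<subseteq> V i) \<and> (\<forall>i<n. V i \<subset> V (Suc i)))"

context module
begin

lemma abelian_subgroup_if_submodule: "submodule N R M \<Longrightarrow> abelian_subgroup N M"
  by (intro abelian_subgroupI3 additive_subgroupI M.abelian_group_axioms) (simp_all add: submodule_def)

lemma zero_in_submodule: "submodule N R M \<Longrightarrow> \<zero>\<^bsub>M\<^esub> \<in> N"
  using submoduleE(1,2,4)[of N] smult_l_null by (metis R.zero_closed ex_in_conv subset_iff)

lemma smult_coset:
  assumes N: "submodule N R M" and r: "r \<in> carrier R" and x: "x \<in> carrier M"
  shows "(\<Union>y\<in>N +>\<^bsub>M\<^esub> x. N +>\<^bsub>M\<^esub> (r \<odot>\<^bsub>M\<^esub> y)) = N +>\<^bsub>M\<^esub> (r \<odot>\<^bsub>M\<^esub> x)"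
proof -
  interpret N: abelian_subgroup N M using N by (rule abelian_subgroup_if_submodule)
  note E = submoduleE[OF N]
  have "N +>\<^bsub>M\<^esub> (r \<odot>\<^bsub>M\<^esub> y) = N +>\<^bsub>M\<^esub> (r \<odot>\<^bsub>M\<^esub> x)" if "y \<in> N +>\<^bsub>M\<^esub> x" for y
  proof -
    obtain k where k: "k \<in> N" "y = k \<oplus>\<^bsub>M\<^esub> x" using \<open>y \<in> N +>\<^bsub>M\<^esub> x\<close> by (auto simp: a_r_coset_def')
    have kM: "k \<in> carrier M" using k E(1) by blast
    have "r \<odot>\<^bsub>M\<^esub> y = r \<odot>\<^bsub>M\<^esub> k \<oplus>\<^bsub>M\<^esub> r \<odot>\<^bsub>M\<^esub> x" using k kM r x by (simp add: smult_r_distr)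
    then have "r \<odot>\<^bsub>M\<^esub> y \<in> N +>\<^bsub>M\<^esub> (r \<odot>\<^bsub>M\<^esub> x)" using E(4)[OF r k(1)] by (auto simp: a_r_coset_def')
    then show ?thesis using M.a_repr_independence[of _ N "r \<odot>\<^bsub>M\<^esub> x"] r x N.a_subgroup by blast
  qed
  moreover have "x \<in> N +>\<^bsub>M\<^esub> x" using N.a_rcos_self x by blast
  ultimately show ?thesis by blast
qed

lemma quotient_ops:
  "carrier (quotient_module M N) = a_rcosets\<^bsub>M\<^esub> N" "zero (quotient_module M N) = N"
  "add (quotient_module M N) = set_add M"
  "smult (quotient_module M N) = (\<lambda>r Y. \<Union>y\<in>Y. N +>\<^bsub>M\<^esub> (r \<odot>\<^bsub>M\<^esub> y))"
  by (simp_all add: quotient_module_def)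

lemma quotient_coset_ops:
  assumes N: "submodule N R M"
  shows "x \<in> carrier M \<Longrightarrow> y \<in> carrier M \<Longrightarrow>
      (N +>\<^bsub>M\<^esub> x) \<oplus>\<^bsub>quotient_module M N\<^esub> (N +>\<^bsub>M\<^esub> y) = N +>\<^bsub>M\<^esub> (x \<oplus>\<^bsub>M\<^esub> y)"
    and "r \<in> carrier R \<Longrightarrow> x \<in> carrier M \<Longrightarrow>
      r \<odot>\<^bsub>quotient_module M N\<^esub> (N +>\<^bsub>M\<^esub> x) = N +>\<^bsub>M\<^esub> (r \<odot>\<^bsub>M\<^esub> x)"
    and "\<zero>\<^bsub>quotient_module M N\<^esub> = N +>\<^bsub>M\<^esub> \<zero>\<^bsub>M\<^esub>"
proof -
  interpret N: abelian_subgroup N M using N by (rule abelian_subgroup_if_submodule)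
  show "x \<in> carrier M \<Longrightarrow> y \<in> carrier M \<Longrightarrow>
      (N +>\<^bsub>M\<^esub> x) \<oplus>\<^bsub>quotient_module M N\<^esub> (N +>\<^bsub>M\<^esub> y) = N +>\<^bsub>M\<^esub> (x \<oplus>\<^bsub>M\<^esub> y)"
    by (simp add: quotient_ops N.a_rcos_sum)
  show "r \<in> carrier R \<Longrightarrow> x \<in> carrier M \<Longrightarrow>
      r \<odot>\<^bsub>quotient_module M N\<^esub> (N +>\<^bsub>M\<^esub> x) = N +>\<^bsub>M\<^esub> (r \<odot>\<^bsub>M\<^esub> x)"
    using smult_coset[OF N] by (simp add: quotient_ops)
  show "\<zero>\<^bsub>quotient_module M N\<^esub> = N +>\<^bsub>M\<^esub> \<zero>\<^bsub>M\<^esub>"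
    using N.a_subset by (simp add: quotient_ops)
qed

lemma module_quotient:
  assumes N: "submodule N R M" shows "module R (quotient_module M N)"
proof -
  interpret N: abelian_subgroup N M using N by (rule abelian_subgroup_if_submodule)
  let ?c = "\<lambda>x. N +>\<^bsub>M\<^esub> x" and ?Q = "quotient_module M N"
  have car: "X \<in> carrier ?Q \<longleftrightarrow> (\<exists>x\<in>carrier M. X = ?c x)" for X
    by (auto simp: quotient_ops A_RCOSETS_def')
  note add = quotient_coset_ops(1)[OF N]
  note sm = quotient_coset_ops(2)[OF N]
  note zero = quotient_coset_ops(3)[OF N]
  show ?thesis
  proof (rule moduleI)
    show "cring R" by (rule R.is_cring)
    show "abelian_group (quotient_module M N)"
    proof (rule abelian_groupI)
      show "\<exists>Y\<in>carrier ?Q. Y \<oplus>\<^bsub>?Q\<^esub> X = \<zero>\<^bsub>?Q\<^esub>"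
        if "X \<in> carrier ?Q" for X
      proof -
        obtain x where x: "x \<in> carrier M" "X = ?c x" using \<open>X \<in> _\<close> car by blast
        then have "?c (\<ominus>\<^bsub>M\<^esub> x) \<oplus>\<^bsub>?Q\<^esub> X = \<zero>\<^bsub>?Q\<^esub>"
          by (simp add: add zero M.l_neg)
        then show ?thesis using x car by blast
      qed
    qed (auto simp: car add zero M.a_ac intro!: bexI)
  qed (auto simp: car add sm smult_l_distr smult_r_distr smult_assoc1 intro!: bexI)
qed

lemma quotient_submodule:
  assumes N: "submodule N R M" and V: "submodule V R M" "N \<subseteq> V"
  shows "submodule ((\<lambda>x. N +>\<^bsub>M\<^esub> x) ` V) R (quotient_module M N)"
proof -
  interpret N: abelian_subgroup N M using N by (rule abelian_subgroup_if_submodule)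
  interpret Q: module R "quotient_module M N" using N by (rule module_quotient)
  let ?c = "\<lambda>x. N +>\<^bsub>M\<^esub> x" and ?Q = "quotient_module M N"
  note E = submoduleE[OF V(1)]
  have VM: "x \<in> carrier M" if "x \<in> V" for x using that E(1) by blast
  note add = quotient_coset_ops(1)[OF N]
  note sm = quotient_coset_ops(2)[OF N]
  note zero = quotient_coset_ops(3)[OF N]
  have car: "?c x \<in> carrier ?Q" if "x \<in> carrier M" for x
    using that N.a_subset by (simp add: quotient_ops M.a_rcosetsI)
  show ?thesis
  proof (rule Q.submoduleI)
    show "\<zero>\<^bsub>?Q\<^esub> \<in> ?c ` V" using zero zero_in_submodule[OF V(1)] by blast
    fix X assume "X \<in> ?c ` V"
    then obtain x where x: "x \<in> V" "X = ?c x" by blast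
    have "?c (\<ominus>\<^bsub>M\<^esub> x) \<oplus>\<^bsub>?Q\<^esub> X = \<zero>\<^bsub>?Q\<^esub>"
      using x VM by (simp add: add zero M.l_neg)
    then have "\<ominus>\<^bsub>?Q\<^esub> X = ?c (\<ominus>\<^bsub>M\<^esub> x)"
      using Q.M.minus_equality x VM car by simp
    then show "\<ominus>\<^bsub>?Q\<^esub> X \<in> ?c ` V" using E(3) x by blast
    { fix Y assume "Y \<in> ?c ` V"
      then show "X \<oplus>\<^bsub>?Q\<^esub> Y \<in> ?c ` V" using x E(5) VM by (auto simp: add) }
    { fix r assume "r \<in> carrier R"
      then show "r \<odot>\<^bsub>?Q\<^esub> X \<in> ?c ` V" using x E(4) VM by (auto simp: sm) }
  qed (use car VM in auto)
qed

lemma preimage_submodule: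
  assumes N: "submodule N R M" and U: "submodule U R (quotient_module M N)"
  defines "V \<equiv> {x \<in> carrier M. N +>\<^bsub>M\<^esub> x \<in> U}"
  shows "submodule V R M" "N \<subseteq> V" "U = (\<lambda>x. N +>\<^bsub>M\<^esub> x) ` V"
proof -
  interpret N: abelian_subgroup N M using N by (rule abelian_subgroup_if_submodule)
  interpret Q: module R "quotient_module M N" using N by (rule module_quotient)
  let ?c = "\<lambda>x. N +>\<^bsub>M\<^esub> x"
  note E = Q.submoduleE[OF U]
  note add = quotient_coset_ops(1)[OF N]
  note sm = quotient_coset_ops(2)[OF N]
  have zero: "N \<in> U" using Q.zero_in_submodule[OF U] by (simp add: quotient_ops)
  have NV: "?c x = N" if "x \<in> N" for x using that by (rule N.a_rcos_const)
  show NsV: "N \<subseteq> V" using NV zero N.a_subset by (auto simp: V_def)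
  show "submodule V R M"
  proof (rule submoduleI)
    show "\<zero>\<^bsub>M\<^esub> \<in> V" using NsV zero_in_submodule[OF N] by blast
    show sV: "r \<odot>\<^bsub>M\<^esub> x \<in> V" if "r \<in> carrier R" "x \<in> V" for r x
      using that E(4) sm unfolding V_def by force
    show "\<ominus>\<^bsub>M\<^esub> x \<in> V" if "x \<in> V" for x
      using sV[of "\<ominus>\<^bsub>R\<^esub> \<one>\<^bsub>R\<^esub>" x] that by (simp add: V_def smult_l_minus)
    show "x \<oplus>\<^bsub>M\<^esub> y \<in> V" if "x \<in> V" "y \<in> V" for x y
      using that E(5) add unfolding V_def by force
  qed (simp add: V_def)
  show "U = ?c ` V"
  proof
    show "U \<subseteq> ?c ` V"
      using E(1) by (fastforce simp: V_def quotient_ops A_RCOSETS_def')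
  qed (auto simp: V_def)
qed

text \<open>
  The correspondence between the submodules of \<open>M/N\<close> and the submodules of \<open>M\<close> above \<open>N\<close>.
\<close>

lemma quotient_length:
  assumes N: "submodule N R M"
  shows "module_length R (quotient_module M N) = Sup {enat n |n. has_chain R M N n}"
proof -
  interpret N: abelian_subgroup N M using N by (rule abelian_subgroup_if_submodule)
  let ?c = "\<lambda>x. N +>\<^bsub>M\<^esub> x" and ?Q = "quotient_module M N"
  have lift: "x \<in> V" if V: "submodule V R M" "N \<subseteq> V" "x \<in> carrier M" "?c x \<in> ?c ` V" for V x
  proof -
    obtain y where y: "y \<in> V" "?c x = ?c y" using V by blast
    have "x \<in> ?c y" using y(2) N.a_rcos_self[OF V(3)] by simp
    then obtain k where "k \<in> N" "x = k \<oplus>\<^bsub>M\<^esub> y" by (auto simp: a_r_coset_def')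
    then show ?thesis using submoduleE(5)[OF V(1)] V(2) y(1) by blast
  qed
  have "(\<exists>U :: nat \<Rightarrow> 'c set set. (\<forall>i\<le>n. submodule (U i) R ?Q) \<and> (\<forall>i<n. U i \<subset> U (Suc i))) \<longleftrightarrow>
      has_chain R M N n" for n
  proof
    assume "\<exists>U :: nat \<Rightarrow> 'c set set. (\<forall>i\<le>n. submodule (U i) R ?Q) \<and> (\<forall>i<n. U i \<subset> U (Suc i))"
    then obtain U :: "nat \<Rightarrow> 'c set set" where U: "\<And>i. i \<le> n \<Longrightarrow> submodule (U i) R ?Q"
      "\<And>i. i < n \<Longrightarrow> U i \<subset> U (Suc i)" by blast
    define V where "V i = {x \<in> carrier M. ?c x \<in> U i}" for i
    note P = preimage_submodule[OF N U(1), folded V_def]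
    have "V i \<subset> V (Suc i)" if "i < n" for i
    proof -
      have "V i \<subseteq> V (Suc i)" using U(2)[OF that] by (auto simp: V_def)
      moreover have "V i \<noteq> V (Suc i)" using U(2)[OF that] P(3)[of i] P(3)[of "Suc i"] that by auto
      ultimately show ?thesis by blast
    qed
    then show "has_chain R M N n" unfolding has_chain_def using P(1,2) by (intro exI[of _ V]) blast
  next
    assume "has_chain R M N n"
    then obtain V where V: "\<And>i. i \<le> n \<Longrightarrow> submodule (V i) R M \<and> N \<subseteq> V i"
      "\<And>i. i < n \<Longrightarrow> V i \<subset> V (Suc i)" unfolding has_chain_def by blast
    have "?c ` V i \<subset> ?c ` V (Suc i)" if "i < n" for i
    proof -
      obtain x where x: "x \<in> V (Suc i)" "x \<notin> V i" using V(2)[OF \<open>i < n\<close>] by blast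
      have "x \<in> carrier M" using x submoduleE(1) V(1)[of "Suc i"] that by fastforce
      then have "?c x \<notin> ?c ` V i" using lift[of "V i" x] V(1)[of i] x that by auto
      then show ?thesis using V(2)[OF \<open>i < n\<close>] x by blast
    qed
    then show "\<exists>U :: nat \<Rightarrow> 'c set set. (\<forall>i\<le>n. submodule (U i) R ?Q) \<and> (\<forall>i<n. U i \<subset> U (Suc i))"
      using quotient_submodule[OF N] V(1) by (intro exI[of _ "\<lambda>i. ?c ` V i"]) blast
  qed
  then show ?thesis unfolding module_length_def by simp
qed

lemma has_chain_0: "submodule N R M \<Longrightarrow> has_chain R M N 0"
  unfolding has_chain_def by auto

lemma Sup_chain_attained:
  assumes "submodule N R M" and Sup: "Sup {enat n |n. has_chain R M N n} = enat l"
  shows "has_chain R M N l"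
proof (rule ccontr)
  assume not: "\<not> has_chain R M N l"
  have le: "n \<le> l" if "has_chain R M N n" for n
    using Sup_upper[of "enat n" "{enat n |n. has_chain R M N n}"] that Sup by auto
  have "l \<noteq> 0" using not has_chain_0[OF assms(1)] by metis
  have "n \<le> l - 1" if "has_chain R M N n" for n
    using le[OF that] not that by (cases "n = l") auto
  then have "Sup {enat n |n. has_chain R M N n} \<le> enat (l - 1)"
    by (intro Sup_least) auto
  then show False using Sup \<open>l \<noteq> 0\<close> by simp
qed

lemma has_chain_extend:
  assumes "has_chain R M N n" and N: "submodule N' R M" "N' \<subset> N"
  shows "has_chain R M N' (Suc n)"
proof -
  obtain V where V: "\<And>i. i \<le> n \<Longrightarrow> submodule (V i) R M \<and> N \<subseteq> V i"
    "\<And>i. i < n \<Longrightarrow> V i \<subset> V (Suc i)" using assms(1) unfolding has_chain_def by blast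
  let ?V = "\<lambda>i. case i of 0 \<Rightarrow> N' | Suc j \<Rightarrow> V j"
  have "submodule (?V i) R M \<and> N' \<subseteq> ?V i" if "i \<le> Suc n" for i
    using that V(1) N by (cases i) auto
  moreover have "?V i \<subset> ?V (Suc i)" if "i < Suc n" for i
    using that V(1)[of 0] V(2) N by (cases i) auto
  ultimately show ?thesis unfolding has_chain_def by (intro exI[of _ ?V]) blast
qed

lemma submodule_zero: "submodule {\<zero>\<^bsub>M\<^esub>} R M"
  by (rule submoduleI) auto

lemma submodule_Inter:
  assumes "\<And>N. N \<in> \<N> \<Longrightarrow> submodule N R M" "\<N> \<noteq> {}"
  shows "submodule (\<Inter>\<N>) R M"
proof (rule submoduleI)
  note E = submoduleE[OF assms(1)]
  show "\<Inter>\<N> \<subseteq> carrier M" using E(1) assms(2) by blast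
  show "\<zero>\<^bsub>M\<^esub> \<in> \<Inter>\<N>" using zero_in_submodule assms(1) by blast
  show "\<ominus>\<^bsub>M\<^esub> x \<in> \<Inter>\<N>" if "x \<in> \<Inter>\<N>" for x using that E(3) by blast
  show "x \<oplus>\<^bsub>M\<^esub> y \<in> \<Inter>\<N>" if "x \<in> \<Inter>\<N>" "y \<in> \<Inter>\<N>" for x y using that E(5) by blast
  show "r \<odot>\<^bsub>M\<^esub> x \<in> \<Inter>\<N>" if "r \<in> carrier R" "x \<in> \<Inter>\<N>" for r x using that E(4) by blast
qed

lemma submodule_ideal_times:
  assumes "I \<subseteq> carrier R" shows "submodule (ideal_times R I M) R M"
  unfolding ideal_times_def module_span_def
proof (rule submodule_Inter)
  have "{r \<odot>\<^bsub>M\<^esub> x |r x. r \<in> I \<and> x \<in> carrier M} \<subseteq> carrier M" using assms by auto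
  then show "{N. submodule N R M \<and> {r \<odot>\<^bsub>M\<^esub> x |r x. r \<in> I \<and> x \<in> carrier M} \<subseteq> N} \<noteq> {}"
    using carrier_is_submodule by blast
qed blast

lemma ideal_times_product: "r \<in> I \<Longrightarrow> x \<in> carrier M \<Longrightarrow> r \<odot>\<^bsub>M\<^esub> x \<in> ideal_times R I M"
  unfolding ideal_times_def module_span_def by blast

lemma ideal_times_least:
  "submodule N R M \<Longrightarrow> (\<And>r x. r \<in> I \<Longrightarrow> x \<in> carrier M \<Longrightarrow> r \<odot>\<^bsub>M\<^esub> x \<in> N) \<Longrightarrow> ideal_times R I M \<subseteq> N"
  unfolding ideal_times_def module_span_def by blast

lemma ideal_times_eq_zero:
  assumes "I \<subseteq> carrier R" "\<And>r x. r \<in> I \<Longrightarrow> x \<in> carrier M \<Longrightarrow> r \<odot>\<^bsub>M\<^esub> x = \<zero>\<^bsub>M\<^esub>"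
  shows "ideal_times R I M = {\<zero>\<^bsub>M\<^esub>}"
proof
  show "ideal_times R I M \<subseteq> {\<zero>\<^bsub>M\<^esub>}"
    by (rule ideal_times_least[OF submodule_zero]) (simp add: assms(2))
  show "{\<zero>\<^bsub>M\<^esub>} \<subseteq> ideal_times R I M"
    using zero_in_submodule[OF submodule_ideal_times[OF assms(1)]] by simp
qed

text \<open>
  A chain of length \<open>l\<close> above a nonzero \<open>I M\<close> could be extended by the zero submodule.
\<close>

lemma ideal_times_zero_if_length_eq:
  assumes I: "I \<subseteq> carrier R" and l: "module_length R (reduction R I M) = enat l"
    and "module_length R (quotient_module M {\<zero>\<^bsub>M\<^esub>}) = enat l"
  shows "ideal_times R I M = {\<zero>\<^bsub>M\<^esub>}"
proof (rule ccontr)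
  let ?N = "ideal_times R I M"
  have N: "submodule ?N R M" using I by (rule submodule_ideal_times)
  assume "?N \<noteq> {\<zero>\<^bsub>M\<^esub>}"
  then have "{\<zero>\<^bsub>M\<^esub>} \<subset> ?N" using zero_in_submodule[OF N] by blast
  moreover have "has_chain R M ?N l"
    using l Sup_chain_attained[OF N] by (simp add: reduction_def quotient_length[OF N])
  ultimately have "has_chain R M {\<zero>\<^bsub>M\<^esub>} (Suc l)" using has_chain_extend submodule_zero by blast
  then have "enat (Suc l) \<le> Sup {enat n |n. has_chain R M {\<zero>\<^bsub>M\<^esub>} n}" by (intro Sup_upper) blast
  then show False using assms(3) by (simp add: quotient_length[OF submodule_zero])
qed

end

lemma exists_rank_from_top:
  fixes G :: "int set"
  assumes "finite G" "i < card G" shows "\<exists>q\<in>G. card {r \<in> G. q < r} = i"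
  using assms
proof (induction G arbitrary: i rule: finite_linorder_min_induct)
  case (insert b A)
  have b: "b \<notin> A" using insert by blast
  show ?case
  proof (cases "i = card A")
    case True
    have "{r \<in> insert b A. b < r} = A" using insert by auto
    then show ?thesis using True by auto
  next
    case False
    then have "i < card A" using insert b by simp
    then obtain q where q: "q \<in> A" "card {r \<in> A. q < r} = i" using insert.IH by blast
    have "{r \<in> insert b A. q < r} = {r \<in> A. q < r}" using insert q by auto
    then have "card {r \<in> insert b A. q < r} = i" using q(2) by simp
    with q(1) show ?thesis by blast
  qed
qed simp

context semigroup_series
begin

text \<open>
  Elimination bounds the length from above. For the lower bound the elements of \<open>H - T\<close> are added to
  \<open>T\<close> one after the other, the largest first: then each intermediate set absorbs \<open>H\<close>, because adding
  an element of \<open>H\<close> moves an exponent up.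
\<close>

lemma length_monomial_quotient:
  assumes T: "T \<subseteq> H" "\<And>s x. s \<in> T \<Longrightarrow> x \<in> H \<Longrightarrow> s + x \<in> T" and fin: "finite (H - T)"
  shows "module_length R (quotient_module (self_module R) {x. \<forall>m. x $$ m \<noteq> 0 \<longrightarrow> m \<in> T}) = enat (card (H - T))"
proof -
  let ?c = "\<lambda>T. {x :: 'k fls. \<forall>m. x $$ m \<noteq> 0 \<longrightarrow> m \<in> T}" and ?G = "H - T"
  interpret module R "self_module R"
    unfolding self_module_eq by (intro module_fractional series_module_carrier)
  have mono_mod: "series_module (?c S)"
    if S: "\<And>s x. s \<in> S \<Longrightarrow> x \<in> H \<Longrightarrow> s + x \<in> S" for S
  proof (rule series_moduleI)
    show "x + y \<in> ?c S" if "x \<in> ?c S" "y \<in> ?c S" for x y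
      using that by (auto, metis add.right_neutral)
    show "r * x \<in> ?c S" if r: "r \<in> carrier R" and x: "x \<in> ?c S" for r x
    proof (rule CollectI, intro allI impI)
      fix m assume "(r * x) $$ m \<noteq> 0"
      then obtain i where "r $$ i \<noteq> 0" "x $$ (m - i) \<noteq> 0" by (rule fls_mult_nth_nonzeroE)
      then have "i \<in> H" "m - i \<in> S" using r x by (auto simp: carrier_iff)
      then have "(m - i) + i \<in> S" using S by blast
      then show "m \<in> S" by simp
    qed
  qed simp
  have sub: "submodule V R (self_module R) \<longleftrightarrow> V \<subseteq> carrier R \<and> series_module V" for V
    unfolding self_module_eq by (rule submodule_iff[OF series_module_carrier])
  have cR: "?c S \<subseteq> carrier R" if "S \<subseteq> H" for S
    by (rule subsetI, subst carrier_iff) (use that in blast)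
  have cT: "submodule (?c T) R (self_module R)" using mono_mod[OF T(2)] cR[OF T(1)] by (simp add: sub)
  have upper: "n \<le> card ?G" if "has_chain R (self_module R) (?c T) n" for n
  proof -
    obtain V where V: "\<And>i. i \<le> n \<Longrightarrow> submodule (V i) R (self_module R) \<and> ?c T \<subseteq> V i"
      "\<And>i. i < n \<Longrightarrow> V i \<subset> V (Suc i)" using \<open>has_chain _ _ _ n\<close> unfolding has_chain_def by blast
    show ?thesis
    proof (rule chain_length_le_card[of ?G n V])
      show "kspace (V i)" if "i \<le> n" for i using V(1)[OF that] by (simp add: sub kspace_if_series_module)
      show "x \<in> V 0" if x: "x \<in> V n" "\<forall>q\<in>?G. x $$ q = 0" for x
      proof -
        have "x \<in> carrier R" using x(1) V(1)[of n] by (auto simp: sub)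
        then have "x \<in> ?c T" using x(2) by (auto simp: carrier_iff)
        then show ?thesis using V(1)[of 0] by blast
      qed
    qed (use fin V in auto)
  qed
  have lower: "has_chain R (self_module R) (?c T) (card ?G)"
  proof -
    define S where "S i = T \<union> {q \<in> ?G. card {r \<in> ?G. q < r} < i}" for i
    have SH: "S i \<subseteq> H" for i using T(1) by (auto simp: S_def)
    have "s + x \<in> S i" if s: "s \<in> S i" and x: "x \<in> H" for s x i
    proof (cases "s \<in> T \<or> s + x \<in> T")
      case True then show ?thesis using T(2) x by (auto simp: S_def)
    next
      case False
      then have "s \<in> ?G" "card {r \<in> ?G. s < r} < i" using s by (auto simp: S_def)
      moreover have "s + x \<in> ?G" using False add_mem[of s x] s x SH by blast
      moreover have "card {r \<in> ?G. s + x < r} \<le> card {r \<in> ?G. s < r}"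
        using nonneg[OF x] by (intro card_mono finite_subset[OF _ fin]) auto
      ultimately show ?thesis by (auto simp: S_def)
    qed
    then have "submodule (?c (S i)) R (self_module R)" for i
      using mono_mod[of "S i"] cR[OF SH] by (simp add: sub)
    moreover have "?c T \<subseteq> ?c (S i)" for i by (auto simp: S_def)
    moreover have "?c (S i) \<subset> ?c (S (Suc i))" if i: "i < card ?G" for i
    proof -
      obtain q where q: "q \<in> ?G" "card {r \<in> ?G. q < r} = i"
        using exists_rank_from_top[OF fin i] by blast
      then have "q \<in> S (Suc i)" "q \<notin> S i" by (auto simp: S_def)
      then have "tpow q \<in> ?c (S (Suc i))" "tpow q \<notin> ?c (S i)" by auto
      moreover have "?c (S i) \<subseteq> ?c (S (Suc i))" by (force simp: S_def)
      ultimately show ?thesis by blast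
    qed
    ultimately show ?thesis unfolding has_chain_def by (intro exI[of _ "\<lambda>i. ?c (S i)"]) blast
  qed
  show ?thesis unfolding quotient_length[OF cT]
    by (intro antisym Sup_least Sup_upper) (use upper lower in auto)
qed

end

context semigroup_series
begin

section \<open>Bases of free quotients\<close>

definition lincomb :: "'k fls set \<Rightarrow> 'k fls set" where
  "lincomb B = {\<Sum>b\<in>F. c b * b | F c. finite F \<and> F \<subseteq> B \<and> (\<forall>b\<in>F. c b \<in> carrier R)}"

text \<open>
  Elements of \<open>K\<close> that represent a basis of \<open>K/N\<close> over \<open>R/I\<close>, for \<open>I K \<subseteq> N\<close>. Coordinates are
  elements of \<open>R\<close>, determined modulo \<open>I\<close>.
\<close>

definition basis_modulo :: "'k fls set \<Rightarrow> 'k fls set \<Rightarrow> 'k fls set \<Rightarrow> 'k fls set \<Rightarrow> bool" where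
  "basis_modulo I K N B \<longleftrightarrow> B \<subseteq> K \<and> (\<forall>x\<in>K. \<exists>s\<in>lincomb B. x - s \<in> N) \<and>
     (\<forall>F c. finite F \<longrightarrow> F \<subseteq> B \<longrightarrow> (\<forall>b\<in>F. c b \<in> carrier R) \<longrightarrow> (\<Sum>b\<in>F. c b * b) \<in> N \<longrightarrow> (\<forall>b\<in>F. c b \<in> I))"

lemma lincombI: "finite F \<Longrightarrow> F \<subseteq> B \<Longrightarrow> (\<And>b. b \<in> F \<Longrightarrow> c b \<in> carrier R) \<Longrightarrow> (\<Sum>b\<in>F. c b * b) \<in> lincomb B"
  unfolding lincomb_def by blast

lemma lincombE:
  assumes "x \<in> lincomb B"
  obtains F c where "x = (\<Sum>b\<in>F. c b * b)" "finite F" "F \<subseteq> B" "\<And>b. b \<in> F \<Longrightarrow> c b \<in> carrier R"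
proof -
  obtain F c where "x = (\<Sum>b\<in>F. c b * b)" "finite F" "F \<subseteq> B" "\<forall>b\<in>F. c b \<in> carrier R"
    using assms unfolding lincomb_def by blast
  then show thesis using that[of c F] by blast
qed

lemma series_module_lincomb: "series_module (lincomb B)"
proof (rule series_moduleI)
  show "0 \<in> lincomb B" using lincombI[of "{}" B] by simp
next
  fix x y assume "x \<in> lincomb B" "y \<in> lincomb B"
  obtain F c where x: "x = (\<Sum>b\<in>F. c b * b)" "finite F" "F \<subseteq> B" "\<And>b. b \<in> F \<Longrightarrow> c b \<in> carrier R"
    using \<open>x \<in> lincomb B\<close> by - (erule lincombE, blast)
  obtain F' c' where y: "y = (\<Sum>b\<in>F'. c' b * b)" "finite F'" "F' \<subseteq> B" "\<And>b. b \<in> F' \<Longrightarrow> c' b \<in> carrier R"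
    using \<open>y \<in> lincomb B\<close> by - (erule lincombE, blast)
  let ?d = "\<lambda>b. (if b \<in> F then c b else 0) + (if b \<in> F' then c' b else 0)"
  have "x = (\<Sum>b\<in>F \<union> F'. (if b \<in> F then c b else 0) * b)"
    unfolding x(1) by (rule sum.mono_neutral_cong_left) (use x y in auto)
  moreover have "y = (\<Sum>b\<in>F \<union> F'. (if b \<in> F' then c' b else 0) * b)"
    unfolding y(1) by (rule sum.mono_neutral_cong_left) (use x y in auto)
  ultimately have "x + y = (\<Sum>b\<in>F \<union> F'. ?d b * b)"
    by (simp only: sum.distrib distrib_right)
  also have "\<dots> \<in> lincomb B" using x y by (intro lincombI) (auto simp: add_closed)
  finally show "x + y \<in> lincomb B" .
next
  fix r x assume r: "r \<in> carrier R" and "x \<in> lincomb B"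
  obtain F c where x: "x = (\<Sum>b\<in>F. c b * b)" "finite F" "F \<subseteq> B" "\<And>b. b \<in> F \<Longrightarrow> c b \<in> carrier R"
    using \<open>x \<in> lincomb B\<close> by - (erule lincombE, blast)
  have "r * x = (\<Sum>b\<in>F. (r * c b) * b)" unfolding x(1) by (simp add: sum_distrib_left mult.assoc)
  also have "\<dots> \<in> lincomb B" using x r by (intro lincombI) (auto simp: mult_closed)
  finally show "r * x \<in> lincomb B" .
qed

lemma lincomb_subset: "series_module K \<Longrightarrow> B \<subseteq> K \<Longrightarrow> lincomb B \<subseteq> K"
  by (auto elim!: lincombE intro!: series_module_sum series_moduleD(3))

lemma lincomb_generator: "b \<in> B \<Longrightarrow> b \<in> lincomb B"
  using lincombI[of "{b}" B "\<lambda>_. 1"] by simp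

text \<open>
  \<open>X\<close> is a quotient of \<open>K\<close>, so that \<open>X/IX\<close> is the quotient of \<open>K\<close> by the preimage of \<open>I X\<close>; any
  choice of representatives of a basis of \<open>X/IX\<close> does it.
\<close>

lemma lift_basis:
  assumes K: "series_module K" and I: "ideal I R" and X: "module R X"
    and lin: "linear_map R (fractional_module K) X \<psi>" and surj: "\<psi> ` K = carrier X"
    and free: "free_module (R Quot I) (reduction_over_quot R I X)"
  obtains B where "basis_modulo I K {x \<in> K. \<psi> x \<in> ideal_times R I X} B"
proof -
  interpret X: module R X by fact
  let ?Q = "reduction_over_quot R I X"
  define P where "P = ideal_times R I X"
  interpret Q: module "R Quot I" ?Q using free by (simp add: free_module_def)
  have IR: "I \<subseteq> carrier R" using I by (simp add: ideal_iff)
  interpret I: ideal I R by fact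
  have P: "submodule P R X" unfolding P_def using IR by (rule X.submodule_ideal_times)
  note E = X.submoduleE[OF P]
  interpret P: abelian_subgroup P X using P by (rule X.abelian_subgroup_if_submodule)
  have Qops: "carrier ?Q = a_rcosets\<^bsub>X\<^esub> P" "zero ?Q = P" "add ?Q = set_add X"
    "smult ?Q = (\<lambda>Z Y. \<Union>r\<in>Z. \<Union>y\<in>Y. P +>\<^bsub>X\<^esub> (r \<odot>\<^bsub>X\<^esub> y))"
    by (simp_all add: reduction_over_quot_def P_def Let_def)
  have \<psi>: "\<psi> x \<in> carrier X" "\<psi> (x + y) = \<psi> x \<oplus>\<^bsub>X\<^esub> \<psi> y" "\<psi> (r * x) = r \<odot>\<^bsub>X\<^esub> \<psi> x"
    if "x \<in> K" "y \<in> K" "r \<in> carrier R" for x y r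
    using lin that unfolding linear_map_def by auto
  define p where "p x = P +>\<^bsub>X\<^esub> \<psi> x" for x
  have p_car: "p x \<in> carrier ?Q" if "x \<in> K" for x
    unfolding p_def Qops using \<psi>(1)[OF that that closed(1)] P.a_subset by (rule X.M.a_rcosetsI[rotated])
  have p_onto: "\<exists>x\<in>K. Y = p x" if "Y \<in> carrier ?Q" for Y
  proof -
    obtain y where y: "y \<in> carrier X" "Y = P +>\<^bsub>X\<^esub> y"
      using \<open>Y \<in> carrier ?Q\<close> unfolding Qops A_RCOSETS_def' by blast
    from y(1) have "y \<in> \<psi> ` K" using surj by simp
    then obtain x where "x \<in> K" "y = \<psi> x" by (rule imageE)
    then show ?thesis using y(2) unfolding p_def by blast
  qed
  have p_add: "p (x + y) = p x \<oplus>\<^bsub>?Q\<^esub> p y" if "x \<in> K" "y \<in> K" for x y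
    unfolding p_def Qops using that \<psi>[of x y 0] \<psi>[of y y 0] by (simp add: P.a_rcos_sum)
  have p_smult: "p (r * x) = (I +>\<^bsub>R\<^esub> r) \<odot>\<^bsub>?Q\<^esub> p x" if r: "r \<in> carrier R" and x: "x \<in> K" for r x
  proof -
    have x': "\<psi> x \<in> carrier X" using \<psi>(1) x closed(1) by blast
    have "P +>\<^bsub>X\<^esub> (r' \<odot>\<^bsub>X\<^esub> y) = P +>\<^bsub>X\<^esub> (r \<odot>\<^bsub>X\<^esub> \<psi> x)"
      if ry: "r' \<in> I +>\<^bsub>R\<^esub> r" "y \<in> P +>\<^bsub>X\<^esub> \<psi> x" for r' y
    proof -
      obtain i k where ik: "i \<in> I" "r' = i \<oplus>\<^bsub>R\<^esub> r" "k \<in> P" "y = k \<oplus>\<^bsub>X\<^esub> \<psi> x"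
        using ry by (auto simp: a_r_coset_def')
      have c: "i \<in> carrier R" "k \<in> carrier X" using ik IR E(1) by auto
      have y: "y \<in> carrier X" using ik c x' by simp
      have "r' \<odot>\<^bsub>X\<^esub> y = (i \<odot>\<^bsub>X\<^esub> y \<oplus>\<^bsub>X\<^esub> r \<odot>\<^bsub>X\<^esub> k) \<oplus>\<^bsub>X\<^esub> r \<odot>\<^bsub>X\<^esub> \<psi> x"
        using X.smult_l_distr[of i r y] c r y x' ik X.smult_r_distr[of r k "\<psi> x"]
        by (simp del: R_ops add: X.M.a_assoc)
      moreover have "i \<odot>\<^bsub>X\<^esub> y \<oplus>\<^bsub>X\<^esub> r \<odot>\<^bsub>X\<^esub> k \<in> P"
        using E(4,5) r ik(3) X.ideal_times_product[OF ik(1) y] unfolding P_def by blast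
      ultimately have "r' \<odot>\<^bsub>X\<^esub> y \<in> P +>\<^bsub>X\<^esub> (r \<odot>\<^bsub>X\<^esub> \<psi> x)" by (auto simp: a_r_coset_def')
      then show ?thesis
        using X.M.a_repr_independence[of _ P "r \<odot>\<^bsub>X\<^esub> \<psi> x"] r x' P.a_subgroup X.smult_closed by metis
    qed
    moreover have "r \<in> I +>\<^bsub>R\<^esub> r" using r by (rule I.a_rcos_self)
    moreover have "\<psi> x \<in> P +>\<^bsub>X\<^esub> \<psi> x" using x' by (rule P.a_rcos_self)
    ultimately have "(\<Union>r'\<in>I +>\<^bsub>R\<^esub> r. \<Union>y\<in>P +>\<^bsub>X\<^esub> \<psi> x. P +>\<^bsub>X\<^esub> (r' \<odot>\<^bsub>X\<^esub> y)) = P +>\<^bsub>X\<^esub> (r \<odot>\<^bsub>X\<^esub> \<psi> x)"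
      by blast
    then show ?thesis unfolding p_def Qops using \<psi>(3)[OF x x r] by simp
  qed
  have p_zero: "p x = \<zero>\<^bsub>?Q\<^esub> \<longleftrightarrow> \<psi> x \<in> P" if x: "x \<in> K" for x
  proof -
    have x': "\<psi> x \<in> carrier X" using \<psi>(1) x closed(1) by blast
    show ?thesis unfolding p_def Qops
      using P.a_rcos_self[OF x'] P.a_rcos_const by metis
  qed
  have RQ: "Z \<in> carrier (R Quot I) \<longleftrightarrow> (\<exists>r\<in>carrier R. Z = I +>\<^bsub>R\<^esub> r)" for Z
    by (auto simp: FactRing_def A_RCOSETS_def')
  have p0: "p 0 = \<zero>\<^bsub>?Q\<^esub>"
  proof -
    have z: "0 \<in> K" using K series_moduleD(1) by blast
    have "p 0 = p 0 \<oplus>\<^bsub>?Q\<^esub> p 0" using p_add[OF z z] by simp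
    then show ?thesis using p_car[OF z] by (metis Q.M.add.l_cancel_one)
  qed
  have p_neg: "\<ominus>\<^bsub>?Q\<^esub> p x = p (- x)" if x: "x \<in> K" for x
  proof (rule Q.M.minus_equality)
    have nx: "- x \<in> K" using K x series_moduleD(4) by blast
    have "p (- x) \<oplus>\<^bsub>?Q\<^esub> p x = p 0" using p_add[OF nx x] by simp
    then show "p (- x) \<oplus>\<^bsub>?Q\<^esub> p x = \<zero>\<^bsub>?Q\<^esub>" using p0 by simp
    show "p x \<in> carrier ?Q" "p (- x) \<in> carrier ?Q" using p_car x nx by auto
  qed
  define indep_set where "indep_set BQ \<longleftrightarrow> (\<forall>F c. finite F \<longrightarrow> F \<subseteq> BQ \<longrightarrow>
      c \<in> F \<rightarrow> carrier (R Quot I) \<longrightarrow> (\<Oplus>\<^bsub>?Q\<^esub>b\<in>F. c b \<odot>\<^bsub>?Q\<^esub> b) = \<zero>\<^bsub>?Q\<^esub> \<longrightarrow>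
      (\<forall>b\<in>F. c b = \<zero>\<^bsub>R Quot I\<^esub>))" for BQ
  have "\<exists>BQ \<subseteq> carrier ?Q. module_span (R Quot I) ?Q BQ = carrier ?Q \<and> indep_set BQ"
    unfolding indep_set_def using free unfolding free_module_def by (rule conjunct2)
  then obtain BQ where BQ: "BQ \<subseteq> carrier ?Q" "module_span (R Quot I) ?Q BQ = carrier ?Q"
    and "indep_set BQ" by blast
  have indep: "\<forall>b\<in>F. c b = \<zero>\<^bsub>R Quot I\<^esub>"
    if "finite F" "F \<subseteq> BQ" "c \<in> F \<rightarrow> carrier (R Quot I)"
      "(\<Oplus>\<^bsub>?Q\<^esub>b\<in>F. c b \<odot>\<^bsub>?Q\<^esub> b) = \<zero>\<^bsub>?Q\<^esub>" for F c
    using \<open>indep_set BQ\<close>[unfolded indep_set_def, rule_format, OF that] by blast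
  have "\<forall>Y\<in>BQ. \<exists>x\<in>K. Y = p x" using BQ(1) p_onto by blast
  then obtain g where g: "\<And>Y. Y \<in> BQ \<Longrightarrow> g Y \<in> K \<and> Y = p (g Y)" by metis
  have inj: "inj_on g BQ" by (rule inj_onI) (metis g)
  let ?B = "g ` BQ"
  have BK: "?B \<subseteq> K" using g by blast
  have LK: "lincomb ?B \<subseteq> K" using K BK by (rule lincomb_subset)
  have "submodule (p ` lincomb ?B) (R Quot I) ?Q"
  proof (rule Q.submoduleI)
    show "p ` lincomb ?B \<subseteq> carrier ?Q" using p_car LK by blast
    show "\<zero>\<^bsub>?Q\<^esub> \<in> p ` lincomb ?B" using p0 series_moduleD(1)[OF series_module_lincomb] by (metis imageI)
    show "\<ominus>\<^bsub>?Q\<^esub> Y \<in> p ` lincomb ?B" if "Y \<in> p ` lincomb ?B" for Y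
      using that p_neg LK series_moduleD(4)[OF series_module_lincomb] by auto
    show "Y \<oplus>\<^bsub>?Q\<^esub> Z \<in> p ` lincomb ?B" if YZ: "Y \<in> p ` lincomb ?B" "Z \<in> p ` lincomb ?B" for Y Z
    proof -
      obtain x y where "x \<in> lincomb ?B" "y \<in> lincomb ?B" "Y = p x" "Z = p y" using YZ by blast
      moreover then have "Y \<oplus>\<^bsub>?Q\<^esub> Z = p (x + y)" using p_add LK by (metis subsetD)
      ultimately show ?thesis using series_moduleD(2)[OF series_module_lincomb] by blast
    qed
    show "Z \<odot>\<^bsub>?Q\<^esub> Y \<in> p ` lincomb ?B" if ZY: "Z \<in> carrier (R Quot I)" "Y \<in> p ` lincomb ?B" for Z Y
    proof -
      obtain r x where "r \<in> carrier R" "Z = I +>\<^bsub>R\<^esub> r" "x \<in> lincomb ?B" "Y = p x" using ZY RQ by blast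
      moreover then have "Z \<odot>\<^bsub>?Q\<^esub> Y = p (r * x)" using p_smult LK by (metis subsetD)
      ultimately show ?thesis using series_moduleD(3)[OF series_module_lincomb] by blast
    qed
  qed
  moreover have "BQ \<subseteq> p ` lincomb ?B"
  proof
    fix Y assume Y: "Y \<in> BQ"
    then have "g Y \<in> lincomb ?B" by (intro lincomb_generator imageI)
    then have "p (g Y) \<in> p ` lincomb ?B" by (rule imageI)
    then show "Y \<in> p ` lincomb ?B" using g[OF Y] by simp
  qed
  ultimately have "module_span (R Quot I) ?Q BQ \<subseteq> p ` lincomb ?B"
    unfolding module_span_def by blast
  then have onto: "carrier ?Q \<subseteq> p ` lincomb ?B" using BQ(2) by simp
  let ?N = "{x \<in> K. \<psi> x \<in> P}"
  have span: "\<exists>s\<in>lincomb ?B. x - s \<in> ?N" if x: "x \<in> K" for x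
  proof -
    have "p x \<in> p ` lincomb ?B" using onto p_car[OF x] by blast
    then obtain s where s: "p x = p s" "s \<in> lincomb ?B" by (rule imageE)
    have sK: "s \<in> K" "- s \<in> K" "x - s \<in> K" using s(2) LK K x series_moduleD(4,5) by blast+
    have "p (x - s) = p x \<oplus>\<^bsub>?Q\<^esub> p (- s)" using p_add[OF x sK(2)] by simp
    also have "\<dots> = p s \<oplus>\<^bsub>?Q\<^esub> \<ominus>\<^bsub>?Q\<^esub> p s" using s(1) p_neg[OF sK(1)] by simp
    also have "\<dots> = \<zero>\<^bsub>?Q\<^esub>" using p_car[OF sK(1)] by (rule Q.M.r_neg)
    finally show ?thesis using s(2) sK p_zero by blast
  qed
  have p_sum: "p (\<Sum>Y\<in>F. c Y * g Y) = (\<Oplus>\<^bsub>?Q\<^esub>Y\<in>F. (I +>\<^bsub>R\<^esub> c Y) \<odot>\<^bsub>?Q\<^esub> Y)"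
    if "finite F" "F \<subseteq> BQ" "\<forall>Y\<in>F. c Y \<in> carrier R" for F c
    using that
  proof (induction F rule: finite_induct)
    case empty then show ?case by (simp add: p0)
  next
    case (insert Y F)
    have Y: "g Y \<in> K" "Y = p (g Y)" "c Y \<in> carrier R" using g insert.prems by auto
    have cg: "c Y * g Y \<in> K" using K Y series_moduleD(3) by blast
    have sK: "(\<Sum>Y\<in>F. c Y * g Y) \<in> K"
      using insert.prems g by (intro series_module_sum[OF K] series_moduleD(3)[OF K]) auto
    have car: "(\<lambda>Y. (I +>\<^bsub>R\<^esub> c Y) \<odot>\<^bsub>?Q\<^esub> Y) \<in> F \<rightarrow> carrier ?Q"
      using insert.prems BQ(1) RQ by (intro funcsetI Q.smult_closed) auto
    have eq: "p (c Y * g Y) = (I +>\<^bsub>R\<^esub> c Y) \<odot>\<^bsub>?Q\<^esub> Y" using p_smult[OF Y(3,1)] Y(2) by simp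
    have "p (\<Sum>Y\<in>insert Y F. c Y * g Y) = p (c Y * g Y) \<oplus>\<^bsub>?Q\<^esub> p (\<Sum>Y\<in>F. c Y * g Y)"
      using insert.hyps p_add[OF cg sK] by simp
    also have "\<dots> = (I +>\<^bsub>R\<^esub> c Y) \<odot>\<^bsub>?Q\<^esub> Y \<oplus>\<^bsub>?Q\<^esub> (\<Oplus>\<^bsub>?Q\<^esub>Y\<in>F. (I +>\<^bsub>R\<^esub> c Y) \<odot>\<^bsub>?Q\<^esub> Y)"
      using insert eq by simp
    also have "\<dots> = (\<Oplus>\<^bsub>?Q\<^esub>Y\<in>insert Y F. (I +>\<^bsub>R\<^esub> c Y) \<odot>\<^bsub>?Q\<^esub> Y)"
      using Q.M.finsum_insert[OF insert.hyps(1,2) car] p_car[OF cg] eq by simp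
    finally show ?case .
  qed
  have ind: "\<forall>b\<in>F. c b \<in> I"
    if F: "finite F" "F \<subseteq> ?B" "\<forall>b\<in>F. c b \<in> carrier R" "(\<Sum>b\<in>F. c b * b) \<in> ?N" for F c
  proof -
    obtain F' where F': "F' \<subseteq> BQ" "F = g ` F'" using F(2) by (meson subset_imageE)
    have inj': "inj_on g F'" using inj F'(1) by (rule inj_on_subset)
    have fin: "finite F'" using F(1) F'(2) inj' by (simp add: finite_image_iff)
    have "(\<Sum>b\<in>F. c b * b) = (\<Sum>Y\<in>F'. c (g Y) * g Y)"
      unfolding F'(2) using inj' by (simp add: sum.reindex)
    then have "p (\<Sum>Y\<in>F'. c (g Y) * g Y) = \<zero>\<^bsub>?Q\<^esub>" using F(4) p_zero by simp
    then have "(\<Oplus>\<^bsub>?Q\<^esub>Y\<in>F'. (I +>\<^bsub>R\<^esub> c (g Y)) \<odot>\<^bsub>?Q\<^esub> Y) = \<zero>\<^bsub>?Q\<^esub>"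
      using p_sum[OF fin F'(1), of "\<lambda>Y. c (g Y)"] F(3) F'(2) by simp
    then have zero: "\<forall>Y\<in>F'. I +>\<^bsub>R\<^esub> c (g Y) = \<zero>\<^bsub>R Quot I\<^esub>"
      using F(3) F'(2) RQ by (intro indep[OF fin F'(1)]) auto
    have "c (g Y) \<in> I" if "Y \<in> F'" for Y
    proof (rule I.rcos_const_imp_mem)
      show "c (g Y) \<in> carrier R" using F(3) F'(2) that by blast
      show "I +>\<^bsub>R\<^esub> c (g Y) = I" using zero that by (simp add: FactRing_def)
    qed
    then show ?thesis using F'(2) by blast
  qed
  have "basis_modulo I K ?N ?B"
    unfolding basis_modulo_def using BK span ind by blast
  then show thesis using that unfolding P_def by blast
qed

lemma basis_moduloD:
  assumes "basis_modulo I K N B"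
  shows "B \<subseteq> K" "x \<in> K \<Longrightarrow> \<exists>s\<in>lincomb B. x - s \<in> N"
    "finite Fb \<Longrightarrow> Fb \<subseteq> B \<Longrightarrow> (\<And>b. b \<in> Fb \<Longrightarrow> c b \<in> carrier R) \<Longrightarrow>
      (\<Sum>b\<in>Fb. c b * b) \<in> N \<Longrightarrow> b \<in> Fb \<Longrightarrow> c b \<in> I"
proof -
  note B = assms[unfolded basis_modulo_def]
  show "B \<subseteq> K" using B by (rule conjunct1)
  show "x \<in> K \<Longrightarrow> \<exists>s\<in>lincomb B. x - s \<in> N"
    by (rule B[THEN conjunct2, THEN conjunct1, THEN bspec])
  show "finite Fb \<Longrightarrow> Fb \<subseteq> B \<Longrightarrow> (\<And>b. b \<in> Fb \<Longrightarrow> c b \<in> carrier R) \<Longrightarrow>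
      (\<Sum>b\<in>Fb. c b * b) \<in> N \<Longrightarrow> b \<in> Fb \<Longrightarrow> c b \<in> I"
    by (rule B[THEN conjunct2, THEN conjunct2, rule_format]) auto
qed

text \<open>
  \<open>M\<close> contains \<open>\<mm>K\<close> for the maximal ideal \<open>\<mm>\<close>, so that 1 and \<open>y\<close> are part of a minimal generating
  set of \<open>K\<close>. Elements outside \<open>M\<close> have a unit among their coordinates; let \<open>b0\<close> be such a place for 1, and
  let \<open>z\<close> be the quotient of the coordinates of \<open>y\<close> and 1 there. The relation \<open>x y = (x y) 1\<close> gives
  \<open>x z \<equiv> x y\<close> modulo \<open>c\<close> at the place \<open>b0\<close>, so \<open>x (y - z)\<close> vanishes in \<open>K/c\<close>; looking at a unit
  coordinate of \<open>y - z\<close> one finds \<open>x \<in> c\<close>.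
\<close>

lemma minimal_generator_annihilator:
  assumes K: "series_module K" and one: "1 \<in> K" and B: "basis_modulo c K c B"
    and c: "c \<subseteq> nonunits" "series_module c"
    and M: "series_module M" "M \<subseteq> K" "\<And>d y. d \<in> nonunits \<Longrightarrow> y \<in> K \<Longrightarrow> d * y \<in> M" "1 \<notin> M"
    and y: "y \<in> K" "\<And>z. z \<in> carrier R \<Longrightarrow> y - z \<notin> M"
    and x: "x \<in> carrier R" "x * y \<in> carrier R"
  shows "x \<in> c"
proof -
  have BK: "B \<subseteq> K" using B by (rule basis_moduloD(1))
  have unit_coeff: "\<exists>b\<in>Fb. d b \<notin> nonunits"
    if w: "w - (\<Sum>b\<in>Fb. d b * b) \<in> c" "Fb \<subseteq> B" "w \<notin> M" for w Fb d
  proof (rule ccontr)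
    assume "\<not> ?thesis"
    then have "(\<Sum>b\<in>Fb. d b * b) \<in> M" using w(2) BK by (intro series_module_sum[OF M(1)] M(3)) auto
    moreover have "w - (\<Sum>b\<in>Fb. d b * b) \<in> M" using M(3)[of _ 1] w(1) c(1) one by fastforce
    ultimately have "(w - (\<Sum>b\<in>Fb. d b * b)) + (\<Sum>b\<in>Fb. d b * b) \<in> M" using M(1) series_moduleD(2) by blast
    then show False using w(3) by simp
  qed
  have coord: "\<exists>Fb d. finite Fb \<and> Fb \<subseteq> B \<and> (\<forall>b. d b \<in> carrier R) \<and> (\<forall>b. b \<notin> Fb \<longrightarrow> d b = 0) \<and>
      w - (\<Sum>b\<in>Fb. d b * b) \<in> c" if w: "w \<in> K" for w
  proof -
    obtain s where "s \<in> lincomb B" and ws: "w - s \<in> c" using basis_moduloD(2)[OF B w] by blast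
    then obtain Fb d where s: "s = (\<Sum>b\<in>Fb. d b * b)" "finite Fb" "Fb \<subseteq> B" "\<And>b. b \<in> Fb \<Longrightarrow> d b \<in> carrier R"
      by - (erule lincombE, blast)
    have "(\<Sum>b\<in>Fb. (if b \<in> Fb then d b else 0) * b) = s" unfolding s(1) by (rule sum.cong) auto
    then show ?thesis using s ws
      by (intro exI[of _ Fb] exI[of _ "\<lambda>b. if b \<in> Fb then d b else 0"]) auto
  qed
  obtain F1 d1 where d1: "finite F1" "F1 \<subseteq> B" "\<And>b. d1 b \<in> carrier R" "\<And>b. b \<notin> F1 \<Longrightarrow> d1 b = 0"
    "1 - (\<Sum>b\<in>F1. d1 b * b) \<in> c" using coord[OF one] by blast
  obtain F2 d2 where d2: "finite F2" "F2 \<subseteq> B" "\<And>b. d2 b \<in> carrier R" "\<And>b. b \<notin> F2 \<Longrightarrow> d2 b = 0"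
    "y - (\<Sum>b\<in>F2. d2 b * b) \<in> c" using coord[OF y(1)] by blast
  let ?F = "F1 \<union> F2"
  have s1: "(\<Sum>b\<in>F1. d1 b * b) = (\<Sum>b\<in>?F. d1 b * b)"
    by (rule sum.mono_neutral_left) (use d1 d2 in auto)
  have s2: "(\<Sum>b\<in>F2. d2 b * b) = (\<Sum>b\<in>?F. d2 b * b)"
    by (rule sum.mono_neutral_left) (use d1 d2 in auto)
  obtain b0 where b0: "b0 \<in> F1" "d1 b0 \<notin> nonunits" using unit_coeff[OF d1(5,2) M(4)] by blast
  have u: "d1 b0 $$ 0 \<noteq> 0" "d1 b0 \<noteq> 0" using b0(2) d1(3)[of b0] by (auto simp: nonunits_def)
  have inv: "inverse (d1 b0) \<in> carrier R" using d1(3) u(1) by (rule inverse_closed)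
  have fin: "finite ?F" and FB: "?F \<subseteq> B" using d1(1,2) d2(1,2) by auto
  have sum_xy: "(\<Sum>b\<in>?F. (x * d2 b - (x * y) * d1 b) * b) =
      (x * y) * (1 - (\<Sum>b\<in>F1. d1 b * b)) - x * (y - (\<Sum>b\<in>F2. d2 b * b))"
    unfolding s1 s2 by (simp add: algebra_simps sum_subtractf sum_distrib_left)
  have "(\<Sum>b\<in>?F. (x * d2 b - (x * y) * d1 b) * b) \<in> c"
    unfolding sum_xy using d1(5) d2(5) x c(2) series_moduleD(3,5) by blast
  moreover have "x * d2 b - (x * y) * d1 b \<in> carrier R" for b
    by (intro diff_closed mult_closed x d1(3) d2(3))
  ultimately have all: "x * d2 b - (x * y) * d1 b \<in> c" if "b \<in> ?F" for b
    using basis_moduloD(3)[OF B fin FB, of "\<lambda>b. x * d2 b - (x * y) * d1 b" b] that by blast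
  define z where "z = d2 b0 * inverse (d1 b0)"
  have zR: "z \<in> carrier R" unfolding z_def using d2(3) inv by (rule mult_closed)
  have xyz: "x * z - x * y \<in> c"
  proof -
    have "inverse (d1 b0) * (x * d2 b0 - (x * y) * d1 b0) \<in> c"
      using all[of b0] b0(1) inv c(2) series_moduleD(3) by blast
    moreover have "inverse (d1 b0) * (x * d2 b0 - (x * y) * d1 b0) = x * z - x * y"
      using u(2) by (simp add: z_def field_simps)
    ultimately show ?thesis by simp
  qed
  have "(y - z) - (\<Sum>b\<in>?F. (d2 b - z * d1 b) * b) \<in> c"
  proof -
    have "(y - z) - (\<Sum>b\<in>?F. (d2 b - z * d1 b) * b) =
        (y - (\<Sum>b\<in>F2. d2 b * b)) - z * (1 - (\<Sum>b\<in>F1. d1 b * b))"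
      unfolding s1 s2 by (simp add: algebra_simps sum_subtractf sum_distrib_left)
    also have "\<dots> \<in> c" using d1(5) d2(5) zR c(2) series_moduleD(3,5) by blast
    finally show ?thesis .
  qed
  then obtain b1 where b1: "b1 \<in> ?F" "d2 b1 - z * d1 b1 \<notin> nonunits"
    using unit_coeff[of "y - z" "\<lambda>b. d2 b - z * d1 b" ?F] d1(2) d2(2) y(2)[OF zR] by blast
  define v where "v = d2 b1 - z * d1 b1"
  have v: "v \<in> carrier R" unfolding v_def using d1(3) d2(3) zR mult_closed diff_closed by blast
  then have v0: "v $$ 0 \<noteq> 0" "v \<noteq> 0" using b1(2) unfolding v_def[symmetric] by (auto simp: nonunits_def)
  have "(x * d2 b1 - (x * y) * d1 b1) - d1 b1 * (x * z - x * y) \<in> c"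
    using all[OF b1(1)] xyz d1(3) c(2) series_moduleD(3,5) by blast
  moreover have "(x * d2 b1 - (x * y) * d1 b1) - d1 b1 * (x * z - x * y) = x * v"
    by (simp add: v_def algebra_simps)
  ultimately have "inverse v * (x * v) \<in> c"
    using inverse_closed[OF v v0(1)] c(2) series_moduleD(3) by simp
  then show ?thesis using v0(2) by (simp add: field_simps)
qed

end

section \<open>The exact sequence of a generalised Gorenstein ring\<close>

lemma (in numerical_semigroup_series) ideal_power_nth:
  assumes I: "I \<subseteq> nonunits" and x: "x \<in> ideal_power R I n"
  shows "x \<in> carrier R \<and> (\<forall>m<int n. x $$ m = 0)"
  using x
proof (induction n arbitrary: x)
  case 0
  then show ?case using nth_neg by (simp add: ideal_power_def)
next
  case (Suc n)
  have "x \<in> ideal_prod R I (ideal_power R I n)" using Suc.prems by (simp add: ideal_power_def)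
  then show ?case
  proof (induction rule: ideal_prod.induct)
    case (prod i j)
    have i: "i \<in> carrier R" "i $$ 0 = 0" using prod(1) I by (auto simp: nonunits_def)
    have j: "j \<in> carrier R" "\<And>m. m < int n \<Longrightarrow> j $$ m = 0" using Suc.IH[OF prod(2)] by auto
    have "i $$ m = 0" if "m < 1" for m using that i nth_neg[of i m] by (cases "m = 0") auto
    then have "(i * j) $$ m = 0" if "m < int (Suc n)" for m
      using j(2) that by (intro fls_mult_nth_below[of 1 i "int n" j]) auto
    then show ?case using i j mult_closed by simp
  next
    case (sum s1 s2)
    then show ?case using add_closed by simp
  qed
qed

text \<open>
  An exact sequence \<open>R \<rightarrow> K \<rightarrow> C \<rightarrow> 0\<close> whose first map sends 1 to \<open>a\<close>: the module \<open>C\<close> is \<open>K/Ra\<close>.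
\<close>

locale cyclic_cokernel = numerical_semigroup_series H R F
  for H and R :: "'k::field fls ring" and F +
  fixes K :: "'k fls set" and a :: "'k fls" and C :: "('k fls, 'c) module" and \<psi>
  assumes K: "series_module K" and K_nth_neg: "x \<in> K \<Longrightarrow> m < 0 \<Longrightarrow> x $$ m = 0"
    and a: "a \<in> K" "a \<noteq> 0" and C: "module R C" and lin: "linear_map R (fractional_module K) C \<psi>"
    and surj: "\<psi> ` K = carrier C"
    and kernel: "x \<in> K \<Longrightarrow> \<psi> x = \<zero>\<^bsub>C\<^esub> \<longleftrightarrow> (\<exists>r\<in>carrier R. x = r * a)"
begin

sublocale C: module R C by (rule C)

lemma psi:
  "x \<in> K \<Longrightarrow> \<psi> x \<in> carrier C" "x \<in> K \<Longrightarrow> y \<in> K \<Longrightarrow> \<psi> (x + y) = \<psi> x \<oplus>\<^bsub>C\<^esub> \<psi> y"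
  "r \<in> carrier R \<Longrightarrow> x \<in> K \<Longrightarrow> \<psi> (r * x) = r \<odot>\<^bsub>C\<^esub> \<psi> x"
  using lin unfolding linear_map_def by auto

text \<open>
  Series of order at least this number lie in \<open>Ra\<close>.
\<close>

definition bound :: int where "bound = fls_subdegree a + F"

lemma psi_high:
  assumes "x \<in> K" "\<And>m. m < bound \<Longrightarrow> x $$ m = 0" shows "\<psi> x = \<zero>\<^bsub>C\<^esub>"
proof -
  have "a \<in> {r * a |r. r \<in> carrier R}" by (auto intro!: exI[of _ 1])
  then have "x \<in> {r * a |r. r \<in> carrier R}"
    using high_mem_module[OF series_module_principal _ a(2)] assms(2) unfolding bound_def by blast
  then show ?thesis using kernel[OF assms(1)] by blast
qed

lemma high_annihilates:
  assumes r: "r \<in> carrier R" "\<And>m. m < bound \<Longrightarrow> r $$ m = 0" and y: "y \<in> carrier C"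
  shows "r \<odot>\<^bsub>C\<^esub> y = \<zero>\<^bsub>C\<^esub>"
proof -
  have "y \<in> \<psi> ` K" using y surj by simp
  then obtain x where x: "x \<in> K" "y = \<psi> x" by blast
  have rx: "r * x \<in> K" using K r x series_moduleD(3) by blast
  have "(r * x) $$ m = 0" if "m < bound" for m
    using r(2) K_nth_neg[OF x(1)] that by (intro fls_mult_nth_below[of bound r 0 x]) auto
  then have "\<psi> (r * x) = \<zero>\<^bsub>C\<^esub>" by (rule psi_high[OF rx])
  then show ?thesis using psi(3)[OF r(1) x(1)] x(2) by simp
qed

text \<open>
  All series of high order annihilate \<open>C\<close>, which leaves only one prime above the annihilator.
\<close>

lemma module_dim_cokernel: "module_dim R C = 0"
proof -
  have eq: "P = nonunits" if P: "primeideal P R" "annihilator R C \<subseteq> P" for P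
  proof (rule prime_eq_nonunits[OF P(1), of "max F bound"])
    fix y :: "'k fls" assume y: "\<And>m. m < max F bound \<Longrightarrow> y $$ m = 0"
    have "y \<in> carrier R" by (rule high_mem_carrier) (simp add: y)
    then have "y \<in> annihilator R C" using high_annihilates[of y] y by (simp add: annihilator_def)
    then show "y \<in> P" using P(2) by blast
  qed
  have "n = 0" if P: "\<forall>i\<le>n. primeideal (P i) R \<and> annihilator R C \<subseteq> P i" "\<forall>i<n. P i \<subset> P (Suc i)"
    for n :: nat and P
  proof (rule ccontr)
    assume "n \<noteq> 0"
    then have "P 0 \<subset> P (Suc 0)" "P 0 = nonunits" "P (Suc 0) = nonunits" using P eq by auto
    then show False by simp
  qed
  then have "module_dim R C \<le> 0" unfolding module_dim_def
    by (intro Sup_least) (auto simp: zero_enat_def)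
  then show ?thesis by simp
qed

lemma chain_length_le:
  assumes "has_chain R C {\<zero>\<^bsub>C\<^esub>} n" shows "n \<le> card {0..<bound}"
proof -
  obtain V where V: "\<And>i. i \<le> n \<Longrightarrow> submodule (V i) R C" "\<And>i. i < n \<Longrightarrow> V i \<subset> V (Suc i)"
    using assms unfolding has_chain_def by blast
  define U where "U i = {x \<in> K. \<psi> x \<in> V i}" for i
  have zero: "\<zero>\<^bsub>C\<^esub> \<in> V i" if "i \<le> n" for i using C.zero_in_submodule V(1)[OF that] by blast
  have psi0: "\<psi> 0 = \<zero>\<^bsub>C\<^esub>" using psi_high[of 0] K series_moduleD(1) by simp
  have "series_module (U i)" if i: "i \<le> n" for i
  proof (rule series_moduleI)
    note E = C.submoduleE[OF V(1)[OF i]]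
    show "0 \<in> U i" using psi0 zero[OF i] K series_moduleD(1) by (simp add: U_def)
    show "x + y \<in> U i" if "x \<in> U i" "y \<in> U i" for x y
      using that E(5) K series_moduleD(2) psi(2) by (simp add: U_def)
    show "r * x \<in> U i" if "r \<in> carrier R" "x \<in> U i" for r x
      using that E(4) K series_moduleD(3) psi(3) by (simp add: U_def)
  qed
  then have "kspace (U i)" if "i \<le> n" for i using that kspace_if_series_module by blast
  moreover have "U i \<subset> U (Suc i)" if i: "i < n" for i
  proof -
    obtain y where y: "y \<in> V (Suc i)" "y \<notin> V i" using V(2)[OF i] by blast
    have "y \<in> carrier C" using y C.submoduleE(1)[OF V(1)[of "Suc i"]] i by auto
    then have "y \<in> \<psi> ` K" using surj by simp
    then obtain x where x: "x \<in> K" "y = \<psi> x" by blast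
    have "x \<in> U (Suc i)" "x \<notin> U i" using x y by (simp_all add: U_def)
    moreover have "U i \<subseteq> U (Suc i)" using V(2)[OF i] by (auto simp: U_def)
    ultimately show ?thesis by blast
  qed
  moreover have "x \<in> U 0" if x: "x \<in> U n" "\<forall>q\<in>{0..<bound}. x $$ q = 0" for x
  proof -
    have xK: "x \<in> K" using x by (simp add: U_def)
    have "\<psi> x = \<zero>\<^bsub>C\<^esub>"
    proof (rule psi_high[OF xK])
      show "x $$ m = 0" if m: "m < bound" for m
        using m x(2) K_nth_neg[OF xK, of m] by (cases "m < 0") auto
    qed
    then show ?thesis using xK zero[of 0] by (simp add: U_def)
  qed
  ultimately show ?thesis by (intro chain_length_le_card[of _ n U]) auto
qed

lemma length_finite:
  obtains d where "module_length R (quotient_module C {\<zero>\<^bsub>C\<^esub>}) = enat d"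
proof -
  have "module_length R (quotient_module C {\<zero>\<^bsub>C\<^esub>}) \<le> enat (card {0..<bound})"
    unfolding C.quotient_length[OF C.submodule_zero] using chain_length_le by (intro Sup_least) auto
  then show thesis using that by (cases "module_length R (quotient_module C {\<zero>\<^bsub>C\<^esub>})") auto
qed

text \<open>
  In dimension 0 the multiplicity is the limit of the lengths of \<open>C/I\<^sup>n\<^sup>+\<^sup>1C\<close>, and \<open>I\<^sup>n\<^sup>+\<^sup>1C = 0\<close> for
  large \<open>n\<close>. So the Ulrich condition says that \<open>C\<close> and \<open>C/IC\<close> have the same length.
\<close>

lemma ideal_kills_ulrich:
  assumes I: "ideal I R" "I \<subseteq> nonunits" and U: "ulrich_module R I C"
  shows "ideal_times R I C = {\<zero>\<^bsub>C\<^esub>}"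
proof -
  obtain l where l: "module_length R (reduction R I C) = enat l" "multiplicity_wrt R I C = real l"
    using U unfolding ulrich_module_def by blast
  obtain d where d: "module_length R (quotient_module C {\<zero>\<^bsub>C\<^esub>}) = enat d" by (rule length_finite)
  have kill: "ideal_times R (ideal_power R I (Suc n)) C = {\<zero>\<^bsub>C\<^esub>}" if n: "bound \<le> int n" for n
  proof (rule C.ideal_times_eq_zero)
    note P = ideal_power_nth[OF I(2), of _ "Suc n"]
    show "ideal_power R I (Suc n) \<subseteq> carrier R" using P by blast
    fix r x assume r: "r \<in> ideal_power R I (Suc n)" and x: "x \<in> carrier C"
    show "r \<odot>\<^bsub>C\<^esub> x = \<zero>\<^bsub>C\<^esub>"
      by (rule high_annihilates) (use P[OF r] n x in auto)
  qed
  let ?f = "\<lambda>n. real (the_enat (module_length R (reduction R (ideal_power R I (Suc n)) C)))"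
  have "?f n = real d" if "bound \<le> int n" for n
    using kill[OF that] d by (simp add: reduction_def)
  then have "\<forall>n\<ge>nat bound. ?f n = real d" by (metis nat_le_iff)
  then have "eventually (\<lambda>n. ?f n = real d) sequentially" by (auto simp: eventually_sequentially)
  then have "?f \<longlonglongrightarrow> real d" by (rule tendsto_eventually)
  then have "lim ?f = real d" by (rule limI)
  moreover have "the_enat (module_dim R C) = 0"
    unfolding module_dim_cokernel zero_enat_def by simp
  ultimately have "multiplicity_wrt R I C = real d"
    unfolding multiplicity_wrt_def Let_def by simp
  then have "l = d" using l(2) by simp
  then show ?thesis using C.ideal_times_zero_if_length_eq l(1) d I(1) by (simp add: ideal_iff)
qed

lemma psi_kernel_eq:
  "{x \<in> K. \<psi> x \<in> {\<zero>\<^bsub>C\<^esub>}} = {r * a |r. r \<in> carrier R}"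
  using kernel K a(1) series_moduleD(3) by blast

end

context numerical_semigroup_series
begin

text \<open>
  The colon ideal \<open>R : K\<close>, provided that \<open>1 \<in> K\<close>.
\<close>

definition conductor_ideal :: "'a fls set \<Rightarrow> 'a fls set" where
  "conductor_ideal K = {x \<in> carrier R. \<forall>y\<in>K. x * y \<in> carrier R}"

lemma series_module_conductor_ideal: "series_module (conductor_ideal K)"
  by (rule series_moduleI)
     (auto simp: conductor_ideal_def add_closed mult_closed distrib_right mult.assoc)

text \<open>
  The heart of the argument. Put \<open>\<aa> = R : K\<close> and let \<open>a\<close> be the image of 1 in the exact sequence.
  The Ulrich condition gives \<open>I K \<subseteq> Ra\<close>. Since \<open>C = K/Ra\<close> is free and not 0, its annihilator is \<open>I\<close>,
  which means \<open>I = a \<aa>\<close>. The bases of \<open>K/IK\<close> and \<open>C\<close> show that \<open>x a \<in> I K\<close> implies \<open>x \<in> I\<close>. So for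
  \<open>x \<in> \<aa>\<close> and \<open>y \<in> K\<close> the relation \<open>(x y) a = (x a) y \<in> I K\<close> yields \<open>x y \<in> I = a \<aa>\<close>. As \<open>1 \<in> K\<close>,
  comparison of orders makes \<open>a\<close> a unit of \<open>k[[t]]\<close>, and then \<open>\<aa> \<subseteq> a \<aa>\<close> have the same leading
  exponents, hence are equal. Thus \<open>\<aa>\<close> is stable under \<open>K\<close>, and \<open>I = \<aa> = I K\<close>, so that the freeness of
  \<open>K/IK\<close> is the second assertion.
\<close>

theorem ggl_conductor:
  assumes K: "series_module K" and one: "1 \<in> K" and K_nth_neg: "\<And>x m. x \<in> K \<Longrightarrow> m < 0 \<Longrightarrow> x $$ m = 0"
    and proper: "\<not> K \<subseteq> carrier R" and ggl: "ggl_ring R (fractional_module K)"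
  shows "\<forall>x\<in>conductor_ideal K. \<forall>y\<in>K. x * y \<in> conductor_ideal K"
    and "\<exists>B. basis_modulo (conductor_ideal K) K (conductor_ideal K) B"
proof -
  let ?c = "conductor_ideal K"
  obtain I C \<phi> \<psi> where prim: "m_primary R I" and C: "module R (C :: ('a fls, 'a fls set) module)"
    and seq: "short_exact R (self_module R) (fractional_module K) C \<phi> \<psi>" and U: "ulrich_module R I C"
    and freeK: "free_module (R Quot I) (reduction_over_quot R I (fractional_module K))"
    using ggl unfolding ggl_ring_def by blast
  have I: "ideal I R" "I \<noteq> carrier R" using prim by (auto simp: m_primary_def)
  then have I': "I \<subseteq> carrier R" "series_module I" by (auto simp: ideal_iff)
  have In: "I \<subseteq> nonunits" using proper_subset_nonunits I I' by blast
  have freeC: "free_module (R Quot I) (reduction_over_quot R I C)"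
    and CM: "nonzero_cohen_macaulay R C" using U by (auto simp: ulrich_module_def)
  define a where "a = \<phi> 1"
  have \<phi>: "\<phi> r = r * a" "\<phi> r \<in> K" if "r \<in> carrier R" for r
    using seq that closed(2) unfolding short_exact_def linear_map_def a_def self_module_eq
    by (auto, metis mult.right_neutral)
  have aK: "a \<in> K" unfolding a_def using \<phi>(2) closed(2) by blast
  have inj: "inj_on \<phi> (carrier R)" and surj: "\<psi> ` K = carrier C"
    and ker: "\<phi> ` carrier R = {x \<in> K. \<psi> x = \<zero>\<^bsub>C\<^esub>}"
    and lin: "linear_map R (fractional_module K) C \<psi>"
    using seq unfolding short_exact_def self_module_eq by auto
  have a0: "a \<noteq> 0"
  proof
    assume "a = 0"
    then have "\<phi> 0 = \<phi> 1" using \<phi>(1) closed(1,2) by simp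
    then show False using inj_onD[OF inj, of 0 1] by simp
  qed
  interpret cyclic_cokernel H R F K a C \<psi>
  proof (rule cyclic_cokernel.intro[OF numerical_semigroup_series_axioms], rule cyclic_cokernel_axioms.intro)
    fix x assume x: "x \<in> K"
    have "\<psi> x = \<zero>\<^bsub>C\<^esub> \<longleftrightarrow> x \<in> \<phi> ` carrier R" unfolding ker using x by simp
    also have "\<dots> \<longleftrightarrow> (\<exists>r\<in>carrier R. x = r * a)" using \<phi>(1) by (auto simp: image_iff)
    finally show "\<psi> x = \<zero>\<^bsub>C\<^esub> \<longleftrightarrow> (\<exists>r\<in>carrier R. x = r * a)" .
  qed (fact K K_nth_neg aK a0 C lin surj)+
  interpret KM: module R "fractional_module K" using K by (rule module_fractional)
  let ?Ra = "{r * a |r. r \<in> carrier R}"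
  have IC: "ideal_times R I C = {\<zero>\<^bsub>C\<^esub>}" using I(1) In U by (rule ideal_kills_ulrich)
  have prod_Ra: "x * y \<in> ?Ra" if x: "x \<in> I" and y: "y \<in> K" for x y
  proof -
    have xR: "x \<in> carrier R" using x I' by blast
    have "x \<odot>\<^bsub>C\<^esub> \<psi> y \<in> ideal_times R I C" using x psi(1)[OF y] by (rule C.ideal_times_product)
    then have "\<psi> (x * y) = \<zero>\<^bsub>C\<^esub>" using IC psi(3)[OF xR y] by simp
    moreover have "x * y \<in> K" using K xR y series_moduleD(3) by blast
    ultimately show ?thesis using kernel by blast
  qed
  define IK where "IK = ideal_times R I (fractional_module K)"
  have IK: "series_module IK" "IK \<subseteq> K"
    using KM.submodule_ideal_times[OF I'(1)] submodule_iff[OF K] by (auto simp: IK_def)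
  have IK_prod: "x * y \<in> IK" if "x \<in> I" "y \<in> K" for x y
    using KM.ideal_times_product[of x I y] that by (simp add: IK_def)
  have IK_least: "IK \<subseteq> V" if "series_module V" "V \<subseteq> K" "\<And>x y. x \<in> I \<Longrightarrow> y \<in> K \<Longrightarrow> x * y \<in> V" for V
    unfolding IK_def using that submodule_iff[OF K] by (intro KM.ideal_times_least) auto
  obtain BC where "basis_modulo I K {x \<in> K. \<psi> x \<in> ideal_times R I C} BC"
    using lift_basis[OF K I(1) C lin surj freeC] by blast
  then have BC: "basis_modulo I K ?Ra BC" unfolding IC psi_kernel_eq .
  have lin_id: "linear_map R (fractional_module K) (fractional_module K) (\<lambda>x. x)"
    using K series_moduleD(2,3) unfolding linear_map_def by auto
  obtain BK where "basis_modulo I K {x \<in> K. x \<in> ideal_times R I (fractional_module K)} BK"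
    using lift_basis[OF K I(1) module_fractional[OF K] lin_id _ freeK] by auto
  moreover have "{x \<in> K. x \<in> ideal_times R I (fractional_module K)} = IK" using IK(2) by (auto simp: IK_def)
  ultimately have BK: "basis_modulo I K IK BK" by simp
  have "BC \<noteq> {}"
  proof
    assume "BC = {}"
    then have "lincomb BC = {0}" by (auto simp: lincomb_def intro!: exI[of _ "{}"])
    then have "x \<in> ?Ra" if "x \<in> K" for x
      using basis_moduloD(2)[OF BC that] by simp
    then have "\<psi> x = \<zero>\<^bsub>C\<^esub>" if "x \<in> K" for x using that kernel by blast
    then have "\<psi> ` K \<subseteq> {\<zero>\<^bsub>C\<^esub>}" by (intro image_subsetI) simp
    then have "carrier C \<subseteq> {\<zero>\<^bsub>C\<^esub>}" unfolding surj .
    then show False using CM C.M.zero_closed unfolding nonzero_cohen_macaulay_def by blast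
  qed
  \<comment> \<open>\<open>C\<close> is free and nonzero, so its annihilator is exactly \<open>I\<close>\<close>
  have I_iff: "x \<in> I \<longleftrightarrow> x \<in> carrier R \<and> (\<forall>y\<in>K. x * y \<in> ?Ra)" for x
  proof
    assume "x \<in> I" then show "x \<in> carrier R \<and> (\<forall>y\<in>K. x * y \<in> ?Ra)" using prod_Ra I' by blast
  next
    assume x: "x \<in> carrier R \<and> (\<forall>y\<in>K. x * y \<in> ?Ra)"
    obtain b where b: "b \<in> BC" using \<open>BC \<noteq> {}\<close> by blast
    then have "b \<in> K" using basis_moduloD(1)[OF BC] by blast
    then have "(\<Sum>y\<in>{b}. x * y) \<in> ?Ra" using x by simp
    then show "x \<in> I" using basis_moduloD(3)[OF BC, of "{b}" "\<lambda>_. x" b] b x by simp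
  qed
  \<comment> \<open>this and the next step: \<open>I = a (R : K)\<close>\<close>
  have c_I: "x * a \<in> I" if x: "x \<in> ?c" for x
  proof -
    have "(x * a) * y \<in> ?Ra" if "y \<in> K" for y
    proof -
      have "(x * a) * y = (x * y) * a" by (simp add: ac_simps)
      moreover have "x * y \<in> carrier R" using x \<open>y \<in> K\<close> by (simp add: conductor_ideal_def)
      ultimately show ?thesis by blast
    qed
    then show ?thesis using x aK unfolding I_iff conductor_ideal_def by blast
  qed
  have I_c: "x / a \<in> ?c" if x: "x \<in> I" for x
  proof -
    have "x / a * y \<in> carrier R" if "y \<in> K" for y
    proof -
      obtain r where "r \<in> carrier R" "x * y = r * a" using x \<open>y \<in> K\<close> I_iff by blast
      then have "x / a * y = r" using a0 by (simp add: field_simps)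
      then show ?thesis using \<open>r \<in> carrier R\<close> by simp
    qed
    moreover from this[OF one] have "x / a \<in> carrier R" by simp
    ultimately show ?thesis by (simp add: conductor_ideal_def)
  qed
  have c_sub: "?c \<subseteq> carrier R" by (auto simp: conductor_ideal_def)
  have "1 \<notin> ?c" using proper by (auto simp: conductor_ideal_def)
  then have c_nonunits: "?c \<subseteq> nonunits"
    using proper_subset_nonunits[OF series_module_conductor_ideal c_sub] closed(2) by metis
  \<comment> \<open>otherwise \<open>1 = a/a\<close> would lie in \<open>(I/a) K = (R : K) K\<close>, all of whose elements are nonunits of \<open>R\<close>\<close>
  have a_notin: "a \<notin> IK"
  proof
    assume aIK: "a \<in> IK"
    define V where "V = {z \<in> K. z / a \<in> nonunits}"
    have "series_module V"
      using K series_module_nonunits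
      by (intro series_moduleI) (auto simp: V_def series_moduleD add_divide_distrib simp flip: times_divide_eq_right)
    moreover have "x * y \<in> V" if x: "x \<in> I" and y: "y \<in> K" for x y
    proof -
      have "x * y \<in> K" using K x y I' series_moduleD(3) by blast
      moreover have "x / a * y \<in> carrier R" using I_c[OF x] y by (simp add: conductor_ideal_def)
      moreover have xa: "x / a \<in> nonunits" using I_c[OF x] c_nonunits by blast
      have "(x / a * y) $$ 0 = (x / a) $$ 0 * y $$ 0"
        using nth_neg[of "x / a"] xa nonunits_subset K_nth_neg[OF y] by (intro mult_nth_0) auto
      then have "(x / a * y) $$ 0 = 0" using xa by (simp add: nonunits_def)
      ultimately show ?thesis by (simp add: V_def nonunits_def)
    qed
    ultimately have "IK \<subseteq> V" by (intro IK_least) (auto simp: V_def)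
    then have "a / a \<in> nonunits" using aIK by (auto simp: V_def)
    then show False using a0 one_notin_nonunits by simp
  qed
  \<comment> \<open>If a coordinate of \<open>a\<close> in \<open>K/IK\<close> is a unit, it detects \<open>x\<close>. Otherwise \<open>a\<close> lies in \<open>\<mm>K\<close>, and
    the basis of \<open>K/Ra\<close> shows \<open>a \<in> I K\<close>, which was excluded.\<close>
  have J: "x \<in> I" if x: "x \<in> carrier R" "x * a \<in> IK" for x
  proof -
    obtain s where "s \<in> lincomb BK" "a - s \<in> IK" using basis_moduloD(2)[OF BK aK] by blast
    then obtain Fb c where s: "s = (\<Sum>b\<in>Fb. c b * b)" "finite Fb" "Fb \<subseteq> BK" "\<And>b. b \<in> Fb \<Longrightarrow> c b \<in> carrier R"
      and as: "a - s \<in> IK" by - (erule lincombE, blast)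
    show ?thesis
    proof (cases "\<exists>b\<in>Fb. c b \<notin> nonunits")
      case True
      then obtain b where b: "b \<in> Fb" "c b \<notin> nonunits" by blast
      have cb: "c b \<in> carrier R" "c b $$ 0 \<noteq> 0" "c b \<noteq> 0" using b s(4) by (auto simp: nonunits_def)
      have "x * a - x * (a - s) \<in> IK" using x as IK series_moduleD(3,5) by blast
      moreover have "x * a - x * (a - s) = (\<Sum>b\<in>Fb. (x * c b) * b)"
        unfolding s(1) by (simp add: algebra_simps sum_distrib_left)
      ultimately have "(\<Sum>b\<in>Fb. (x * c b) * b) \<in> IK" by simp
      then have "x * c b \<in> I"
        using basis_moduloD(3)[OF BK s(2,3), of "\<lambda>b. x * c b" b] b(1) s(4) x(1) mult_closed by blast
      then have "inverse (c b) * (x * c b) \<in> I"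
        using I'(2) inverse_closed[OF cb(1,2)] series_moduleD(3) by blast
      then show ?thesis using cb(3) by (simp add: field_simps)
    next
      case False
      \<comment> \<open>\<open>Z\<close> contains \<open>\<mm>K\<close>, because \<open>K\<close> is spanned by the basis \<open>BC\<close> and \<open>a\<close>\<close>
      define Z where "Z = {u + d * a |u d. u \<in> lincomb BC \<and> d \<in> nonunits}"
      have LC: "lincomb BC \<subseteq> K" using lincomb_subset[OF K basis_moduloD(1)[OF BC]] .
      have nK: "d * a \<in> K" if "d \<in> nonunits" for d using that K aK nonunits_subset series_moduleD(3) by blast
      have "Z = {u + v |u v. u \<in> lincomb BC \<and> v \<in> {d * a |d. d \<in> nonunits}}"
        unfolding Z_def by blast
      then have Z: "series_module Z"
        by (simp only: series_module_plus series_module_lincomb series_module_scale series_module_nonunits)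
      have ZK: "Z \<subseteq> K" unfolding Z_def using LC nK K series_moduleD(2) by blast
      have nZ: "d * y \<in> Z" if d: "d \<in> nonunits" and y: "y \<in> K" for d y
      proof -
        obtain u r where ur: "u \<in> lincomb BC" "r \<in> carrier R" "y - u = r * a"
          using basis_moduloD(2)[OF BC y] by blast
        have dR: "d \<in> carrier R" using d nonunits_subset by blast
        have "y = u + r * a" using ur(3) by (simp add: algebra_simps)
        then have "d * y = d * u + (r * d) * a" by (simp add: algebra_simps)
        moreover have "d * u \<in> lincomb BC" "r * d \<in> nonunits"
          using series_moduleD(3)[OF series_module_lincomb dR ur(1)]
            series_moduleD(3)[OF series_module_nonunits ur(2) d] by auto
        ultimately show ?thesis unfolding Z_def by blast
      qed
      have "IK \<subseteq> Z" using Z ZK nZ In by (intro IK_least) auto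
      moreover have "s \<in> Z" unfolding s(1)
        using False s(3) basis_moduloD(1)[OF BK] by (intro series_module_sum[OF Z] nZ) auto
      ultimately have "(a - s) + s \<in> Z" using as Z series_moduleD(2) by blast
      then obtain u d where ud: "a = u + d * a" "u \<in> lincomb BC" "d \<in> nonunits" unfolding Z_def by auto
      \<comment> \<open>\<open>a = u + d a\<close> with \<open>1 - d\<close> a unit: \<open>a\<close> is a combination of \<open>BC\<close> that vanishes in \<open>K/Ra\<close>\<close>
      have dR: "1 - d \<in> carrier R" "(1 - d) $$ 0 \<noteq> 0" "1 - d \<noteq> 0"
        using ud(3) diff_closed by (auto simp: nonunits_def)
      have "(1 - d) * a = u" using ud(1) by (simp add: algebra_simps)
      then have "a = inverse (1 - d) * u" using dR(3) by (simp add: field_simps)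
      then have "a \<in> lincomb BC"
        using series_moduleD(3)[OF series_module_lincomb inverse_closed[OF dR(1,2)] ud(2)] by simp
      then obtain F' c' where a': "a = (\<Sum>b\<in>F'. c' b * b)" "finite F'" "F' \<subseteq> BC"
        "\<And>b. b \<in> F' \<Longrightarrow> c' b \<in> carrier R" by - (erule lincombE, blast)
      have "a \<in> ?Ra" by (auto intro!: exI[of _ 1])
      then have "(\<Sum>b\<in>F'. c' b * b) \<in> ?Ra" unfolding a'(1) .
      then have "c' b \<in> I" if "b \<in> F'" for b
        using basis_moduloD(3)[OF BC a'(2,3), of c' b] a'(4) that by blast
      then have "a \<in> IK" unfolding a'(1)
        using a'(3) basis_moduloD(1)[OF BC] by (intro series_module_sum[OF IK(1)] IK_prod) auto
      then show ?thesis using a_notin by blast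
    qed
  qed
  have cK: "\<exists>x'\<in>?c. x * y = x' * a" if x: "x \<in> ?c" and y: "y \<in> K" for x y
  proof -
    have "(x * a) * y \<in> IK" using c_I[OF x] y by (rule IK_prod)
    then have "(x * y) * a \<in> IK" by (simp add: ac_simps)
    moreover have "x * y \<in> carrier R" using x y by (simp add: conductor_ideal_def)
    ultimately have "x * y \<in> I" using J by blast
    then have "x * y / a \<in> ?c" by (rule I_c)
    then show ?thesis using a0 by (intro bexI[of _ "x * y / a"]) auto
  qed
  have high_c: "x \<in> ?c" if high: "\<And>m. m < F \<Longrightarrow> x $$ m = 0" for x
  proof -
    have "x * y \<in> carrier R" if y: "y \<in> K" for y
      using high K_nth_neg[OF y] by (intro high_mem_carrier fls_mult_nth_below[of F x 0 y]) auto
    then show ?thesis using high_mem_carrier[of x] high by (simp add: conductor_ideal_def)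
  qed
  have sub_nonneg: "0 \<le> fls_subdegree x" if "x \<in> K" "x \<noteq> 0" for x
    using that K_nth_neg by (intro fls_subdegree_geI) auto
  have c_K: "?c \<subseteq> K" using c_sub K one series_moduleD(3)[OF K _ one] by auto
  \<comment> \<open>An element of least order in \<open>R : K\<close> is a multiple of \<open>a\<close> by another element of \<open>R : K\<close>.\<close>
  have sub_a: "fls_subdegree a = 0"
  proof -
    let ?P = "\<lambda>k. \<exists>x\<in>?c. x \<noteq> 0 \<and> nat (fls_subdegree x) = k"
    have "tpow F \<in> ?c" by (rule high_c) simp
    then have "?P (nat (fls_subdegree (tpow F :: 'a fls)))" using tpow_nonzero by blast
    then have "?P (LEAST k. ?P k)" by (rule LeastI)
    then obtain x where x: "x \<in> ?c" "x \<noteq> 0" "nat (fls_subdegree x) = (LEAST k. ?P k)" by blast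
    obtain x' where x': "x' \<in> ?c" "x * 1 = x' * a" using cK[OF x(1) one] by blast
    have "x' \<noteq> 0" using x(2) x'(2) by auto
    then have "?P (nat (fls_subdegree x'))" using x'(1) by blast
    then have "nat (fls_subdegree x) \<le> nat (fls_subdegree x')" unfolding x(3) by (rule Least_le)
    moreover have "fls_subdegree x = fls_subdegree x' + fls_subdegree a"
      using x'(2) \<open>x' \<noteq> 0\<close> a0 by simp
    moreover have "0 \<le> fls_subdegree a" "0 \<le> fls_subdegree x'"
      using sub_nonneg aK a0 x'(1) c_K \<open>x' \<noteq> 0\<close> by blast+
    ultimately show ?thesis by simp
  qed
  \<comment> \<open>\<open>W = a (R : K)\<close> contains \<open>R : K\<close>, and it has the same leading exponents because \<open>a\<close> has order 0\<close>
  define W where "W = {x * a |x. x \<in> ?c}"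
  have "?c = W"
  proof (rule eq_if_leads_subset[of "{0..<F}"])
    show "kspace ?c" by (rule kspace_if_series_module[OF series_module_conductor_ideal])
    have "series_module W"
      unfolding W_def by (rule series_module_scale[OF series_module_conductor_ideal])
    then show "kspace W" by (rule kspace_if_series_module)
    show "?c \<subseteq> W" using cK[OF _ one] unfolding W_def by auto
    have WK: "W \<subseteq> K" unfolding W_def using c_sub aK K series_moduleD(3) by blast
    show "x \<in> ?c" if x: "x \<in> W" "\<forall>q\<in>{0..<F}. x $$ q = 0" for x
    proof (rule high_c)
      show "x $$ m = 0" if m: "m < F" for m
        using m x WK K_nth_neg[of x m] by (cases "m < 0") auto
    qed
    show "leads {0..<F} W \<subseteq> leads {0..<F} ?c"
    proof
      fix p assume "p \<in> leads {0..<F} W"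
      then obtain z where p: "p \<in> {0..<F}" and z: "z \<in> W" "z $$ p \<noteq> 0" "\<forall>q\<in>{0..<F}. q < p \<longrightarrow> z $$ q = 0"
        unfolding leads_def by blast
      obtain x where x: "x \<in> ?c" "z = x * a" using z(1) unfolding W_def by blast
      have "fls_subdegree z = p"
      proof (rule fls_subdegree_eqI[OF z(2)])
        fix k assume "k < p"
        then show "z $$ k = 0" using z WK K_nth_neg[of z k] p by (cases "k < 0") auto
      qed
      moreover have x0: "x \<noteq> 0" using z(2) x(2) by auto
      ultimately have "fls_subdegree x = p" using x(2) a0 sub_a by simp
      then have "x $$ p \<noteq> 0" "\<forall>q\<in>{0..<F}. q < p \<longrightarrow> x $$ q = 0" using x0 by auto
      with x(1) p show "p \<in> leads {0..<F} ?c" unfolding leads_def by blast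
    qed
  qed simp
  then have c_a: "x * a \<in> ?c" "\<exists>x'\<in>?c. x = x' * a" if "x \<in> ?c" for x
    using that unfolding W_def by blast+
  have stable: "x * y \<in> ?c" if "x \<in> ?c" "y \<in> K" for x y
    using cK[OF that] c_a(1) by auto
  then show "\<forall>x\<in>?c. \<forall>y\<in>K. x * y \<in> ?c" by blast
  have "I = ?c"
  proof
    show "I \<subseteq> ?c"
    proof
      fix x assume "x \<in> I"
      then have "x / a * a \<in> ?c" using I_c c_a(1) by blast
      then show "x \<in> ?c" using a0 by simp
    qed
    show "?c \<subseteq> I" using c_a(2) c_I by blast
  qed
  moreover have "IK = ?c"
  proof
    show "IK \<subseteq> ?c"
      using stable \<open>I = ?c\<close> c_K series_module_conductor_ideal by (intro IK_least) auto
    show "?c \<subseteq> IK" using IK_prod[OF _ one] \<open>I = ?c\<close> by auto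
  qed
  ultimately show "\<exists>B. basis_modulo ?c K ?c B" using BK by auto
qed

end

section \<open>Finitely generated semigroups and Apery sets\<close>

lemma semigroup_genI: "x = (\<Sum>a\<in>A. int (c a) * a) \<Longrightarrow> x \<in> semigroup_gen A"
  unfolding semigroup_gen_def by blast

lemma semigroup_gen_zero: "0 \<in> semigroup_gen A"
  unfolding semigroup_gen_def by (auto intro!: exI[of _ "\<lambda>_. 0"])

lemma semigroup_gen_add:
  assumes "x \<in> semigroup_gen A" "y \<in> semigroup_gen A" shows "x + y \<in> semigroup_gen A"
proof -
  from assms obtain c d where "x = (\<Sum>a\<in>A. int (c a) * a)" "y = (\<Sum>a\<in>A. int (d a) * a)"
    unfolding semigroup_gen_def by blast
  then have "x + y = (\<Sum>a\<in>A. int (c a + d a) * a)"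
    by (simp add: algebra_simps sum.distrib)
  then show ?thesis by (rule semigroup_genI)
qed

lemma semigroup_gen_generator:
  assumes "finite A" "a \<in> A" shows "a \<in> semigroup_gen A"
proof -
  have "(\<Sum>b\<in>A. int (if b = a then 1 else 0) * b) = (\<Sum>b\<in>A. if b = a then b else 0)"
    by (rule sum.cong) auto
  also have "\<dots> = a" using assms by simp
  finally show ?thesis by (rule semigroup_genI[OF sym])
qed

lemma semigroup_gen_induct [consumes 2, case_names zero add]:
  assumes "finite A" "x \<in> semigroup_gen A" and "P 0" and add: "\<And>a x. a \<in> A \<Longrightarrow> P x \<Longrightarrow> P (x + a)"
  shows "P x"
proof -
  obtain c where x: "x = (\<Sum>a\<in>A. int (c a) * a)" using assms(2) unfolding semigroup_gen_def by blast
  have mult: "P (y + int k * a)" if "a \<in> A" "P y" for a y k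
  proof (induction k)
    case (Suc k)
    then show ?case using add[OF that(1) Suc] by (simp add: algebra_simps)
  qed (use that in simp)
  have "P (\<Sum>a\<in>B. int (c a) * a)" if "B \<subseteq> A" for B
    using finite_subset[OF that assms(1)] that
  proof (induction B rule: finite_induct)
    case (insert b B)
    then show ?case using mult[of b "\<Sum>a\<in>B. int (c a) * a" "c b"] by (simp add: add.commute)
  qed (simp add: \<open>P 0\<close>)
  then show ?thesis unfolding x by simp
qed

lemma semigroup_gen_least:
  assumes "finite A" "0 \<in> S" "A \<subseteq> S" "\<And>x y. x \<in> S \<Longrightarrow> y \<in> S \<Longrightarrow> x + y \<in> S"
  shows "semigroup_gen A \<subseteq> S"
proof
  fix x assume "x \<in> semigroup_gen A"
  with assms(1) show "x \<in> S" by (induction rule: semigroup_gen_induct) (use assms in auto)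
qed

lemma semigroup_gen_multiple:
  assumes "finite A" "a \<in> A" "x \<in> semigroup_gen A" shows "x + int k * a \<in> semigroup_gen A"
proof (induction k)
  case (Suc k)
  then show ?case using semigroup_gen_add[OF Suc semigroup_gen_generator[OF assms(1,2)]]
    by (simp add: algebra_simps)
qed (use assms in simp)

lemma semigroup_gen_if_congruent:
  assumes A: "finite A" "e \<in> A" "0 < e" and w: "w \<in> semigroup_gen A" "w \<le> x" "e dvd x - w"
  shows "x \<in> semigroup_gen A"
proof -
  have "w + int (nat ((x - w) div e)) * e \<in> semigroup_gen A" using A w semigroup_gen_multiple by blast
  moreover have "0 \<le> (x - w) div e" using w A by (simp add: pos_imp_zdiv_nonneg_iff)
  ultimately show ?thesis using w by simp
qed

lemma semigroup_gen_mono: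
  assumes "finite B" "A \<subseteq> B" shows "semigroup_gen A \<subseteq> semigroup_gen B"
  using assms semigroup_gen_generator[OF assms(1)]
  by (intro semigroup_gen_least) (auto simp: semigroup_gen_zero semigroup_gen_add finite_subset)

lemma semigroup_gen_nonneg:
  assumes "finite A" "\<forall>a\<in>A. 0 < a" "x \<in> semigroup_gen A" shows "0 \<le> x"
  using assms(1,3)
proof (induction rule: semigroup_gen_induct)
  case (add a x)
  then have "0 < a" using assms(2) by blast
  with add show ?case by simp
qed simp

lemma semigroup_gen_remove_greater:
  assumes "finite A" "\<forall>a\<in>A. 0 < a" "x \<in> semigroup_gen A" "x < w"
  shows "x \<in> semigroup_gen (A - {w})"
proof -
  have "0 \<le> x \<and> (x < w \<longrightarrow> x \<in> semigroup_gen (A - {w}))"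
    using assms(1,3)
  proof (induction rule: semigroup_gen_induct)
    case (add a x)
    have "0 < a" using add.hyps assms(2) by blast
    moreover have "x + a \<in> semigroup_gen (A - {w})" if "x + a < w"
    proof -
      have "a \<in> A - {w}" "x < w" using that add \<open>0 < a\<close> by auto
      then show ?thesis
        using semigroup_gen_add[OF _ semigroup_gen_generator[of "A - {w}" a]] add assms(1) by simp
    qed
    ultimately show ?case using add by simp
  qed (simp add: semigroup_gen_zero)
  with assms(4) show ?thesis by blast
qed

text \<open>
  \<open>W\<close> is the Apery set of \<open>H\<close> without 0: it has one element in each nonzero class modulo \<open>e\<close>, and a
  number belongs to \<open>H\<close> iff it is at least the representative of its class. The last assumption says
  that \<open>H\<close> is closed under addition.
\<close>

locale apery_system =
  fixes e :: int and W H :: "int set"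
  assumes e_pos: "0 < e"
    and W_pos: "w \<in> W \<Longrightarrow> 0 < w" and W_ndvd: "w \<in> W \<Longrightarrow> \<not> e dvd w"
    and class_ex: "\<not> e dvd x \<Longrightarrow> \<exists>w\<in>W. e dvd x - w"
    and class_unique: "u \<in> W \<Longrightarrow> v \<in> W \<Longrightarrow> e dvd u - v \<Longrightarrow> u = v"
    and mem_iff: "x \<in> H \<longleftrightarrow> 0 \<le> x \<and> e dvd x \<or> (\<exists>w\<in>W. w \<le> x \<and> e dvd x - w)"
    and sum_mem: "u \<in> W \<Longrightarrow> v \<in> W \<Longrightarrow> u + v \<in> H"
begin

lemma mem_iff_multiple: "e dvd x \<Longrightarrow> x \<in> H \<longleftrightarrow> 0 \<le> x"
  using W_ndvd unfolding mem_iff by (metis dvd_add_right_iff diff_add_cancel)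

lemma mem_iff_class: "w \<in> W \<Longrightarrow> e dvd x - w \<Longrightarrow> x \<in> H \<longleftrightarrow> w \<le> x"
proof
  assume w: "w \<in> W" "e dvd x - w"
  { assume "x \<in> H"
    then consider "e dvd x" | u where "u \<in> W" "u \<le> x" "e dvd x - u" unfolding mem_iff by blast
    then show "w \<le> x"
    proof cases
      case 1
      then have "e dvd w" using w dvd_diff[of e x "x - w"] by simp
      with w W_ndvd show ?thesis by blast
    next
      case 2
      have "e dvd (x - w) - (x - u)" using w(2) 2(3) by (rule dvd_diff)
      then have "u = w" using class_unique[of u w] 2 w by simp
      with 2 show ?thesis by simp
    qed }
  show "w \<le> x \<Longrightarrow> x \<in> H" using w mem_iff by blast
qed

lemma W_subset: "W \<subseteq> H"
  by (rule subsetI, subst mem_iff) auto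

lemma zero_mem: "0 \<in> H" and e_mem: "e \<in> H"
  using e_pos by (simp_all add: mem_iff)

lemma nonneg: "x \<in> H \<Longrightarrow> 0 \<le> x"
  using W_pos unfolding mem_iff by force

lemma add_multiple:
  assumes "x \<in> H" "e dvd y" "0 \<le> y" shows "x + y \<in> H"
proof -
  consider "0 \<le> x" "e dvd x" | w where "w \<in> W" "w \<le> x" "e dvd x - w"
    using assms(1) unfolding mem_iff by blast
  then show ?thesis
  proof cases
    case 1 then show ?thesis using assms unfolding mem_iff by simp
  next
    case 2
    have "e dvd (x - w) + y" using 2(3) assms(2) by (rule dvd_add)
    then have "e dvd x + y - w" by (simp add: algebra_simps)
    then show ?thesis using 2 assms unfolding mem_iff by (intro disjI2 bexI[of _ w]) auto
  qed
qed

lemma add_mem: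
  assumes "x \<in> H" "y \<in> H" shows "x + y \<in> H"
proof -
  consider "e dvd y" | "e dvd x" | u v where "u \<in> W" "u \<le> x" "e dvd x - u" "v \<in> W" "v \<le> y" "e dvd y - v"
    using assms unfolding mem_iff by blast
  then show ?thesis
  proof cases
    case 1 then show ?thesis using add_multiple[OF assms(1)] nonneg[OF assms(2)] by blast
  next
    case 2 then show ?thesis using add_multiple[OF assms(2)] nonneg[OF assms(1)] by (simp add: add.commute)
  next
    case 3
    then have "(u + v) + ((x - u) + (y - v)) \<in> H" by (intro add_multiple sum_mem dvd_add) auto
    then show ?thesis by simp
  qed
qed

lemma finite_W: "finite W"
proof (rule finite_imageD)
  show "finite ((\<lambda>w. w mod e) ` W)"
    by (rule finite_subset[of _ "{0..<e}"]) (use e_pos in auto)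
  show "inj_on (\<lambda>w. w mod e) W"
    by (rule inj_onI) (auto intro!: class_unique simp: mod_eq_dvd_iff)
qed

lemma apery_eq: "apery e H = insert 0 W"
proof
  have "x \<in> W" if x: "x \<in> H" "x - e \<notin> H" "x \<noteq> 0" for x
  proof -
    have "\<not> e dvd x"
    proof
      assume d: "e dvd x"
      then have "0 \<le> x" "\<not> 0 \<le> x - e" using x mem_iff_multiple[of x] mem_iff_multiple[of "x - e"] by auto
      then show False using d \<open>x \<noteq> 0\<close> zdvd_not_zless[of x e] by simp
    qed
    then obtain w where w: "w \<in> W" "e dvd x - w" using class_ex by blast
    have "e dvd x - e - w" using dvd_diff[OF w(2) dvd_refl] by (simp add: algebra_simps)
    then have "w \<le> x" "\<not> w \<le> x - e" using x w mem_iff_class[of w x] mem_iff_class[of w "x - e"] by auto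
    then have "x - w = 0" using w(2) zdvd_not_zless[of "x - w" e] by linarith
    then show ?thesis using w by simp
  qed
  then show "apery e H \<subseteq> insert 0 W" unfolding apery_def by blast
  have "w - e \<notin> H" if "w \<in> W" for w
    using mem_iff_class[OF that, of "w - e"] e_pos by simp
  then show "insert 0 W \<subseteq> apery e H"
    using W_subset zero_mem nonneg[of "- e"] e_pos unfolding apery_def by auto
qed

lemma semigroup_gen_eq: "semigroup_gen (insert e W) = H"
proof
  show "semigroup_gen (insert e W) \<subseteq> H"
    using finite_W e_mem W_subset zero_mem add_mem by (intro semigroup_gen_least) auto
  show "H \<subseteq> semigroup_gen (insert e W)"
  proof
    fix x assume "x \<in> H"
    then obtain w where w: "w = 0 \<or> w \<in> W" "w \<le> x" "e dvd x - w"
      unfolding mem_iff by (metis diff_zero)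
    have "w \<in> semigroup_gen (insert e W)"
      using w(1) finite_W by (auto intro: semigroup_gen_zero semigroup_gen_generator)
    then show "x \<in> semigroup_gen (insert e W)"
      using semigroup_gen_if_congruent[of "insert e W" e w x] finite_W e_pos w by simp
  qed
qed

lemma mem_if_large:
  assumes "W \<noteq> {}" "Max W - e < x" shows "x \<in> H"
proof (cases "e dvd x")
  case True
  have "0 < Max W" using assms(1) finite_W W_pos by simp
  then have "- e < x" using assms by simp
  then have "0 \<le> x" using True zdvd_not_zless[of "- x" e] by force
  with True mem_iff show ?thesis by blast
next
  case False
  then obtain w where w: "w \<in> W" "e dvd x - w" using class_ex by blast
  then have "w \<le> Max W" using finite_W by simp
  then have "w - x < e" using assms by linarith
  moreover have "e dvd w - x" using w(2) by (simp add: dvd_diff_commute)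
  ultimately have "w \<le> x" using zdvd_not_zless[of "w - x" e] by linarith
  with w mem_iff show ?thesis by blast
qed

lemma frobenius_eq: "W \<noteq> {} \<Longrightarrow> frobenius H = Max W - e"
  unfolding frobenius_def
proof (rule Greatest_equality)
  assume W: "W \<noteq> {}"
  then have "Max W \<in> W" using finite_W by simp
  then show "Max W - e \<notin> H" using mem_iff_class[of "Max W" "Max W - e"] e_pos by simp
  show "y \<le> Max W - e" if "y \<notin> H" for y using that mem_if_large[OF W, of y] by linarith
qed

text \<open>
  If \<open>w\<close> represents the class of \<open>m\<close>, its partner \<open>v\<close> represents the class of \<open>f - m\<close>, where
  \<open>f = Max W - e\<close>, and \<open>f - m \<ge> v\<close> says \<open>m \<le> w - e\<close>. The classes of 0 and \<open>Max W\<close> are exchanged.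
\<close>

lemma symmetric_if_paired:
  assumes W: "W \<noteq> {}" and pair: "\<And>w. w \<in> W \<Longrightarrow> w \<noteq> Max W \<Longrightarrow> \<exists>v\<in>W. w + v = Max W"
  shows "symmetric_semigroup H"
  unfolding symmetric_semigroup_def frobenius_eq[OF W]
proof
  fix m
  have M: "Max W \<in> W" using W finite_W by simp
  have below: "x < y \<longleftrightarrow> x \<le> y - e" if "e dvd y - x" for x y
    using zdvd_imp_le[OF that] e_pos by linarith
  consider "e dvd m" | "e dvd m - Max W" | w v where "w \<in> W" "v \<in> W" "w + v = Max W" "e dvd m - w"
    using class_ex pair by metis
  then show "m \<in> H \<longleftrightarrow> Max W - e - m \<notin> H"
  proof cases
    case 1
    then have "e dvd (Max W - e - m) - Max W" by simp
    then have "Max W - e - m \<in> H \<longleftrightarrow> Max W \<le> Max W - e - m" by (rule mem_iff_class[OF M])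
    moreover have "m < 0 \<longleftrightarrow> m \<le> 0 - e" using below[of 0 m] 1 by simp
    ultimately show ?thesis using mem_iff_multiple[OF 1] by auto
  next
    case 2
    then have "e dvd Max W - m" by (simp add: dvd_diff_commute)
    then show ?thesis
      using mem_iff_class[OF M 2] mem_iff_multiple[of "Max W - e - m"] below[of "Max W" m]
      by (auto simp: diff_diff_eq algebra_simps dvd_diff)
  next
    case 3
    then have d: "e dvd w - m" by (simp add: dvd_diff_commute)
    have eq: "(Max W - e - m) - v = (w - m) - e" using 3(3) by simp
    have "e dvd (Max W - e - m) - v" unfolding eq by (rule dvd_diff[OF d dvd_refl])
    then show ?thesis
      using mem_iff_class[OF 3(1,4)] mem_iff_class[OF 3(2)] below[OF d] 3(3) by auto
  qed
qed

end

text \<open>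
  A generator that is congruent modulo \<open>e\<close> to a smaller element made of the other generators is
  redundant. So minimality forces the \<open>e - 1\<close> generators into distinct nonzero classes, which they fill,
  and makes each the least element of its class. A sum of two of them is not a generator either, so
  it exceeds the representative of its class by at least \<open>e\<close>.
\<close>

lemma minimal_generators_apery_system:
  fixes e :: nat and W :: "int set"
  assumes e: "0 < e" and W: "finite W" "card W = e - 1" "\<And>w. w \<in> W \<Longrightarrow> 0 < w" "int e \<notin> W"
    and min: "\<And>w. w \<in> W \<Longrightarrow> w \<notin> semigroup_gen (insert (int e) W - {w})"
  shows "apery_system (int e) W (semigroup_gen (insert (int e) W))"
    and "\<And>u v. u \<in> W \<Longrightarrow> v \<in> W \<Longrightarrow> u + v - int e \<in> semigroup_gen (insert (int e) W)"
proof -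
  let ?A = "insert (int e) W"
  have A: "finite ?A" "\<forall>a\<in>?A. 0 < a" using W e by auto
  have shift: "w \<notin> semigroup_gen (?A - {w})" "x \<in> semigroup_gen (?A - {w}) \<Longrightarrow> x \<le> w \<Longrightarrow> \<not> int e dvd w - x"
    if w: "w \<in> W" for w x
  proof -
    show m: "w \<notin> semigroup_gen (?A - {w})" using min w by blast
    assume x: "x \<in> semigroup_gen (?A - {w})" "x \<le> w"
    show "\<not> int e dvd w - x"
    proof
      assume "int e dvd w - x"
      then have "w \<in> semigroup_gen (?A - {w})"
        using semigroup_gen_if_congruent[of "?A - {w}" "int e" x w] w W e x by auto
      then show False using m by simp
    qed
  qed
  have ndvd: "\<not> int e dvd w" if "w \<in> W" for w
    using shift(2)[OF that semigroup_gen_zero] W(3)[OF that] by simp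
  have less: "\<not> int e dvd v - u" if "u \<in> W" "v \<in> W" "u < v" for u v
    using that W(1) by (intro shift(2) semigroup_gen_generator) auto
  have uniq: "u = v" if "u \<in> W" "v \<in> W" "int e dvd u - v" for u v
    using that less[of u v] less[of v u] dvd_diff_commute[of "int e" u v] by (cases u v rule: linorder_cases) auto
  have "inj_on (\<lambda>w. w mod int e) W" by (rule inj_onI) (auto intro!: uniq simp: mod_eq_dvd_iff)
  then have "card ((\<lambda>w. w mod int e) ` W) = e - 1" using W by (simp add: card_image)
  moreover have "(\<lambda>w. w mod int e) ` W \<subseteq> {1..int e - 1}"
  proof
    fix r assume "r \<in> (\<lambda>w. w mod int e) ` W"
    then obtain w where w: "w \<in> W" "r = w mod int e" by blast
    have "0 \<le> r" "r < int e" "r \<noteq> 0" using e w ndvd by (auto simp: dvd_eq_mod_eq_0)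
    then show "r \<in> {1..int e - 1}" by simp
  qed
  moreover have "card {1..int e - 1} = e - 1" by simp
  ultimately have onto: "(\<lambda>w. w mod int e) ` W = {1..int e - 1}"
    by (intro card_subset_eq) auto
  have ex: "\<exists>w\<in>W. int e dvd x - w" if "\<not> int e dvd x" for x
  proof -
    have "0 \<le> x mod int e" "x mod int e < int e" "x mod int e \<noteq> 0"
      using e that by (auto simp: dvd_eq_mod_eq_0)
    then have "x mod int e \<in> {1..int e - 1}" by simp
    then obtain w where "w \<in> W" "x mod int e = w mod int e" using onto by blast
    then show ?thesis by (auto simp: mod_eq_dvd_iff)
  qed
  have mem: "x \<in> semigroup_gen ?A \<longleftrightarrow> 0 \<le> x \<and> int e dvd x \<or> (\<exists>w\<in>W. w \<le> x \<and> int e dvd x - w)" for x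
  proof
    assume x: "x \<in> semigroup_gen ?A"
    have "w \<le> x" if "w \<in> W" "int e dvd x - w" for w
    proof (rule ccontr)
      assume "\<not> w \<le> x"
      then have "x \<in> semigroup_gen (?A - {w})" using semigroup_gen_remove_greater[OF A x] by simp
      moreover have "int e dvd w - x" using that(2) dvd_diff_commute[of "int e" w x] by simp
      ultimately show False using shift(2)[OF that(1), of x] \<open>\<not> w \<le> x\<close> by simp
    qed
    then show "0 \<le> x \<and> int e dvd x \<or> (\<exists>w\<in>W. w \<le> x \<and> int e dvd x - w)"
      using ex semigroup_gen_nonneg[OF A x] by blast
  next
    assume "0 \<le> x \<and> int e dvd x \<or> (\<exists>w\<in>W. w \<le> x \<and> int e dvd x - w)"
    then obtain w where w: "w = 0 \<or> w \<in> W" "w \<le> x" "int e dvd x - w"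
      by (metis diff_zero)
    have "w \<in> semigroup_gen ?A" using w(1) A(1) by (auto intro: semigroup_gen_zero semigroup_gen_generator)
    then show "x \<in> semigroup_gen ?A"
      using semigroup_gen_if_congruent[of ?A "int e" w x] A(1) e w by simp
  qed
  have sum: "u + v \<in> semigroup_gen ?A" if "u \<in> W" "v \<in> W" for u v
    using that A(1) by (intro semigroup_gen_add semigroup_gen_generator) auto
  show "apery_system (int e) W (semigroup_gen ?A)"
    by unfold_locales (use e W(3) ndvd ex uniq mem sum in auto)
  fix u v assume uv: "u \<in> W" "v \<in> W"
  have pos: "0 < u" "0 < v" using W uv by auto
  have notW: "u + v \<notin> W"
  proof
    assume "u + v \<in> W"
    moreover have "u + v \<in> semigroup_gen (?A - {u + v})"
      using uv pos W(1) by (intro semigroup_gen_add semigroup_gen_generator) auto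
    ultimately show False using min by blast
  qed
  have step: "0 < y \<Longrightarrow> int e dvd y \<Longrightarrow> int e \<le> y" for y using zdvd_imp_le by blast
  show "u + v - int e \<in> semigroup_gen ?A"
  proof (cases "int e dvd u + v")
    case True
    then show ?thesis using step[OF _ True] pos unfolding mem by simp
  next
    case False
    then obtain w where w: "w \<in> W" "w \<le> u + v" "int e dvd u + v - w"
      using sum[OF uv] unfolding mem by blast
    then have "w < u + v" using notW by (metis order_le_imp_less_or_eq)
    then have "int e \<le> u + v - w" using step w by simp
    moreover have "int e dvd u + v - int e - w" using dvd_diff[OF w(3) dvd_refl] by (simp add: algebra_simps)
    ultimately show ?thesis using w unfolding mem by (intro disjI2 bexI[of _ w]) auto
  qed
qed

context apery_system
begin

text \<open>
  \<open>Max W - w \<in> H\<close> would give \<open>v \<in> W\<close> with \<open>w + v \<le> Max W\<close> in the class of \<open>Max W\<close>, whereas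
  \<open>w + v - e \<in> H\<close> gives \<open>Max W + e \<le> w + v\<close>.
\<close>

lemma max_element_gap:
  assumes max_emb: "\<And>u v. u \<in> W \<Longrightarrow> v \<in> W \<Longrightarrow> u + v - e \<in> H" and w: "w \<in> W" "w \<noteq> Max W"
  shows "Max W - w \<notin> H"
proof
  have M: "Max W \<in> W" using finite_W w by (intro Max_in) auto
  assume "Max W - w \<in> H"
  moreover have "\<not> e dvd Max W - w" using class_unique M w by blast
  ultimately obtain v where v: "v \<in> W" "v \<le> Max W - w" "e dvd Max W - w - v" unfolding mem_iff by blast
  have "e dvd (w + v - e) - Max W"
    using v(3) dvd_minus_iff[of e "Max W - w - v"] dvd_diff[of e "- (Max W - w - v)" e] by (simp add: algebra_simps)
  then have "Max W \<le> w + v - e" using mem_iff_class[OF M] max_emb[OF w(1) v(1)] by blast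
  then show False using v e_pos by simp
qed

lemma exists_nonmax:
  assumes "2 \<le> card W" obtains w where "w \<in> W" "w \<noteq> Max W"
proof -
  have "\<not> W \<subseteq> {Max W}" using assms card_mono[of "{Max W}" W] by auto
  then show thesis using that by blast
qed

text \<open>
  For \<open>w \<noteq> Max W\<close> the translate of \<open>w\<close> by \<open>Max W - w\<close> is \<open>Max W\<close>; the translates of \<open>w = Max W\<close> lie
  beyond the Frobenius number.
\<close>

lemma generators_in_translate_set:
  assumes max_emb: "\<And>u v. u \<in> W \<Longrightarrow> v \<in> W \<Longrightarrow> u + v - e \<in> H"
    and card: "2 \<le> card W"
    and all_or_none: "\<And>s w. s \<in> H \<Longrightarrow> w \<in> W \<Longrightarrow> w \<noteq> Max W \<Longrightarrow> s + (Max W - w) \<in> H \<Longrightarrow> s \<in> T"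
  shows "W \<subseteq> T"
proof
  fix w assume w: "w \<in> W"
  obtain w0 where w0: "w0 \<in> W" "w0 \<noteq> Max W" using card by (rule exists_nonmax)
  have M: "Max W \<in> W" "w0 \<le> Max W" using finite_W w w0 by (auto intro: Max_in)
  show "w \<in> T"
  proof (cases "w = Max W")
    case True
    have "Max W \<in> H" using M W_subset by blast
    moreover have "Max W + (Max W - w0) \<in> H"
      by (rule mem_if_large) (use w M e_pos in auto)
    ultimately show ?thesis using all_or_none[OF _ w0] True by blast
  next
    case False
    have "w \<in> H" "w + (Max W - w) \<in> H" using w M W_subset by auto
    then show ?thesis using all_or_none[OF _ w False] by blast
  qed
qed

end

text \<open>
  \<open>T\<close> is the set of exponents of \<open>R : K\<close>, and the two hypotheses on \<open>T\<close> are what freeness of \<open>K/\<cc>\<close> over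
  \<open>R/\<cc>\<close> says about monomials. For \<open>w \<noteq> M\<close> the number \<open>p e + M - w\<close> lies in \<open>H\<close> precisely for \<open>p \<ge> n\<close>,
  so \<open>n e + M - w\<close> is the least element of \<open>H\<close> in its class, an element \<open>v\<close> of \<open>W\<close>. The equation
  \<open>w + v = M + n e\<close> is the pairing that makes the shifted set \<open>W'\<close> symmetric, and it also forces
  \<open>w > n e\<close>. That sums of elements of \<open>W'\<close> reach the representative of their class
  comes from the stability of \<open>T\<close>: if \<open>a, b \<in> W\<close> with \<open>b \<noteq> M\<close> and \<open>c\<close> is the partner of \<open>b\<close>, the number
  \<open>a + b - n e\<close> is the translate \<open>a + (M - c)\<close> of \<open>a \<in> T\<close>.
\<close>

lemma (in apery_system) shifted_apery_system:
  fixes n :: nat and T :: "int set"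
  defines "M \<equiv> Max W"
  assumes max_emb: "\<And>u v. u \<in> W \<Longrightarrow> v \<in> W \<Longrightarrow> u + v - e \<in> H"
    and card: "2 \<le> card W"
    and T: "T = {s \<in> H. \<forall>w\<in>W. s + (M - w) \<in> H}"
    and all_or_none: "\<And>s w. s \<in> H \<Longrightarrow> w \<in> W \<Longrightarrow> w \<noteq> M \<Longrightarrow> s + (M - w) \<in> H \<Longrightarrow> s \<in> T"
    and stable: "\<And>s w. s \<in> T \<Longrightarrow> w \<in> W \<Longrightarrow> s + (M - w) \<in> T"
    and n: "\<And>p::nat. int p * e \<in> T \<longleftrightarrow> n \<le> p"
  defines "W' \<equiv> (\<lambda>w. w - int n * e) ` W"
  shows "0 < n" and "\<And>w. w \<in> W \<Longrightarrow> int n * e < w"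
    and "apery_system e W' (semigroup_gen (insert e W'))"
    and "symmetric_semigroup (semigroup_gen (insert e W'))"
proof -
  have fin: "finite W" by (rule finite_W)
  have "W \<noteq> {}" using card by auto
  then have M: "M \<in> W" "\<And>w. w \<in> W \<Longrightarrow> w \<le> M" using fin by (auto simp: M_def)
  obtain w0 where w0: "w0 \<in> W" "w0 \<noteq> M" using card unfolding M_def by (rule exists_nonmax)
  have gap: "M - w \<notin> H" if "w \<in> W" "w \<noteq> M" for w
    using max_element_gap[OF max_emb] that by (simp add: M_def)
  have "0 \<notin> T" using gap[OF w0] w0 unfolding T by auto
  then show n_pos: "0 < n" using n[of 0] by (cases n) auto
  have WT: "w \<in> T" if "w \<in> W" for w
    using generators_in_translate_set[OF max_emb card] all_or_none that unfolding M_def by blast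
  have pair: "\<exists>v\<in>W. w + v = M + int n * e" if w: "w \<in> W" "w \<noteq> M" for w
  proof -
    have nd: "\<not> e dvd M - w" using class_unique M(1) w by blast
    have "int n * e \<in> T" using n by blast
    then have up: "int n * e + (M - w) \<in> H" using w(1) unfolding T by blast
    have "int (n - 1) * e \<notin> T" using n[of "n - 1"] n_pos by simp
    moreover have "int (n - 1) * e \<in> H" using mem_iff_multiple[of "int (n - 1) * e"] e_pos by simp
    ultimately have down: "int (n - 1) * e + (M - w) \<notin> H" using all_or_none[OF _ w] by blast
    obtain v where v: "v \<in> W" "e dvd M - w - v" using class_ex[OF nd] by blast
    have d: "e dvd int k * e + (M - w) - v" for k
      using dvd_add[of e "int k * e" "M - w - v"] v(2) by (simp add: algebra_simps)
    have "v \<le> int n * e + (M - w)" using up mem_iff_class[OF v(1) d] by blast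
    moreover have "int (n - 1) * e + (M - w) < v" using down mem_iff_class[OF v(1) d] by force
    moreover have "int n * e = int (n - 1) * e + e" using n_pos by (cases n) (auto simp: algebra_simps)
    ultimately have "int n * e + (M - w) - v = 0" using zdvd_not_zless[of "int n * e + (M - w) - v" e] d[of n]
      by linarith
    with v(1) show ?thesis by (intro bexI[of _ v]) auto
  qed
  have big: "int n * e < w" if w: "w \<in> W" "w \<noteq> M" for w
  proof -
    obtain v where "v \<in> W" "w + v = M + int n * e" using pair[OF w] by blast
    moreover have "v \<noteq> M"
    proof
      assume "v = M"
      with calculation have "w = int n * e" by simp
      then show False using W_ndvd[OF w(1)] by simp
    qed
    ultimately show ?thesis using M(2)[of v] by force
  qed
  then show big: "int n * e < w" if "w \<in> W" for w
    using that w0 M(2)[OF w0(1)] by (cases "w = M") force+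
  define H' where "H' = {x. 0 \<le> x \<and> e dvd x \<or> (\<exists>w\<in>W'. w \<le> x \<and> e dvd x - w)}"
  have W'_mem: "w - int n * e \<in> W' \<longleftrightarrow> w \<in> W" for w by (auto simp: W'_def)
  have shift_dvd: "e dvd x - (w - int n * e) \<longleftrightarrow> e dvd x - w" for x w
    by (metis diff_diff_eq2 add_diff_eq diff_add_eq dvd_add_times_triv_right_iff mult.commute)
  have sum': "(u - int n * e) + (v - int n * e) \<in> H'" if uv: "u \<in> W" "v \<in> W" for u v
  proof (cases "e dvd u + v")
    case True
    have "(u - int n * e) + (v - int n * e) = (u + v) - (2 * int n) * e" by (simp add: algebra_simps)
    then have "e dvd (u - int n * e) + (v - int n * e)" using True by (metis dvd_diff dvd_triv_right)
    moreover have "0 \<le> (u - int n * e) + (v - int n * e)" using big[OF uv(1)] big[OF uv(2)] by linarith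
    ultimately show ?thesis unfolding H'_def by blast
  next
    case False
    then obtain k where k: "k \<in> W" "e dvd u + v - k" using class_ex by blast
    have "k \<le> u + v - int n * e"
    proof (cases "u = M \<and> v = M")
      case True
      then show ?thesis using M(2)[OF k(1)] big[OF M(1)] by simp
    next
      case False
      then obtain a b where ab: "a \<in> W" "b \<in> W" "b \<noteq> M" "a + b = u + v" using uv by (metis add.commute)
      obtain c where c: "c \<in> W" "b + c = M + int n * e" using pair ab by blast
      have "a + (M - c) \<in> H" using stable[OF WT[OF ab(1)] c(1)] unfolding T by blast
      moreover have "a + (M - c) = u + v - int n * e" using ab c by simp
      moreover have "e dvd (u + v - int n * e) - k"
        using k(2) dvd_diff[of e "u + v - k" "int n * e"] by (simp add: algebra_simps)
      ultimately show ?thesis using mem_iff_class[OF k(1), of "u + v - int n * e"] by simp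
    qed
    then have "k - int n * e \<le> (u - int n * e) + (v - int n * e)" by linarith
    moreover have "e dvd (u - int n * e) + (v - int n * e) - (k - int n * e)"
      using k(2) dvd_diff[of e "u + v - k" "int n * e"] by (simp add: algebra_simps)
    moreover have "k - int n * e \<in> W'" using k(1) W'_mem by blast
    ultimately show ?thesis unfolding H'_def by blast
  qed
  have sys: "apery_system e W' H'"
  proof
    show "\<exists>w\<in>W'. e dvd x - w" if x: "\<not> e dvd x" for x
    proof -
      obtain w where "w \<in> W" "e dvd x - w" using class_ex[OF x] by blast
      then show ?thesis using shift_dvd W'_mem by blast
    qed
    show "u = v" if "u \<in> W'" "v \<in> W'" "e dvd u - v" for u v
      using that class_unique by (auto simp: W'_def)
    show "\<not> e dvd w" if w: "w \<in> W'" for w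
    proof -
      obtain v where v: "v \<in> W" "w = v - int n * e" using w by (auto simp: W'_def)
      then have "v = w + int n * e" by simp
      then show ?thesis using W_ndvd[OF v(1)] by auto
    qed
    show "u + v \<in> H'" if "u \<in> W'" "v \<in> W'" for u v
      using that sum' unfolding W'_def by blast
  qed (use e_pos big in \<open>auto simp: H'_def W'_def\<close>)
  then interpret S: apery_system e W' H' .
  have H': "semigroup_gen (insert e W') = H'" by (rule S.semigroup_gen_eq)
  show "apery_system e W' (semigroup_gen (insert e W'))" unfolding H' by (rule sys)
  have Max': "Max W' = M - int n * e"
    by (rule Max_eqI) (use fin M in \<open>auto simp: W'_def\<close>)
  show "symmetric_semigroup (semigroup_gen (insert e W'))" unfolding H'
  proof (rule S.symmetric_if_paired)
    show "W' \<noteq> {}" using \<open>W \<noteq> {}\<close> by (simp add: W'_def)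
    fix w assume "w \<in> W'" "w \<noteq> Max W'"
    then obtain v where v: "v \<in> W" "v \<noteq> M" "w = v - int n * e" unfolding Max' by (auto simp: W'_def)
    then obtain u where "u \<in> W" "v + u = M + int n * e" using pair by blast
    then show "\<exists>v\<in>W'. w + v = Max W'" unfolding Max' using v by (intro bexI[of _ "u - int n * e"]) (auto simp: W'_mem)
  qed
qed

section \<open>Monomial generators\<close>

context semigroup_series
begin

text \<open>
  Each nonzero \<open>s \<in> H\<close> is assigned to one generator \<open>b = f s\<close> with \<open>s - b \<in> H\<close>. Collecting the terms of
  a series by their generators writes it as a combination of the finitely many \<open>t\<^bsup>b\<^esup>\<close>.
\<close>

lemma nonunits_eq_monomial_ideal:
  assumes B: "finite B" "\<forall>b\<in>B. 0 < b" and H: "H = semigroup_gen B"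
  shows "Idl\<^bsub>R\<^esub> (tpow ` B) = nonunits"
proof
  have BH: "B \<subseteq> H" using semigroup_gen_generator[OF B(1)] H by blast
  have "tpow ` B \<subseteq> nonunits" using B(2) BH by (auto simp: nonunits_def)
  then show "Idl\<^bsub>R\<^esub> (tpow ` B) \<subseteq> nonunits"
    unfolding genideal_eq using nonunits_subset series_module_nonunits by blast
  have "\<exists>b\<in>B. s - b \<in> H" if s: "s \<in> H" "s \<noteq> 0" for s
  proof -
    have "s = 0 \<or> (\<exists>b\<in>B. s - b \<in> H) \<and> s \<in> H"
      using B(1) s(1)[unfolded H]
    proof (induction rule: semigroup_gen_induct)
      case (add a x)
      then have "x \<in> H" "a \<in> H" using zero_mem BH by auto
      then have "x + a - a \<in> H" "x + a \<in> H" using add_mem by simp_all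
      then show ?case using add.hyps by blast
    qed simp
    with s(2) show ?thesis by blast
  qed
  then obtain f where f: "\<And>s. s \<in> H \<Longrightarrow> s \<noteq> 0 \<Longrightarrow> f s \<in> B \<and> s - f s \<in> H" by metis
  show "nonunits \<subseteq> Idl\<^bsub>R\<^esub> (tpow ` B)"
  proof
    fix x assume x: "x \<in> nonunits"
    have xH: "m \<in> H" "m \<noteq> 0" if "x $$ m \<noteq> 0" for m
      using x that by (auto simp: nonunits_def carrier_iff)
    define y where "y b = tpow (- b) * restrict_support {s \<in> H - {0}. f s = b} x" for b
    have yR: "y b \<in> carrier R" for b
    proof (subst carrier_iff, intro allI impI)
      fix m assume "y b $$ m \<noteq> 0"
      then have "m + b \<in> H" "m + b \<noteq> 0" "f (m + b) = b" by (auto simp: y_def split: if_splits)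
      then show "m \<in> H" using f[of "m + b"] by simp
    qed
    have "x = (\<Sum>b\<in>B. y b * tpow b)"
    proof (rule fls_eqI)
      fix m
      have "(\<Sum>b\<in>B. y b * tpow b) $$ m = (\<Sum>b\<in>B. if f m = b then (if m \<in> H \<and> m \<noteq> 0 then x $$ m else 0) else 0)"
        unfolding fls_nth_sum by (rule sum.cong) (auto simp: y_def)
      also have "\<dots> = (if f m \<in> B then (if m \<in> H \<and> m \<noteq> 0 then x $$ m else 0) else 0)"
        using B(1) by simp
      also have "\<dots> = x $$ m" using xH[of m] f[of m] by auto
      finally show "x $$ m = (\<Sum>b\<in>B. y b * tpow b) $$ m" by simp
    qed
    moreover have "(\<Sum>b\<in>B. y b * tpow b) \<in> V"
      if "series_module V" "tpow ` B \<subseteq> V" for V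
      using that yR by (intro series_module_sum series_moduleD(3)) auto
    ultimately show "x \<in> Idl\<^bsub>R\<^esub> (tpow ` B)" unfolding genideal_eq by auto
  qed
qed

lemma embedding_dim_le_card:
  assumes B: "finite B" "\<forall>b\<in>B. 0 < b" and H: "H = semigroup_gen B"
  shows "embedding_dim R \<le> card B"
proof -
  let ?S = "tpow ` B :: 'k fls set"
  have "?S \<subseteq> carrier R" using semigroup_gen_generator[OF B(1)] H by auto
  then have "embedding_dim R \<le> card ?S"
    unfolding embedding_dim_def max_ideal_eq
    using B(1) nonunits_eq_monomial_ideal[OF assms] by (intro Least_le exI[of _ ?S]) auto
  also have "\<dots> \<le> card B" using B(1) by (rule card_image_le)
  finally show ?thesis .
qed

end

lemma fls_ring_uminus: "\<ominus>\<^bsub>fls_ring\<^esub> (x :: 'k::field fls) = - x"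
proof -
  have "(THE y. y \<in> carrier (add_monoid fls_ring) \<and> x \<otimes>\<^bsub>add_monoid fls_ring\<^esub> y = \<one>\<^bsub>add_monoid fls_ring\<^esub> \<and>
      y \<otimes>\<^bsub>add_monoid fls_ring\<^esub> x = \<one>\<^bsub>add_monoid fls_ring\<^esub>) = - x"
    by (rule the_equality) (auto simp: fls_ring_def eq_neg_iff_add_eq_0 add.commute)
  then show ?thesis by (simp add: a_inv_def m_inv_def)
qed

text \<open>
  An ideal stable under \<open>K\<close> is stable under \<open>R[K]\<close>.
\<close>

lemma (in numerical_semigroup_series) colon_adjoin_eq_conductor_ideal:
  assumes stable: "\<forall>x\<in>conductor_ideal K. \<forall>y\<in>K. x * y \<in> conductor_ideal K"
  shows "colon R (adjoin R K) = conductor_ideal K"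
proof
  have incl: "carrier R \<union> K \<subseteq> adjoin R K" unfolding adjoin_def by (auto intro: generate_ring.incl)
  show "colon R (adjoin R K) \<subseteq> conductor_ideal K"
  proof
    fix x assume x: "x \<in> colon R (adjoin R K)"
    then have "x * 1 \<in> carrier R" "\<forall>y\<in>K. x * y \<in> carrier R"
      using incl closed(2) unfolding colon_def by blast+
    then show "x \<in> conductor_ideal K" by (simp add: conductor_ideal_def)
  qed
  have prod: "x * y \<in> conductor_ideal K" if "y \<in> adjoin R K" "x \<in> conductor_ideal K" for x y
    using that unfolding adjoin_def
  proof (induction arbitrary: x rule: generate_ring.induct)
    case (incl y)
    then show ?case using stable series_moduleD(3)[OF series_module_conductor_ideal, of y x]
      by (auto simp: mult.commute)
  next
    case (a_inv y)
    then show ?case using series_moduleD(4)[OF series_module_conductor_ideal] by (simp add: fls_ring_uminus)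
  next
    case (eng_add y z)
    then show ?case using series_moduleD(2)[OF series_module_conductor_ideal]
      by (simp add: fls_ring_def distrib_left)
  next
    case (eng_mult y z)
    then have "(x * y) * z \<in> conductor_ideal K" by blast
    then show ?case by (simp add: fls_ring_def mult.assoc)
  qed (simp add: fls_ring_def)
  have sub: "conductor_ideal K \<subseteq> carrier R" by (auto simp: conductor_ideal_def)
  show "conductor_ideal K \<subseteq> colon R (adjoin R K)"
  proof
    fix x assume x: "x \<in> conductor_ideal K"
    then have "x \<in> carrier R" using sub by blast
    then have "x \<in> fraction_field R" unfolding fraction_field_def
      by (intro CollectI exI[of _ x] exI[of _ 1]) auto
    then show "x \<in> colon R (adjoin R K)" using prod x sub unfolding colon_def by blast
  qed
qed

section \<open>The canonical ideal in maximal embedding dimension\<close>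

locale max_embedding_dim = apery_system e W H + semigroup_series H R
  for e :: int and W H :: "int set" and R :: "'k::field fls ring" +
  assumes max_emb: "u \<in> W \<Longrightarrow> v \<in> W \<Longrightarrow> u + v - e \<in> H" and card_W: "2 \<le> card W"
begin

definition M :: int where "M = Max W"

definition K :: "'k fls set" where "K = canonical_ideal (insert e W)"

lemma W_nonempty: "W \<noteq> {}" using card_W by auto

lemma M_mem: "M \<in> W" and le_M: "w \<in> W \<Longrightarrow> w \<le> M"
  using finite_W W_nonempty by (auto simp: M_def)

sublocale numerical_semigroup_series H R "M - e + 1"
  by unfold_locales (use mem_if_large[OF W_nonempty] in \<open>simp add: M_def\<close>)

lemma pseudo_frobenius_add:
  assumes w: "w \<in> W" and j: "j \<in> H" "j \<noteq> 0" shows "w - e + j \<in> H"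
proof -
  consider "0 \<le> j" "e dvd j" | v where "v \<in> W" "v \<le> j" "e dvd j - v" using j(1) unfolding mem_iff by blast
  then show ?thesis
  proof cases
    case 1
    then have "e \<le> j" using zdvd_imp_le[of e j] j(2) by simp
    then have "w + (j - e) \<in> H" using w W_subset 1(2) by (intro add_multiple) auto
    then show ?thesis by (simp add: algebra_simps)
  next
    case 2
    then have "(w + v - e) + (j - v) \<in> H" using max_emb[OF w] by (intro add_multiple) auto
    then show ?thesis by (simp add: algebra_simps)
  qed
qed

lemma pseudo_frobenius_eq: "pseudo_frobenius (insert e W) = (\<lambda>w. w - e) ` W"
proof
  have W_sub: "w - e \<notin> H" if "w \<in> W" for w
    using mem_iff_class[OF that, of "w - e"] e_pos by simp
  show "pseudo_frobenius (insert e W) \<subseteq> (\<lambda>w. w - e) ` W"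
  proof
    fix m assume "m \<in> pseudo_frobenius (insert e W)"
    then have m: "m \<notin> H" "m + e \<in> H" "\<forall>w\<in>W. m + w \<in> H"
      unfolding pseudo_frobenius_def semigroup_gen_eq by auto
    then have "m + e \<in> apery e H" by (simp add: apery_def)
    then have "m + e = 0 \<or> m + e \<in> W" unfolding apery_eq by blast
    moreover have "m + e \<noteq> 0"
    proof
      assume "m + e = 0"
      then have "M - e = m + M" by simp
      also have "\<dots> \<in> H" using m(3) M_mem by blast
      finally have "M - e \<in> H" .
      then show False using W_sub M_mem by blast
    qed
    ultimately show "m \<in> (\<lambda>w. w - e) ` W" by (intro image_eqI[of _ _ "m + e"]) auto
  qed
  show "(\<lambda>w. w - e) ` W \<subseteq> pseudo_frobenius (insert e W)"
  proof
    fix m assume "m \<in> (\<lambda>w. w - e) ` W"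
    then obtain w where w: "w \<in> W" "m = w - e" by blast
    have "m + a \<in> H" if "a \<in> insert e W" for a
      unfolding w(2)
    proof (rule pseudo_frobenius_add[OF w(1)])
      show "a \<in> H" using that e_mem W_subset by blast
      show "a \<noteq> 0" using that e_pos W_pos by force
    qed
    then show "m \<in> pseudo_frobenius (insert e W)"
      unfolding pseudo_frobenius_def semigroup_gen_eq using W_sub w by blast
  qed
qed

lemma K_eq: "K = {\<Sum>w\<in>W. r (w - e) * tpow (M - w) | r. \<forall>c. r c \<in> carrier R}"
proof -
  have inj: "inj_on (\<lambda>w. w - e) W" by (simp add: inj_on_def)
  have sums: "(\<Sum>c\<in>(\<lambda>w. w - e) ` W. r c * fls_X_intpow (M - e - c)) = (\<Sum>w\<in>W. r (w - e) * tpow (M - w))"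
    for r :: "int \<Rightarrow> 'k fls" unfolding sum.reindex[OF inj] by (simp add: tpow_def)
  show ?thesis
    unfolding K_def canonical_ideal_def pseudo_frobenius_eq semigroup_gen_eq frobenius_eq[OF W_nonempty]
      M_def[symmetric] R_def[symmetric] sums ..
qed

lemma series_module_K: "series_module K"
proof -
  let ?K = "{\<Sum>w\<in>W. r (w - e) * tpow (M - w) | r. \<forall>c. r c \<in> carrier R}"
  show ?thesis unfolding K_eq
  proof (rule series_moduleI)
  show "0 \<in> ?K"
    by (intro CollectI exI[of _ "\<lambda>_. 0"]) simp
next
  fix x y assume "x \<in> ?K"
    "y \<in> ?K"
  then obtain r r' where "x = (\<Sum>w\<in>W. r (w - e) * tpow (M - w))" "y = (\<Sum>w\<in>W. r' (w - e) * tpow (M - w))"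
    "\<forall>w. r w \<in> carrier R" "\<forall>w. r' w \<in> carrier R" by blast
  then show "x + y \<in> ?K"
    by (intro CollectI exI[of _ "\<lambda>w. r w + r' w"]) (simp add: add_closed sum.distrib distrib_right)
next
  fix s x assume "s \<in> carrier R" "x \<in> ?K"
  then obtain r where "x = (\<Sum>w\<in>W. r (w - e) * tpow (M - w))" "\<forall>w. r w \<in> carrier R" by blast
  then show "s * x \<in> ?K"
    using \<open>s \<in> carrier R\<close>
    by (intro CollectI exI[of _ "\<lambda>w. s * r w"]) (simp add: mult_closed sum_distrib_left mult.assoc)
  qed
qed

lemma tpow_mem_K: "w \<in> W \<Longrightarrow> tpow (M - w) \<in> K"
proof -
  assume w: "w \<in> W"
  have "(\<Sum>v\<in>W. (if v = w then 1 else 0) * tpow (M - v)) = (\<Sum>v\<in>W. if v = w then tpow (M - v) else 0 :: 'k fls)"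
    by (rule sum.cong) auto
  also have "\<dots> = tpow (M - w)" using w finite_W by simp
  finally have "tpow (M - w) = (\<Sum>v\<in>W. (if v = w then 1 else 0) * tpow (M - v) :: 'k fls)" by simp
  then show ?thesis unfolding K_eq
    by (intro CollectI exI[of _ "\<lambda>c. if c = w - e then 1 else 0"]) auto
qed

lemma one_mem_K: "1 \<in> K"
  using tpow_mem_K[OF M_mem] by simp

text \<open>
  If \<open>m = s + (M - w)\<close> with \<open>s \<in> H\<close> and \<open>M - e - m \<in> H\<close>, the pseudo-Frobenius number \<open>w - e\<close> would
  be a sum of two elements of \<open>H\<close>.
\<close>

lemma K_support:
  assumes x: "x \<in> K" and m: "x $$ m \<noteq> 0" shows "M - e - m \<notin> H"
proof
  assume H: "M - e - m \<in> H"
  obtain r where r: "x = (\<Sum>w\<in>W. r (w - e) * tpow (M - w))" "\<And>c. r c \<in> carrier R" using x unfolding K_eq by blast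
  have "(\<Sum>w\<in>W. r (w - e) $$ (m - (M - w))) \<noteq> 0" using m unfolding r(1) fls_nth_sum by simp
  then obtain w where w: "w \<in> W" "r (w - e) $$ (m - (M - w)) \<noteq> 0" by (meson sum.not_neutral_contains_not_neutral)
  have "m - (M - w) \<in> H" using r(2)[of "w - e"] w(2) by (simp add: carrier_iff)
  then have "(M - e - m) + (m - (M - w)) \<in> H" using H by (intro add_mem)
  then have "w - e \<in> H" by (simp add: algebra_simps)
  then show False using mem_iff_class[OF w(1), of "w - e"] e_pos by simp
qed

lemma K_nth_neg: "x \<in> K \<Longrightarrow> m < 0 \<Longrightarrow> x $$ m = 0"
  using K_support[of x m] conductor[of "M - e - m"] by force

text \<open>
  The exponents of \<open>R : K\<close>.
\<close>

definition T :: "int set" where "T = {s \<in> H. \<forall>w\<in>W. s + (M - w) \<in> H}"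

lemma conductor_ideal_K: "conductor_ideal K = {x. \<forall>m. x $$ m \<noteq> 0 \<longrightarrow> m \<in> T}"
proof
  show "conductor_ideal K \<subseteq> {x. \<forall>m. x $$ m \<noteq> 0 \<longrightarrow> m \<in> T}"
  proof (intro subsetI CollectI allI impI)
    fix x m assume x: "x \<in> conductor_ideal K" "x $$ m \<noteq> 0"
    have "m + (M - w) \<in> H" if "w \<in> W" for w
    proof -
      have "x * tpow (M - w) \<in> carrier R" using x(1) tpow_mem_K[OF that] by (simp add: conductor_ideal_def)
      moreover have "(x * tpow (M - w)) $$ (m + (M - w)) \<noteq> 0" using x(2) by simp
      ultimately show ?thesis unfolding carrier_iff by blast
    qed
    moreover have "m \<in> H" using x by (simp add: conductor_ideal_def carrier_iff)
    ultimately show "m \<in> T" by (simp add: T_def)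
  qed
  show "{x. \<forall>m. x $$ m \<noteq> 0 \<longrightarrow> m \<in> T} \<subseteq> conductor_ideal K"
  proof
    fix x :: "'k fls" assume "x \<in> {x. \<forall>m. x $$ m \<noteq> 0 \<longrightarrow> m \<in> T}"
    then have x: "m \<in> T" if "x $$ m \<noteq> 0" for m using that by blast
    have mono: "x * tpow (M - w) \<in> carrier R" if "w \<in> W" for w
    proof (subst carrier_iff, intro allI impI)
      fix m assume "(x * tpow (M - w)) $$ m \<noteq> 0"
      then have "m - (M - w) \<in> T" using x by simp
      then have "m - (M - w) + (M - w) \<in> H" using that unfolding T_def by blast
      then show "m \<in> H" by simp
    qed
    have "x * y \<in> carrier R" if y: "y \<in> K" for y
    proof -
      obtain r where r: "y = (\<Sum>w\<in>W. r (w - e) * tpow (M - w))" "\<And>c. r c \<in> carrier R"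
        using y unfolding K_eq by blast
      have "x * y = (\<Sum>w\<in>W. r (w - e) * (x * tpow (M - w)))" unfolding r(1) by (simp add: sum_distrib_left ac_simps)
      also have "\<dots> \<in> carrier R"
        by (intro series_module_sum[OF series_module_carrier] mult_closed[OF r(2) mono])
      finally show ?thesis .
    qed
    moreover have "x \<in> carrier R" unfolding carrier_iff using x by (auto simp: T_def)
    ultimately show "x \<in> conductor_ideal K" by (simp add: conductor_ideal_def)
  qed
qed

lemma tpow_mem_conductor_iff: "tpow s \<in> conductor_ideal K \<longleftrightarrow> s \<in> T"
  unfolding conductor_ideal_K by auto

lemma gap: "w \<in> W \<Longrightarrow> w \<noteq> M \<Longrightarrow> M - w \<notin> H"
  using max_element_gap[OF max_emb] by (simp add: M_def)

lemma K_not_subset: "\<not> K \<subseteq> carrier R"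
proof -
  obtain w where "w \<in> W" "w \<noteq> M" using card_W unfolding M_def by (rule exists_nonmax)
  then have "tpow (M - w) \<in> K" "tpow (M - w) \<notin> carrier R" using tpow_mem_K gap by simp_all
  then show ?thesis by blast
qed

text \<open>
  \<open>N\<close> is a submodule that contains \<open>\<mm>K\<close> but neither 1 nor any \<open>t\<^bsup>M - w\<^esup> - z\<close> with \<open>z \<in> R\<close>: the exponent
  \<open>M - w\<close> is not a sum of a nonzero element of \<open>H\<close> and an exponent of \<open>K\<close>. So 1 and \<open>t\<^bsup>M - w\<^esup>\<close> belong to
  a minimal generating set.
\<close>

lemma all_or_none_if_basis:
  assumes B: "basis_modulo (conductor_ideal K) K (conductor_ideal K) B"
    and s: "s \<in> H" and w: "w \<in> W" "w \<noteq> M" and sw: "s + (M - w) \<in> H"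
  shows "s \<in> T"
proof -
  let ?g = "M - w"
  define N where "N = {x \<in> K. x $$ 0 = 0 \<and> x $$ ?g = 0}"
  have at0: "(r * x) $$ 0 = r $$ 0 * x $$ 0" if "r \<in> carrier R" "x \<in> K" for r x
    using nth_neg[OF that(1)] K_nth_neg[OF that(2)] by (rule mult_nth_0)
  have atg: "(r * x) $$ ?g = r $$ 0 * x $$ ?g" if r: "r \<in> carrier R" and x: "x \<in> K" for r x
  proof -
    have "(r * x) $$ ?g = r $$ 0 * x $$ (?g - 0)"
    proof (rule fls_mult_nth_single)
      fix j assume j: "r $$ j \<noteq> 0" "x $$ (?g - j) \<noteq> 0"
      have "j \<in> H" using j(1) r by (simp add: carrier_iff)
      moreover have "M - e - (?g - j) \<notin> H" using K_support[OF x j(2)] .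
      then have "w - e + j \<notin> H" by (simp add: algebra_simps)
      ultimately show "j = 0" using pseudo_frobenius_add[OF w(1)] by blast
    qed
    then show ?thesis by simp
  qed
  have "tpow s \<in> conductor_ideal K"
  proof (rule minimal_generator_annihilator[OF series_module_K one_mem_K B])
    have "1 \<notin> conductor_ideal K" using K_not_subset by (auto simp: conductor_ideal_def)
    then have "conductor_ideal K \<noteq> carrier R" using closed(2) by blast
    moreover have "conductor_ideal K \<subseteq> carrier R" by (auto simp: conductor_ideal_def)
    ultimately show "conductor_ideal K \<subseteq> nonunits"
      by (intro proper_subset_nonunits series_module_conductor_ideal)
    show "series_module (conductor_ideal K)" by (rule series_module_conductor_ideal)
    show "series_module N"
      by (rule series_moduleI) (auto simp: N_def series_moduleD series_module_K at0 atg)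
    show "d * y \<in> N" if "d \<in> nonunits" "y \<in> K" for d y
      using that at0[of d y] atg[of d y] series_moduleD(3)[OF series_module_K]
      by (simp add: N_def nonunits_def)
    show "tpow ?g - z \<notin> N" if "z \<in> carrier R" for z
      using that gap[OF w] by (auto simp: N_def carrier_iff)
    show "tpow s * tpow ?g \<in> carrier R" using sw by (simp add: tpow_mult)
  qed (use s tpow_mem_K[OF w(1)] in \<open>auto simp: N_def\<close>)
  then show ?thesis by (simp add: tpow_mem_conductor_iff)
qed

theorem ggl_semigroup:
  assumes ggl: "ggl_ring R (fractional_module K)"
  defines "\<cc> \<equiv> colon R (adjoin R K)"
  obtains n :: nat where
    "module_length R (quotient_module (self_module R) \<cc>) = enat n" "0 < n"
    "\<And>w. w \<in> W \<Longrightarrow> int n * e < w"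
    "apery_system e ((\<lambda>w. w - int n * e) ` W) (semigroup_gen (insert e ((\<lambda>w. w - int n * e) ` W)))"
    "symmetric_semigroup (semigroup_gen (insert e ((\<lambda>w. w - int n * e) ` W)))"
proof -
  note ggl = ggl_conductor[OF series_module_K one_mem_K K_nth_neg K_not_subset ggl]
  obtain B where B: "basis_modulo (conductor_ideal K) K (conductor_ideal K) B" using ggl(2) by blast
  note all_or_none = all_or_none_if_basis[OF B]
  have stable: "s + (M - w) \<in> T" if "s \<in> T" "w \<in> W" for s w
  proof -
    have "tpow s * tpow (M - w) \<in> conductor_ideal K"
      using ggl(1) tpow_mem_K[OF that(2)] that(1) by (simp add: tpow_mem_conductor_iff)
    then show ?thesis by (simp add: tpow_mult tpow_mem_conductor_iff)
  qed
  have add_T: "s + x \<in> T" if "s \<in> T" "x \<in> H" for s x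
  proof -
    have "(s + (M - w)) + x \<in> H" if "w \<in> W" for w
      by (rule add_mem) (use \<open>s \<in> T\<close> that \<open>x \<in> H\<close> in \<open>auto simp: T_def\<close>)
    then have "(s + x) + (M - w) \<in> H" if "w \<in> W" for w using that by (metis add.commute add.left_commute)
    moreover have "s + x \<in> H" by (rule add_mem) (use that in \<open>auto simp: T_def\<close>)
    ultimately show ?thesis by (simp add: T_def)
  qed
  have WT: "W \<subseteq> T"
    using generators_in_translate_set[OF max_emb card_W] all_or_none unfolding M_def T_def by blast
  define n where "n = (LEAST p. int p * e \<in> T)"
  have M_pos: "0 < M" using W_pos M_mem by blast
  have "int (nat M) * e \<in> T"
  proof -
    have "M * 1 \<le> M * e" using M_pos e_pos by (intro mult_left_mono) auto
    then have "M \<le> int (nat M) * e" using M_pos by simp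
    then have "int (nat M) * e + (M - w) \<in> H" if "w \<in> W" for w
      using le_M[OF that] e_pos by (intro conductor) linarith
    moreover have "int (nat M) * e \<in> H" using mem_iff_multiple[of "int (nat M) * e"] e_pos by simp
    ultimately show ?thesis by (simp add: T_def)
  qed
  then have nT: "int n * e \<in> T" unfolding n_def by (rule LeastI)
  have n_iff: "int p * e \<in> T \<longleftrightarrow> n \<le> p" for p :: nat
  proof
    show "int p * e \<in> T \<Longrightarrow> n \<le> p" unfolding n_def by (rule Least_le)
    assume "n \<le> p"
    then have "int (p - n) * e \<in> H" using mem_iff_multiple[of "int (p - n) * e"] e_pos by simp
    then have "int n * e + int (p - n) * e \<in> T" using nT by (intro add_T)
    moreover have "int n * e + int (p - n) * e = int p * e" using \<open>n \<le> p\<close>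
      by (simp add: of_nat_diff algebra_simps)
    ultimately show "int p * e \<in> T" by simp
  qed
  have HT: "H - T = (\<lambda>p. int p * e) ` {..<n}"
  proof
    show "H - T \<subseteq> (\<lambda>p. int p * e) ` {..<n}"
    proof
      fix x assume x: "x \<in> H - T"
      then have "x \<in> H" by simp
      then consider "0 \<le> x" "e dvd x" | w where "w \<in> W" "w \<le> x" "e dvd x - w" unfolding mem_iff by blast
      then show "x \<in> (\<lambda>p. int p * e) ` {..<n}"
      proof cases
        case 1
        then have "x = int (nat (x div e)) * e" using e_pos by (simp add: pos_imp_zdiv_nonneg_iff)
        moreover from this x n_iff[of "nat (x div e)"] have "nat (x div e) < n" by auto
        ultimately show ?thesis by blast
      next
        case 2
        then have "x - w \<in> H" using mem_iff_multiple[of "x - w"] by simp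
        then have "w + (x - w) \<in> T" using 2 WT by (intro add_T) auto
        with x show ?thesis by simp
      qed
    qed
    show "(\<lambda>p. int p * e) ` {..<n} \<subseteq> H - T"
      using n_iff mem_iff_multiple e_pos by auto
  qed
  have "inj_on (\<lambda>p. int p * e) {..<n}" using e_pos by (intro inj_onI) simp
  then have card: "card (H - T) = n" unfolding HT by (simp add: card_image)
  have fin: "finite (H - T)" unfolding HT by simp
  have TH: "T \<subseteq> H" by (auto simp: T_def)
  have c: "\<cc> = {x. \<forall>m. x $$ m \<noteq> 0 \<longrightarrow> m \<in> T}"
    using colon_adjoin_eq_conductor_ideal[OF ggl(1)] unfolding \<cc>_def conductor_ideal_K .
  have len: "module_length R (quotient_module (self_module R) \<cc>) = enat n"
    unfolding c using length_monomial_quotient[OF TH add_T fin] card by simp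
  note shifted = shifted_apery_system[OF max_emb card_W T_def[unfolded M_def]
      all_or_none[unfolded M_def] stable[unfolded M_def] n_iff]
  show thesis
    by (rule that[OF len shifted])
qed

end

section \<open>Reconstruction of the semigroup\<close>

theorem theorem5p6:
  fixes e n :: nat and h :: "nat \<Rightarrow> nat" and A A' H H' :: "int set"
    and R R' :: "'k::field fls ring" and K \<cc> :: "'k fls set"
  assumes "0 < e" and "e \<le> h 1" and "\<forall>i\<in>{1..<e - 1}. h i \<le> h (Suc i)"
    and "Gcd (insert e (h ` {1..e - 1})) = 1"
    and "A = insert (int e) ((\<lambda>i. int (h i)) ` {1..e - 1})"
    and "H = semigroup_gen A"
    and "R = semigroup_ring H"
    and "K = canonical_ideal A"
    and "\<cc> = colon R (adjoin R K)"
    and "ggl_ring R (fractional_module K)"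
    and "real e = ring_multiplicity R" and "e = embedding_dim R" and "e \<ge> 3"
    and "n = the_enat (module_length R (quotient_module (self_module R) \<cc>))"
    and "A' = insert (int e) ((\<lambda>i. int (h i) - int n * int e) ` {1..e - 1})"
    and "H' = semigroup_gen A'"
    and "R' = semigroup_ring H'"
  shows "module_length R (quotient_module (self_module R) \<cc>) = enat n \<and> n > 0 \<and>
    (\<forall>i\<in>{1..e - 1}. int (h i) - int n * int e > 0) \<and>
    symmetric_semigroup H' \<and> gorenstein_local R' \<and>
    apery (int e) H' = insert 0 ((\<lambda>i. int (h i) - int n * int e) ` {1..e - 1}) \<and>
    R = semigroup_ring
      (semigroup_gen (insert (int e) ((\<lambda>a. a + int n * int e) ` (apery (int e) H' - {0}))))"
proof -
  define W where "W = (\<lambda>i. int (h i)) ` {1..e - 1}"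
  have A: "A = insert (int e) W" using assms(5) by (simp add: W_def)
  have "e \<le> h i" if "1 \<le> i" "i \<le> e - 1" for i
    using that
  proof (induction i rule: dec_induct)
    case (step i)
    then have "h i \<le> h (Suc i)" using assms(3) by simp
    with step show ?case by simp
  qed (use assms(2) in simp)
  then have W_ge: "int e \<le> w" if "w \<in> W" for w using that by (auto simp: W_def)
  have fin: "finite W" by (simp add: W_def)
  have pos: "\<forall>a\<in>A. 0 < a" using W_ge assms(1) unfolding A by force
  have finA: "finite A" using fin by (simp add: A)
  interpret S: semigroup_series H R
    by unfold_locales (use assms(6,7) semigroup_gen_zero semigroup_gen_add semigroup_gen_nonneg[OF finA pos] in auto)
  have card_ge: "e \<le> card B" if "finite B" "\<forall>b\<in>B. 0 < b" "semigroup_gen B = H" for B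
    using S.embedding_dim_le_card[of B] that assms(12) by simp
  have card_W_le: "card W \<le> e - 1"
    unfolding W_def using card_image_le[of "{1..e - 1}" "\<lambda>i. int (h i)"] by simp
  have "e \<le> card A" using card_ge[OF finA pos] assms(6) by simp
  then have card_W: "card W = e - 1" and e_notin: "int e \<notin> W"
    using card_W_le fin assms(1) unfolding A by (auto simp: card_insert_if split: if_splits)
  have card_A: "card A = e" using card_W e_notin fin assms(1) by (simp add: A)
  have min: "w \<notin> semigroup_gen (insert (int e) W - {w})" if w: "w \<in> W" for w
  proof
    assume in_gen: "w \<in> semigroup_gen (insert (int e) W - {w})"
    let ?B = "A - {w}"
    have finB: "finite ?B" using finA by simp
    have "A \<subseteq> semigroup_gen ?B"
    proof
      fix a assume "a \<in> A"
      then show "a \<in> semigroup_gen ?B"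
        using in_gen semigroup_gen_generator[OF finB, of a] by (cases "a = w") (auto simp: A)
    qed
    then have "semigroup_gen A \<subseteq> semigroup_gen ?B"
      using finA by (intro semigroup_gen_least) (auto intro: semigroup_gen_zero semigroup_gen_add)
    moreover have "semigroup_gen ?B \<subseteq> semigroup_gen A" using finA by (intro semigroup_gen_mono) auto
    ultimately have "e \<le> card ?B" using card_ge[OF finB] pos assms(6) by auto
    moreover have "card ?B = e - 1" using w finA card_A by (simp add: A)
    ultimately show False using assms(1) by simp
  qed
  have H: "H = semigroup_gen (insert (int e) W)" using assms(6) A by simp
  note sys = minimal_generators_apery_system[OF assms(1) fin card_W _ e_notin min, folded H]
  interpret max_embedding_dim "int e" W H R
  proof (intro max_embedding_dim.intro max_embedding_dim_axioms.intro S.semigroup_series_axioms)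
    have Wp: "0 < w" if "w \<in> W" for w using W_ge[OF that] assms(1) by simp
    show "apery_system (int e) W H" by (rule sys(1)) (use Wp in auto)
    show "u + v - int e \<in> H" if "u \<in> W" "v \<in> W" for u v by (rule sys(2)) (use Wp that in auto)
    show "2 \<le> card W" using card_W assms(13) by simp
  qed
  have K: "canonical_ideal A = local.K" unfolding K_def A ..
  have ggl: "ggl_ring R (fractional_module local.K)" using assms(8,10) K by simp
  obtain n' :: nat where n': "module_length R (quotient_module (self_module R) \<cc>) = enat n'" "0 < n'"
    "\<And>w. w \<in> W \<Longrightarrow> int n' * int e < w"
    "apery_system (int e) ((\<lambda>w. w - int n' * int e) ` W)
       (semigroup_gen (insert (int e) ((\<lambda>w. w - int n' * int e) ` W)))"
    "symmetric_semigroup (semigroup_gen (insert (int e) ((\<lambda>w. w - int n' * int e) ` W)))"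
    using ggl_semigroup[OF ggl] assms(8,9) K by metis
  have n: "n = n'" using assms(14) n'(1) by simp
  define W' where "W' = (\<lambda>w. w - int n * int e) ` W"
  have W'_eq: "W' = (\<lambda>i. int (h i) - int n * int e) ` {1..e - 1}"
    by (auto simp: W'_def W_def)
  have H': "H' = semigroup_gen (insert (int e) W')" using assms(15,16) W'_eq by simp
  interpret S': apery_system "int e" W' H' using n'(4) unfolding n[symmetric] W'_def[symmetric] H'[symmetric] .
  have W'_ne: "W' \<noteq> {}" using W_nonempty by (simp add: W'_def)
  interpret R': numerical_semigroup_series H' R' "Max W' - int e + 1"
  proof (intro numerical_semigroup_series.intro semigroup_series.intro numerical_semigroup_series_axioms.intro)
    show "x \<in> H'" if "Max W' - int e + 1 \<le> x" for x
      by (rule S'.mem_if_large[OF W'_ne]) (use that in simp)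
  qed (fact S'.zero_mem S'.add_mem S'.nonneg assms(17))+
  have sym: "symmetric_semigroup H'" using n'(5) unfolding n[symmetric] W'_def[symmetric] H'[symmetric] .
  have "m \<in> H' \<longleftrightarrow> frobenius H' - m \<notin> H'" for m
    using sym unfolding symmetric_semigroup_def by (rule spec)
  then have gor: "gorenstein_local R'" by (rule R'.gorenstein_if_symmetric)
  have ap: "apery (int e) H' = insert 0 W'" by (rule S'.apery_eq)
  have "0 \<notin> W'" using S'.W_pos by blast
  then have "apery (int e) H' - {0} = W'" unfolding ap by blast
  moreover have "(\<lambda>a. a + int n * int e) ` W' = W" by (simp add: W'_def image_image)
  ultimately have "R = semigroup_ring (semigroup_gen (insert (int e) ((\<lambda>a. a + int n * int e) ` (apery (int e) H' - {0}))))"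
    using assms(7) H by simp
  then show ?thesis
    using n'(1,2,3) n sym gor ap unfolding W'_eq by (auto simp: W_def)
qed

end
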